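(* Let $T_1\subset(0,\infty)$ and $T_2\subset\mathbb R^N$ be compact intervals and $T=T_1\times T_2$. (i) For any fixed $x_0\in\mathbb R^N$, $\{u(t,x_0):t\in T_1\}$ has a square-integrable local time $L^{x_0}(v,T_1)$ on $T_1$ if and only if $\alpha d<1$. (ii) For any fixed $t_0>0$, $\{u(t_0,x):x\in T_2\}$ has a square-integrable local time $L_{t_0}(v,T_2)$ on $T_2$ if and only if $\alpha d<N$. (iii) $\{u(t,x):(t,x)\in T\}$ has a square-integrable local time $L(v,T)$ on $T$ if and only if $\alpha d<1+N$.
   Context: Fix integers $N\ge1$, $d\ge1$, and $H\in[1/2,1)$, $\beta\in(0,N)$. Let $h_\beta:\mathbb R^N\to[0,\infty)$ be measurable with $c_1|\xi|^{-\beta}\le h_\beta(\xi)\le c_2|\xi|^{-\beta}$ for constants $0<c_1\le c_2<\infty$. Assume $N-2H-1<\beta<N-2H+1$ and set $\alpha=\frac{2H+1-N+\beta}{2}\in(0,1)$. For $t\ge0$, $x\in\mathbb R^N$, $\tau\in\mathbb R$, $\xi\in\mathbb R^N$ let $\mathcal F g_{t,x}(\tau,\xi)=\frac{e^{-ix\cdot\xi}}{2|\xi|}\Big(\frac{e^{-it\tau}-e^{it|\xi|}}{\tau+|\xi|}-\frac{e^{-it\tau}-e^{-it|\xi|}}{\tau-|\xi|}\Big)$. The field $u=(u_1,\dots,u_d)$ is the random field solution of $\partial_t^2u_j=\Delta u_j+\dot W_j$ on $[0,\infty)\times\mathbb R^N$ with zero initial data, where $\dot W_j$ are i.i.d. centered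 Gaussian noises with formal covariance $\rho_H(t-s)f_\beta(x-y)$ ($\rho_H=\delta$ if $H=1/2$, $\rho_H(r)=|r|^{2H-2}$ if $H>1/2$, $f_\beta$ the Fourier transform of $h_\beta(\xi)d\xi$). Concretely, $u_1,\dots,u_d$ are i.i.d. centered Gaussian random fields with $\mathbb E[u_1(t,x)u_1(s,y)]=c_H\int_{\mathbb R}\int_{\mathbb R^N}\mathcal F g_{t,x}(\tau,\xi)\overline{\mathcal F g_{s,y}(\tau,\xi)}\,|\tau|^{1-2H}h_\beta(\xi)\,d\xi\,d\tau$ for a constant $c_H>0$. Local times: for an $\mathbb R^d$-valued random field $X=\{X(z):z\in S\}$, $S\subset\mathbb R^k$ Borel, with occupation measure $\nu_S(B)=\lambda_k\{z\in S:X(z)\in B\}$, $X$ has a local time on $S$ if a.s. $\nu_S\ll\lambda_d$; a version $L(v,S)$ of the Radon–Nikodym derivative is a local time. It is square-integrable if $L(\cdot,S)\in L^2(\lambda_d\times\mathbb P)$. *)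

theory Defs
  imports "HOL-Probability.Probability"
begin

definition centered_gaussian_rv :: "'a measure \<Rightarrow> ('a \<Rightarrow> real) \<Rightarrow> bool" where
  "centered_gaussian_rv M X \<longleftrightarrow> X \<in> borel_measurable M \<and>
     (\<exists>v\<ge>0. \<forall>\<theta>. char (distr M borel X) \<theta> = complex_of_real (exp (- (v * \<theta>\<^sup>2) / 2)))"

definition centered_gaussian_field :: "'a measure \<Rightarrow> 'i set \<Rightarrow> ('i \<Rightarrow> 'a \<Rightarrow> real) \<Rightarrow> bool" where
  "centered_gaussian_field M I Z \<longleftrightarrow>
     (\<forall>F c. finite F \<longrightarrow> F \<subseteq> I \<longrightarrow> centered_gaussian_rv M (\<lambda>\<omega>. \<Sum>z\<in>F. c z * Z z \<omega>))"

section \<open>The space-time Fourier transform of the wave kernel\<close>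

definition Fg :: "real \<Rightarrow> real^'n \<Rightarrow> real \<Rightarrow> real^'n \<Rightarrow> complex" where
  "Fg t x \<tau> \<xi> =
     exp (- \<i> * of_real (x \<bullet> \<xi>)) / (2 * of_real (norm \<xi>)) *
     ((exp (- \<i> * of_real (t * \<tau>)) - exp (\<i> * of_real (t * norm \<xi>))) / of_real (\<tau> + norm \<xi>)
      - (exp (- \<i> * of_real (t * \<tau>)) - exp (- \<i> * of_real (t * norm \<xi>))) / of_real (\<tau> - norm \<xi>))"

definition wave_cov :: "real \<Rightarrow> real \<Rightarrow> (real^'n \<Rightarrow> real) \<Rightarrow> real \<times> (real^'n) \<Rightarrow> real \<times> (real^'n) \<Rightarrow> complex" where
  "wave_cov cH H h p q =
     of_real cH * (LINT \<tau>|lborel. LINT \<xi>|lborel.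
        Fg (fst p) (snd p) \<tau> \<xi> * cnj (Fg (fst q) (snd q) \<tau> \<xi>)
        * of_real (\<bar>\<tau>\<bar> powr (1 - 2 * H)) * of_real (h \<xi>))"

definition occupation_measure :: "'k::euclidean_space set \<Rightarrow> ('k \<Rightarrow> 'b::euclidean_space) \<Rightarrow> 'b measure" where
  "occupation_measure S f = distr (restrict_space lborel S) lborel f"

definition has_sq_int_local_time ::
  "'a measure \<Rightarrow> ('k::euclidean_space \<Rightarrow> 'a \<Rightarrow> 'b::euclidean_space) \<Rightarrow> 'k set \<Rightarrow> bool" where
  "has_sq_int_local_time M X S \<longleftrightarrow>
     (\<exists>L :: 'b \<Rightarrow> 'a \<Rightarrow> real.
        (\<lambda>(v, \<omega>). L v \<omega>) \<in> borel_measurable (lborel \<Otimes>\<^sub>M M) \<and>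
        (\<integral>\<^sup>+ p. ennreal ((case p of (v, \<omega>) \<Rightarrow> L v \<omega>)\<^sup>2) \<partial>(lborel \<Otimes>\<^sub>M M)) < \<infinity> \<and>
        (AE \<omega> in M. (\<lambda>z. X z \<omega>) \<in> borel_measurable (restrict_space lborel S) \<and>
           occupation_measure S (\<lambda>z. X z \<omega>) = density lborel (\<lambda>v. ennreal (L v \<omega>))))"

end

theory Submission
  imports Defs
begin

text \<open>
A square-integrable local time on \<open>S\<close> exists iff the double integral over \<open>S \<times> S\<close> of
\<open>\<sigma>(p, q) powr - d\<close> is finite, where \<open>\<sigma>(p, q)\<^sup>2\<close> is the variance of \<open>u\<^sub>1(p) - u\<^sub>1(q)\<close>. Since
\<open>\<sigma>(p, q)\<close> is comparable to \<open>dist p q powr \<alpha>\<close>, this means \<open>\<alpha> d < dim S\<close>.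

Upper bound for \<open>\<sigma>\<close>: the time derivative of the Fourier transform of the kernel is bounded by the two
resonances \<open>min b (2 / \<bar>\<tau> \<plusminus> r\<bar>)\<close> with \<open>r = norm \<xi>\<close>, and the function itself by \<open>1 / r\<close> times these. Lower bound: close to
the resonance \<open>\<tau> = r\<close> the transform is essentially \<open>t / (2 r)\<close> times a phase, and the phases of \<open>p\<close> and
\<open>q\<close> are nearly opposite on a ball of frequencies of size \<open>1 / dist p q\<close>.

If the double integral is finite, the averages of the occupation measure over dyadic cells form an
\<open>L\<^sup>2\<close>-bounded martingale whose limit is the local time. Conversely, a local time \<open>L\<close> in \<open>L\<^sup>2\<close> bounds the expected
occupation of the strip \<open>\<bar>v - w\<bar> \<le> \<epsilon>\<close> by \<open>O(\<epsilon> ^ d)\<close>.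
\<close>

section \<open>Power integrals\<close>

text \<open>An L^2 criterion sees the field only through pairs of parameters, so a two-sided
  variance bound for increments drives both directions. The exponent is a count of homogeneity:
  integrating in \<open>\<tau>\<close> leaves \<open>norm \<xi> powr - g\<close> with
  \<open>g = 2 * H + 1 + \<beta>\<close>, against the square of
  \<open>min 1 (\<rho> * norm \<xi>)\<close>. In dimension N this scales like
  \<open>\<rho> powr (g - N)\<close>, and \<open>g - N = 2 * \<alpha>\<close>. The two bounds on
  \<open>\<beta>\<close> relative to N say \<open>N < g < N + 2\<close>, that is, convergence at
  infinity and at the origin. The obstacle is the lower bound. The resonant amplitude
  \<open>t / (2 * r)\<close> dominates the errors only for times at least some \<open>a > 0\<close>
  and for \<open>r\<close> large compared with \<open>1 / a\<close>. As the frequencies in use have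
  size \<open>1 / \<rho>\<close>, the variance is bounded below only for
  \<open>\<rho> \<le> a / 4\<close>, and sufficiency has to be argued on small pieces of the
  parameter set. Necessity rests on the upper variance bound alone, which holds at all
  distances.\<close>

lemma nn_integral_lborel_scaleR:
  fixes f :: "'k::euclidean_space \<Rightarrow> ennreal"
  assumes [measurable]: "f \<in> borel_measurable borel" and c: "0 < c"
  shows "ennreal (c ^ DIM('k)) * (\<integral>\<^sup>+x. f (c *\<^sub>R x) \<partial>lborel) = (\<integral>\<^sup>+x. f x \<partial>lborel)"
proof -
  have "(\<integral>\<^sup>+x. f x \<partial>lborel)
      = (\<integral>\<^sup>+x. f x \<partial>density (distr lborel borel (\<lambda>x. 0 + c *\<^sub>R x)) (\<lambda>_. ennreal (\<bar>c\<bar>^DIM('k))))"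
    using lborel_affine[of c "0::'k"] c by simp
  also have "\<dots> = ennreal (c ^ DIM('k)) * (\<integral>\<^sup>+x. f (c *\<^sub>R x) \<partial>lborel)"
    using c by (simp add: nn_integral_density nn_integral_distr nn_integral_cmult)
  finally show ?thesis by simp
qed

lemma dyadic_shell_ge1:
  assumes "1 \<le> (x::real)"
  obtains n :: nat where "2 ^ n \<le> x" "x < 2 ^ Suc n"
proof -
  define n where "n = nat \<lfloor>log 2 x\<rfloor>"
  have "real n \<le> log 2 x" "log 2 x < real n + 1"
    using assms by (auto simp: n_def)
  then have "2 powr real n \<le> x" "x < 2 powr (real n + 1)"
    using assms by (auto simp: le_log_iff log_less_iff)
  then show ?thesis
    using that[of n] by (simp add: powr_realpow powr_add)
qed

lemma le_suminf_ennreal: "(f :: nat \<Rightarrow> ennreal) n \<le> (\<Sum>n. f n)"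
  using sum_le_suminf[of f "{n}"] by simp

lemma cball_measurable [measurable]: "cball (c::'k::euclidean_space) r \<in> sets borel"
  by simp

lemma emeasure_lborel_cball_lt_top: "emeasure lborel (cball (c::'k::euclidean_space) r) < \<infinity>"
  using emeasure_lborel_cball_finite[of c r] by auto

text \<open>Majorizing by constants on full dyadic balls rather than shells costs only a constant,
  because the resulting series is geometric with ratio \<open>2 powr (s - DIM('k))\<close>, below 1.
  The origin does no harm, since \<open>0 powr - s\<close> is 0.\<close>

lemma nn_integral_norm_powr_cball_finite:
  assumes s: "0 \<le> s" "s < real DIM('k::euclidean_space)"
  shows "(\<integral>\<^sup>+x\<in>cball (0::'k) 1. ennreal (norm x powr - s) \<partial>lborel) < \<infinity>"
proof -
  let ?V = "emeasure lborel (cball (0::'k) 1)"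
  define q where "q = 2 powr (s - real DIM('k))"
  have q: "0 < q" "q < 1" using s by (auto simp: q_def powr_less_one)
  have V: "emeasure lborel (cball (0::'k) (1 / 2 ^ n)) = ennreal (1 / 2 ^ (n * DIM('k))) * ?V" for n
    by (simp add: emeasure_cball ennreal_mult'[symmetric] power_mult[symmetric] power_divide divide_simps)
  have "(\<integral>\<^sup>+x\<in>cball (0::'k) 1. ennreal (norm x powr - s) \<partial>lborel)
     \<le> (\<integral>\<^sup>+x. (\<Sum>n. ennreal (2 powr (s * real (Suc n))) * indicator (cball (0::'k) (1 / 2 ^ n)) x) \<partial>lborel)"
  proof (intro nn_integral_mono)
    fix x :: 'k
    show "ennreal (norm x powr - s) * indicator (cball 0 1) x
        \<le> (\<Sum>n. ennreal (2 powr (s * real (Suc n))) * indicator (cball (0::'k) (1 / 2 ^ n)) x)"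
    proof (cases "x \<in> cball 0 1 \<and> x \<noteq> 0")
      case True
      then have "1 \<le> 1 / norm x" by (simp add: field_simps)
      then obtain n where n: "2 ^ n \<le> 1 / norm x" "1 / norm x < 2 ^ Suc n"
        by (rule dyadic_shell_ge1)
      have "norm x powr - s = (1 / norm x) powr s"
        using True by (simp add: powr_minus powr_divide divide_simps)
      also have "\<dots> \<le> (2 ^ Suc n) powr s"
        using n s True by (intro powr_mono2) auto
      also have "\<dots> = 2 powr (s * real (Suc n))"
        by (simp add: powr_realpow[symmetric] powr_powr mult.commute del: power_Suc of_nat_Suc)
      finally have "ennreal (norm x powr - s) * indicator (cball 0 1) x
         \<le> ennreal (2 powr (s * real (Suc n))) * indicator (cball (0::'k) (1 / 2 ^ n)) x"
        using True n by (auto simp: indicator_def field_simps ennreal_leI)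
      also have "\<dots> \<le> (\<Sum>n. ennreal (2 powr (s * real (Suc n))) * indicator (cball (0::'k) (1 / 2 ^ n)) x)"
        by (rule le_suminf_ennreal)
      finally show ?thesis .
    next
      case False
      then have "ennreal (norm x powr - s) * indicator (cball 0 1) x = 0" by auto
      then show ?thesis by (metis zero_le)
    qed
  qed
  also have "\<dots> = (\<Sum>n. ennreal (2 powr (s * real (Suc n))) * (ennreal (1 / 2 ^ (n * DIM('k))) * ?V))"
    by (subst nn_integral_suminf) (simp_all add: nn_integral_cmult V del: of_nat_Suc)
  also have "\<dots> = (\<Sum>n. ennreal (q ^ n) * (ennreal (2 powr s) * ?V))"
  proof (intro suminf_cong)
    fix n
    have "1 / 2 ^ (n * DIM('k)) = 2 powr (- (real n * real DIM('k)))"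
      by (simp add: powr_minus_divide powr_realpow flip: of_nat_mult)
    moreover have "q ^ n * 2 powr s = 2 powr ((s - real DIM('k)) * real n + s)"
      using q unfolding q_def by (subst powr_realpow[symmetric]) (simp_all add: powr_powr powr_add)
    ultimately have "2 powr (s * real (Suc n)) * (1 / 2 ^ (n * DIM('k))) = q ^ n * 2 powr s"
      by (simp add: powr_add[symmetric] algebra_simps)
    then show "ennreal (2 powr (s * real (Suc n))) * (ennreal (1 / 2 ^ (n * DIM('k))) * ?V)
       = ennreal (q ^ n) * (ennreal (2 powr s) * ?V)"
      using q by (metis ennreal_mult' mult.assoc powr_ge_zero zero_le_power less_imp_le)
  qed
  also have "\<dots> = (\<Sum>n. ennreal (q ^ n)) * (ennreal (2 powr s) * ?V)"
    by simp
  also have "\<dots> < \<infinity>"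
  proof -
    have "summable (\<lambda>n. q ^ n)" using q by (intro summable_geometric) auto
    then have "(\<Sum>n. ennreal (q ^ n)) < \<infinity>"
      using q by (simp add: suminf_ennreal2 less_top[symmetric])
    then show ?thesis using emeasure_lborel_cball_lt_top[of "0::'k" 1]
      by (auto simp: ennreal_mult_less_top)
  qed
  finally show ?thesis .
qed

text \<open>The same majorization with growing balls of radius \<open>2 ^ Suc n\<close>; the ratio
  is now \<open>2 powr (DIM('k) - s)\<close>.\<close>

lemma nn_integral_norm_powr_tail_finite:
  assumes s: "real DIM('k::euclidean_space) < s"
  shows "(\<integral>\<^sup>+x\<in>{x::'k. 1 \<le> norm x}. ennreal (norm x powr - s) \<partial>lborel) < \<infinity>"
proof -
  let ?V = "emeasure lborel (cball (0::'k) 1)"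
  define q where "q = 2 powr (real DIM('k) - s)"
  have q: "0 < q" "q < 1" using s by (auto simp: q_def powr_less_one)
  have V: "emeasure lborel (cball (0::'k) (2 ^ Suc n)) = ennreal (2 ^ (Suc n * DIM('k))) * ?V" for n
    by (simp add: emeasure_cball ennreal_mult'[symmetric] power_mult[symmetric] del: power_Suc)
  have "(\<integral>\<^sup>+x\<in>{x::'k. 1 \<le> norm x}. ennreal (norm x powr - s) \<partial>lborel)
     \<le> (\<integral>\<^sup>+x. (\<Sum>n. ennreal (2 powr (- s * real n)) * indicator (cball (0::'k) (2 ^ Suc n)) x) \<partial>lborel)"
  proof (intro nn_integral_mono)
    fix x :: 'k
    show "ennreal (norm x powr - s) * indicator {x. 1 \<le> norm x} x
        \<le> (\<Sum>n. ennreal (2 powr (- s * real n)) * indicator (cball (0::'k) (2 ^ Suc n)) x)"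
    proof (cases "1 \<le> norm x")
      case True
      then obtain n where n: "2 ^ n \<le> norm x" "norm x < 2 ^ Suc n"
        by (rule dyadic_shell_ge1)
      have "norm x powr - s \<le> (2 ^ n) powr - s"
        using n s by (intro powr_mono2') auto
      also have "\<dots> = 2 powr (- s * real n)"
        by (simp add: powr_realpow[symmetric] powr_powr mult.commute)
      finally have "ennreal (norm x powr - s) * indicator {x. 1 \<le> norm x} x
         \<le> ennreal (2 powr (- s * real n)) * indicator (cball (0::'k) (2 ^ Suc n)) x"
        using True n by (auto simp: indicator_def ennreal_leI)
      also have "\<dots> \<le> (\<Sum>n. ennreal (2 powr (- s * real n)) * indicator (cball (0::'k) (2 ^ Suc n)) x)"
        by (rule le_suminf_ennreal)
      finally show ?thesis .
    qed auto
  qed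
  also have "\<dots> = (\<Sum>n. ennreal (2 powr (- s * real n)) * (ennreal (2 ^ (Suc n * DIM('k))) * ?V))"
    by (subst nn_integral_suminf) (simp_all add: nn_integral_cmult V del: power_Suc mult_Suc)
  also have "\<dots> = (\<Sum>n. ennreal (q ^ n) * (ennreal (2 ^ DIM('k)) * ?V))"
  proof (intro suminf_cong)
    fix n
    have "2 ^ (n * DIM('k)) = 2 powr (real n * real DIM('k))"
      by (simp add: powr_realpow flip: of_nat_mult)
    moreover have "q ^ n = 2 powr ((real DIM('k) - s) * real n)"
      using q unfolding q_def by (subst powr_realpow[symmetric]) (simp_all add: powr_powr)
    ultimately have "2 powr (- s * real n) * (2 ^ (Suc n * DIM('k))) = q ^ n * 2 ^ DIM('k)"
      by (simp add: power_add powr_add[symmetric] algebra_simps)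
    then show "ennreal (2 powr (- s * real n)) * (ennreal (2 ^ (Suc n * DIM('k))) * ?V)
       = ennreal (q ^ n) * (ennreal (2 ^ DIM('k)) * ?V)"
      using q by (metis ennreal_mult' mult.assoc powr_ge_zero zero_le_power less_imp_le)
  qed
  also have "\<dots> = (\<Sum>n. ennreal (q ^ n)) * (ennreal (2 ^ DIM('k)) * ?V)"
    by simp
  also have "\<dots> < \<infinity>"
  proof -
    have "summable (\<lambda>n. q ^ n)" using q by (intro summable_geometric) auto
    then have "(\<Sum>n. ennreal (q ^ n)) < \<infinity>"
      using q by (simp add: suminf_ennreal2 less_top[symmetric])
    then show ?thesis using emeasure_lborel_cball_lt_top[of "0::'k" 1]
      by (auto simp: ennreal_mult_less_top)
  qed
  finally show ?thesis .
qed

lemma nn_integral_norm_powr_cball_scale: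
  assumes R: "0 < R"
  shows "(\<integral>\<^sup>+x\<in>cball (0::'k::euclidean_space) R. ennreal (norm x powr - s) \<partial>lborel)
     = ennreal (R powr (real DIM('k) - s)) * (\<integral>\<^sup>+x\<in>cball (0::'k) 1. ennreal (norm x powr - s) \<partial>lborel)"
proof -
  let ?f = "\<lambda>R x. ennreal (norm x powr - s) * indicator (cball (0::'k) R) x"
  have eq: "?f R (R *\<^sub>R x) = ennreal (R powr - s) * ?f 1 x" for x
    using R by (auto simp: indicator_def powr_mult ennreal_mult' field_simps)
  have "(\<integral>\<^sup>+x. ?f R x \<partial>lborel) = ennreal (R ^ DIM('k)) * (\<integral>\<^sup>+x. ?f R (R *\<^sub>R x) \<partial>lborel)"
    using R by (intro nn_integral_lborel_scaleR[symmetric]; measurable)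
  also have "\<dots> = ennreal (R ^ DIM('k)) * (ennreal (R powr - s) * (\<integral>\<^sup>+x. ?f 1 x \<partial>lborel))"
    by (simp only: eq) (subst nn_integral_cmult; simp)
  also have "\<dots> = ennreal (R ^ DIM('k) * R powr - s) * (\<integral>\<^sup>+x. ?f 1 x \<partial>lborel)"
    using R by (subst ennreal_mult) (simp_all add: mult.assoc)
  also have "R ^ DIM('k) * R powr - s = R powr (real DIM('k) - s)"
    using R by (simp add: powr_realpow[symmetric] powr_add[symmetric])
  finally show ?thesis .
qed

text \<open>Self-similarity replaces radial integration: halving the radius multiplies the integral
  by a factor that is at least 1. If the integral over the unit ball were finite, the annulus
  \<open>A\<close> would carry none of it, although the integrand is positive there and
  \<open>A\<close> has positive volume.\<close>

lemma nn_integral_norm_powr_cball_infinite: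
  assumes s: "real DIM('k::euclidean_space) \<le> s" and R: "0 < R"
  shows "(\<integral>\<^sup>+x\<in>cball (0::'k) R. ennreal (norm x powr - s) \<partial>lborel) = \<infinity>"
proof -
  let ?I = "\<lambda>A. \<integral>\<^sup>+x\<in>A. ennreal (norm x powr - s) \<partial>(lborel :: 'k measure)"
  define A where "A = cball (0::'k) 1 - cball 0 (1/2)"
  have [measurable]: "A \<in> sets borel" by (auto simp: A_def)
  have "?I (cball 0 1) = \<infinity>"
  proof (rule ccontr)
    assume fin: "?I (cball 0 1) \<noteq> \<infinity>"
    have "ennreal ((1/2) powr (real DIM('k) - s)) * ?I (cball 0 1) + ?I A = ?I (cball 0 (1/2)) + ?I A"
      by (subst nn_integral_norm_powr_cball_scale[of "1/2"]) auto
    also have "\<dots> = ?I (cball 0 1)"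
      by (subst nn_integral_add[symmetric]) (auto intro!: nn_integral_cong simp: A_def indicator_def)
    finally have eq: "ennreal ((1/2) powr (real DIM('k) - s)) * ?I (cball 0 1) + ?I A = ?I (cball 0 1)" .
    have "(1/2::real) powr 0 \<le> (1/2) powr (real DIM('k) - s)"
      using s by (intro powr_mono') auto
    then have "1 \<le> ennreal ((1/2) powr (real DIM('k) - s))" by simp
    then have "1 * ?I (cball 0 1) + ?I A \<le> ennreal ((1/2) powr (real DIM('k) - s)) * ?I (cball 0 1) + ?I A"
      by (intro add_right_mono mult_right_mono) auto
    then have "?I (cball 0 1) + ?I A \<le> ?I (cball 0 1) + 0"
      unfolding eq by simp
    then have "?I A \<le> 0" using fin by (subst (asm) ennreal_add_left_cancel_le) simp_all
    then have "?I A = 0" by simp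
    moreover have "?I A = 0 \<longleftrightarrow> (AE x in lborel. ennreal (norm x powr - s) * indicator A (x::'k) = 0)"
      by (rule nn_integral_0_iff_AE) auto
    moreover have "ennreal (norm x powr - s) * indicator A x = 0 \<longleftrightarrow> x \<notin> A" for x :: 'k
      by (cases "x = 0") (auto simp: A_def indicator_def)
    ultimately have "AE x in lborel. x \<notin> A" by simp
    then have "emeasure lborel A = 0"
      by (subst (asm) AE_iff_measurable[where N=A]) auto
    moreover have "emeasure lborel A = emeasure lborel (cball (0::'k) 1) - emeasure lborel (cball (0::'k) (1/2))"
      unfolding A_def using emeasure_lborel_cball_lt_top[of "0::'k" "1/2"]
      by (intro emeasure_Diff) auto
    moreover have "emeasure lborel (cball (0::'k) (1/2)) < emeasure lborel (cball (0::'k) 1)"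
      by (simp add: emeasure_cball ennreal_less_iff power_divide divide_less_eq)
    ultimately show False by (metis diff_gt_0_iff_gt_ennreal less_irrefl)
  qed
  then show ?thesis
    using R by (subst nn_integral_norm_powr_cball_scale) (auto simp: ennreal_mult_top)
qed

text \<open>The dilation \<open>x \<mapsto> x / r\<close> makes the integral exactly homogeneous of degree \<open>g - N\<close> in \<open>r\<close>.\<close>
lemma nn_integral_min_norm_powr:
  assumes g: "real DIM('k::euclidean_space) < g" "g < real DIM('k) + 2" "2 \<le> g"
  shows "\<exists>C\<ge>0. \<forall>r\<ge>0. (\<integral>\<^sup>+x. ennreal ((min 1 (r * norm (x::'k)))\<^sup>2 * norm x powr - g) \<partial>lborel)
           \<le> ennreal (C * r powr (g - real DIM('k)))"
proof -
  let ?f = "\<lambda>r x. ennreal ((min 1 (r * norm (x::'k)))\<^sup>2 * norm x powr - g)"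
  let ?J = "\<integral>\<^sup>+x. ?f 1 x \<partial>lborel"
  \<comment> \<open>The pieces are integrable for opposite reasons: near 0 the squared minimum
    supplies two powers and \<open>g - 2\<close> lies below the dimension, while at infinity
    \<open>g\<close> lies above it.\<close>
  have "?f 1 x \<le> ennreal (norm x powr - (g - 2)) * indicator (cball 0 1) x
          + ennreal (norm x powr - g) * indicator {x. 1 \<le> norm x} x" for x
  proof (cases "1 \<le> norm x")
    case False
    have "(min 1 (1 * norm x))\<^sup>2 * norm x powr - g = norm x powr - (g - 2)"
      using False by (cases "x = 0") (simp_all add: powr_add powr_diff powr_minus divide_simps)
    then show ?thesis using False by simp
  qed auto
  then have "?J \<le> (\<integral>\<^sup>+x. ennreal (norm x powr - (g - 2)) * indicator (cball (0::'k) 1) x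
          + ennreal (norm x powr - g) * indicator {x. 1 \<le> norm x} x \<partial>lborel)"
    by (intro nn_integral_mono)
  also have "\<dots> < \<infinity>"
    using nn_integral_norm_powr_cball_finite[of "g - 2", where 'k='k]
      nn_integral_norm_powr_tail_finite[of g, where 'k='k] g
    by (subst nn_integral_add; (measurable | simp))
  finally obtain C where C: "C \<ge> 0" "?J = ennreal C"
    by (cases ?J) auto
  show ?thesis
  proof (intro exI[of _ C] conjI allI impI C)
    fix r :: real assume r: "0 \<le> r"
    show "(\<integral>\<^sup>+x. ?f r x \<partial>lborel) \<le> ennreal (C * r powr (g - real DIM('k)))"
    proof (cases "r = 0")
      case False
      then have r: "0 < r" using r by simp
      let ?c = "1 / r"
      have eq: "?f r (?c *\<^sub>R x) = ennreal (r powr g) * ?f 1 x" for x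
        using r by (simp add: powr_mult powr_divide powr_minus field_simps flip: ennreal_mult')
      have "(\<integral>\<^sup>+x. ?f r x \<partial>lborel) = ennreal (?c ^ DIM('k)) * (\<integral>\<^sup>+x. ?f r (?c *\<^sub>R x) \<partial>lborel)"
        using r by (intro nn_integral_lborel_scaleR[symmetric]; measurable)
      also have "\<dots> = ennreal (?c ^ DIM('k)) * (ennreal (r powr g) * ?J)"
        by (simp only: eq) (subst nn_integral_cmult; simp)
      also have "\<dots> = ennreal (C * (?c ^ DIM('k) * r powr g))"
        using r C by (simp add: ennreal_mult'[symmetric] mult_ac)
      also have "?c ^ DIM('k) * r powr g = r powr (g - real DIM('k))"
        using r by (simp add: powr_diff powr_realpow power_divide)
      finally show ?thesis by simp
    qed simp
  qed
qed

section \<open>Upper bound for the kernel\<close>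

text \<open>Bound for a quotient \<open>(iexp x - iexp y) / \<eta>\<close> whose phases differ by at
  most \<open>b\<close> times the modulus of \<open>\<eta>\<close>: the Lipschitz estimate gives
  \<open>b\<close>, the trivial one gives 2 over that modulus. At \<open>\<eta> = 0\<close> division
  by zero gives 0 instead of the limit \<open>b\<close>; these points are null sets in
  \<open>\<tau>\<close>.\<close>

definition resonance_bound :: "real \<Rightarrow> real \<Rightarrow> real" where
  "resonance_bound b \<eta> = min b (2 / \<bar>\<eta>\<bar>)"

lemma resonance_bound_nonneg [simp]: "0 \<le> b \<Longrightarrow> 0 \<le> resonance_bound b \<eta>"
  by (simp add: resonance_bound_def)

lemma resonance_bound_measurable [measurable]: "resonance_bound b \<in> borel_measurable borel"
  unfolding resonance_bound_def by measurable

lemma nn_integral_resonance_bound_sq_finite: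
  "(\<integral>\<^sup>+\<tau>. ennreal ((resonance_bound b \<tau>)\<^sup>2) \<partial>lborel) < \<infinity>" if "0 \<le> b"
proof -
  have "ennreal ((resonance_bound b \<tau>)\<^sup>2) \<le> ennreal (b\<^sup>2) * indicator (cball 0 1) \<tau>
          + 4 * (ennreal (norm \<tau> powr - 2) * indicator {x. 1 \<le> norm x} \<tau>)" for \<tau> :: real
  proof (cases "1 \<le> \<bar>\<tau>\<bar>")
    case True
    have "(resonance_bound b \<tau>)\<^sup>2 \<le> (2 / \<bar>\<tau>\<bar>)\<^sup>2"
      using that by (intro power_mono) (auto simp: resonance_bound_def)
    also have "\<dots> = 4 * norm \<tau> powr - 2"
      using True by (simp add: powr_minus powr_numeral power2_eq_square field_simps)
    finally have "ennreal ((resonance_bound b \<tau>)\<^sup>2) \<le> 4 * ennreal (norm \<tau> powr - 2)"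
      by (metis ennreal_leI ennreal_mult' ennreal_numeral zero_le_numeral)
    then show ?thesis using True by (simp add: add_increasing)
  next
    case False
    then show ?thesis using that
      by (auto simp: resonance_bound_def intro!: ennreal_leI power_mono)
  qed
  then have "(\<integral>\<^sup>+\<tau>. ennreal ((resonance_bound b \<tau>)\<^sup>2) \<partial>lborel)
      \<le> (\<integral>\<^sup>+\<tau>. ennreal (b\<^sup>2) * indicator (cball 0 1) \<tau>
          + 4 * (ennreal (norm \<tau> powr - 2) * indicator {x. 1 \<le> norm x} \<tau>) \<partial>(lborel :: real measure))"
    by (intro nn_integral_mono)
  also have "\<dots> = (\<integral>\<^sup>+\<tau>. ennreal (b\<^sup>2) * indicator (cball 0 1) \<tau> \<partial>(lborel :: real measure))
      + (\<integral>\<^sup>+\<tau>. 4 * (ennreal (norm \<tau> powr - 2) * indicator {x. 1 \<le> norm x} \<tau>) \<partial>(lborel :: real measure))"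
    by (rule nn_integral_add; measurable)
  also have "(\<integral>\<^sup>+\<tau>. ennreal (b\<^sup>2) * indicator (cball 0 1) \<tau> \<partial>(lborel :: real measure))
      = ennreal (b\<^sup>2) * emeasure lborel (cball (0::real) 1)"
    by (rule nn_integral_cmult_indicator) simp
  also have "(\<integral>\<^sup>+\<tau>. 4 * (ennreal (norm \<tau> powr - 2) * indicator {x. 1 \<le> norm x} \<tau>) \<partial>(lborel :: real measure))
      = 4 * (\<integral>\<^sup>+\<tau>\<in>{x. 1 \<le> norm x}. ennreal (norm \<tau> powr - 2) \<partial>(lborel :: real measure))"
    by (rule nn_integral_cmult; measurable)
  finally have "(\<integral>\<^sup>+\<tau>. ennreal ((resonance_bound b \<tau>)\<^sup>2) \<partial>lborel)
      \<le> ennreal (b\<^sup>2) * emeasure lborel (cball (0::real) 1)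
        + 4 * (\<integral>\<^sup>+\<tau>\<in>{x. 1 \<le> norm x}. ennreal (norm \<tau> powr - 2) \<partial>(lborel :: real measure))" .
  also have "\<dots> < \<infinity>"
    using nn_integral_norm_powr_tail_finite[of 2, where 'k=real] emeasure_lborel_cball_lt_top[of "0::real" 1]
    by (auto simp: ennreal_mult_less_top)
  finally show ?thesis .
qed

text \<open>Near the singularity of the weight, i.e. for \<open>\<bar>\<tau>\<bar> \<le> \<bar>\<sigma>\<bar> / 2\<close>, the resonance bound is at most
  \<open>min b (4 / \<bar>\<sigma>\<bar>)\<close>; elsewhere the weight is at most \<open>(\<bar>\<sigma>\<bar> / 2) powr - p\<close>.\<close>
lemma nn_integral_resonance_bound_weighted:
  assumes b: "0 \<le> b" and p: "0 \<le> p" "p < 1"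
  shows "\<exists>C\<ge>0. \<forall>\<sigma>. \<sigma> \<noteq> 0 \<longrightarrow>
    (\<integral>\<^sup>+\<tau>. ennreal ((resonance_bound b (\<tau> - \<sigma>))\<^sup>2 * \<bar>\<tau>\<bar> powr - p) \<partial>lborel) \<le> ennreal (C * \<bar>\<sigma>\<bar> powr - p)"
proof -
  obtain K1 where K1: "0 \<le> K1" "(\<integral>\<^sup>+x\<in>cball (0::real) 1. ennreal (norm x powr - p) \<partial>lborel) = ennreal K1"
    using nn_integral_norm_powr_cball_finite[of p, where 'k=real] p
    by (cases "\<integral>\<^sup>+x\<in>cball (0::real) 1. ennreal (norm x powr - p) \<partial>lborel") auto
  obtain K2 where K2: "0 \<le> K2" "(\<integral>\<^sup>+\<tau>. ennreal ((resonance_bound b \<tau>)\<^sup>2) \<partial>lborel) = ennreal K2"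
    using nn_integral_resonance_bound_sq_finite[OF b]
    by (cases "\<integral>\<^sup>+\<tau>. ennreal ((resonance_bound b \<tau>)\<^sup>2) \<partial>lborel") auto
  let ?C = "4 * b * (1/2) powr (1 - p) * K1 + (1/2) powr - p * K2"
  show ?thesis
  proof (intro exI[of _ ?C] conjI allI impI)
    show "0 \<le> ?C" using b K1 K2 by simp
    fix \<sigma> :: real assume "\<sigma> \<noteq> 0"
    let ?B = "\<lambda>\<tau>. (resonance_bound b (\<tau> - \<sigma>))\<^sup>2"
    define r where "r = \<bar>\<sigma>\<bar>"
    have r: "0 < r" using \<open>\<sigma> \<noteq> 0\<close> by (simp add: r_def)
    have pw: "ennreal (?B \<tau> * \<bar>\<tau>\<bar> powr - p)
        \<le> ennreal (b * (4 / r)) * (ennreal (norm \<tau> powr - p) * indicator (cball 0 (r / 2)) \<tau>)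
          + ennreal ((r / 2) powr - p) * ennreal (?B \<tau>)" for \<tau>
    proof (cases "\<bar>\<tau>\<bar> \<le> r / 2")
      case True
      then have "r / 2 \<le> \<bar>\<tau> - \<sigma>\<bar>" unfolding r_def by linarith
      then have "2 / \<bar>\<tau> - \<sigma>\<bar> \<le> 2 / (r / 2)" using r by (intro divide_left_mono mult_pos_pos) linarith+
      then have "resonance_bound b (\<tau> - \<sigma>) \<le> 4 / r" "resonance_bound b (\<tau> - \<sigma>) \<le> b"
        unfolding resonance_bound_def by auto
      \<comment> \<open>One factor of the square is bounded by \<open>b\<close>, the other by
        \<open>4 / r\<close>. Together with the power \<open>r powr (1 - p)\<close> from integrating
        the weight this gives exactly \<open>r powr - p\<close> for all \<open>r\<close>; using the
        same bound twice would fail for large or for small \<open>r\<close>.\<close>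
      then have "?B \<tau> \<le> b * (4 / r)"
        using b by (simp only: power2_eq_square) (intro mult_mono; simp)
      then have "?B \<tau> * \<bar>\<tau>\<bar> powr - p \<le> b * (4 / r) * \<bar>\<tau>\<bar> powr - p"
        by (intro mult_right_mono) auto
      then have "ennreal (?B \<tau> * \<bar>\<tau>\<bar> powr - p)
        \<le> ennreal (b * (4 / r)) * ennreal (norm \<tau> powr - p)"
        using b r by (subst ennreal_mult'[symmetric]) (auto intro: ennreal_leI)
      then show ?thesis using True by (simp add: add_increasing2)
    next
      case False
      then have "\<bar>\<tau>\<bar> powr - p \<le> (r / 2) powr - p"
        using r p by (intro powr_mono2') auto
      then have "?B \<tau> * \<bar>\<tau>\<bar> powr - p \<le> (r / 2) powr - p * ?B \<tau>"
        by (subst mult.commute) (intro mult_right_mono; simp)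
      then have "ennreal (?B \<tau> * \<bar>\<tau>\<bar> powr - p)
        \<le> ennreal ((r / 2) powr - p) * ennreal (?B \<tau>)"
        by (subst ennreal_mult'[symmetric]) (auto intro: ennreal_leI)
      then show ?thesis by (simp add: add_increasing)
    qed
    have shift: "(\<integral>\<^sup>+\<tau>. ennreal (?B \<tau>) \<partial>lborel) = ennreal K2"
      using nn_integral_real_affine[of "\<lambda>\<tau>. ennreal ((resonance_bound b \<tau>)\<^sup>2)" 1 "- \<sigma>"] K2
      by (simp add: add.commute)
    have "(\<integral>\<^sup>+\<tau>. ennreal (?B \<tau> * \<bar>\<tau>\<bar> powr - p) \<partial>lborel)
       \<le> (\<integral>\<^sup>+\<tau>. ennreal (b * (4 / r)) * (ennreal (norm \<tau> powr - p) * indicator (cball 0 (r / 2)) \<tau>)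
          + ennreal ((r / 2) powr - p) * ennreal (?B \<tau>) \<partial>lborel)"
      by (intro nn_integral_mono pw)
    also have "\<dots> = ennreal (b * (4 / r)) * (\<integral>\<^sup>+x\<in>cball (0::real) (r/2). ennreal (norm x powr - p) \<partial>lborel)
        + ennreal ((r / 2) powr - p) * ennreal K2"
    proof (subst nn_integral_add)
      show "(\<integral>\<^sup>+\<tau>. ennreal (b * (4 / r)) * (ennreal (norm \<tau> powr - p) * indicator (cball (0::real) (r / 2)) \<tau>) \<partial>lborel)
        + (\<integral>\<^sup>+\<tau>. ennreal ((r / 2) powr - p) * ennreal (?B \<tau>) \<partial>lborel)
        = ennreal (b * (4 / r)) * (\<integral>\<^sup>+x\<in>cball (0::real) (r/2). ennreal (norm x powr - p) \<partial>lborel)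
        + ennreal ((r / 2) powr - p) * ennreal K2"
        by (subst nn_integral_cmult, measurable)+ (simp only: shift)
    qed measurable
    also have "\<dots> = ennreal (b * (4 / r) * ((r / 2) powr (1 - p) * K1) + (r / 2) powr - p * K2)"
      using nn_integral_norm_powr_cball_scale[of "r / 2" p, where 'k=real] r b K1 K2
      by (simp add: ennreal_mult' ennreal_plus del: times_divide_eq_right)
    also have "b * (4 / r) * ((r / 2) powr (1 - p) * K1) + (r / 2) powr - p * K2 = ?C * r powr - p"
    proof -
      have "(r / 2) powr (1 - p) = r * (r powr - p * (1/2) powr (1 - p))"
        using r by (simp add: powr_divide powr_diff powr_minus field_simps)
      moreover have "(r / 2) powr - p = r powr - p * (1/2) powr - p"
        using powr_mult[of r "1/2" "- p"] r by simp
      ultimately show ?thesis using r by (simp add: field_simps)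
    qed
    finally show "(\<integral>\<^sup>+\<tau>. ennreal (?B \<tau> * \<bar>\<tau>\<bar> powr - p) \<partial>lborel)
       \<le> ennreal (?C * \<bar>\<sigma>\<bar> powr - p)" unfolding r_def .
  qed
qed

section \<open>Pointwise bounds on the increments of the transformed wave kernel\<close>

definition wave_phase :: "real \<Rightarrow> real \<Rightarrow> real \<Rightarrow> complex" where
  "wave_phase t \<tau> r =
     ((iexp (- (t * \<tau>)) - iexp (t * r)) / of_real (\<tau> + r)
      - (iexp (- (t * \<tau>)) - iexp (- (t * r))) / of_real (\<tau> - r)) / of_real (2 * r)"

lemma Fg_eq: "Fg t x \<tau> \<xi> = iexp (- (x \<bullet> \<xi>)) * wave_phase t \<tau> (norm \<xi>)"
  by (simp add: Fg_def wave_phase_def)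

text \<open>The zero initial condition in spectral form. It turns a distance to a point at time 0
  into the norm of the transform itself, which later yields integrability of the covariance
  integrand.\<close>

lemma wave_phase_0 [simp]: "wave_phase 0 \<tau> r = 0"
  by (simp add: wave_phase_def)

lemma norm_iexp_diff_le: "norm (iexp x - iexp y) \<le> \<bar>x - y\<bar>"
proof -
  have "iexp x - iexp y = iexp y * (iexp (x - y) - 1)"
    by (simp add: algebra_simps flip: exp_add)
  then show ?thesis using iexp_approx1[of "x - y" 0] by (simp add: norm_mult)
qed

lemma norm_iexp_diff_le_2: "norm (iexp x - iexp y) \<le> 2"
  using norm_triangle_ineq4[of "iexp x" "iexp y"] by simp

lemma norm_iexp_diff_div_le:
  assumes "0 \<le> t" "t \<le> b" "\<bar>x - y\<bar> = t * \<bar>\<eta>\<bar>" "\<eta> \<noteq> 0"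
  shows "norm ((iexp x - iexp y) / of_real \<eta>) \<le> resonance_bound b \<eta>"
proof -
  have "norm (iexp x - iexp y) \<le> b * \<bar>\<eta>\<bar>"
    using norm_iexp_diff_le[of x y] assms by (smt (verit) mult_right_mono)
  then show ?thesis
    using norm_iexp_diff_le_2[of x y] assms(4)
    by (simp add: resonance_bound_def norm_divide divide_le_eq)
qed

lemma wave_phase_resonances:
  assumes t: "0 \<le> t" "t \<le> b" and "\<tau> \<noteq> r" "\<tau> \<noteq> - r"
  shows "norm ((iexp (- (t * \<tau>)) - iexp (t * r)) / of_real (\<tau> + r)) \<le> resonance_bound b (\<tau> + r)"
    and "norm ((iexp (- (t * \<tau>)) - iexp (- (t * r))) / of_real (\<tau> - r)) \<le> resonance_bound b (\<tau> - r)"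
proof -
  have "\<bar>- (t * \<tau>) - t * r\<bar> = t * \<bar>\<tau> + r\<bar>" "\<bar>- (t * \<tau>) - - (t * r)\<bar> = t * \<bar>\<tau> - r\<bar>"
    using t by (simp_all add: abs_mult_pos' algebra_simps abs_minus_commute)
  then show "norm ((iexp (- (t * \<tau>)) - iexp (t * r)) / of_real (\<tau> + r)) \<le> resonance_bound b (\<tau> + r)"
    "norm ((iexp (- (t * \<tau>)) - iexp (- (t * r))) / of_real (\<tau> - r)) \<le> resonance_bound b (\<tau> - r)"
    using assms by (intro norm_iexp_diff_div_le[of t b]; simp)+
qed

lemma norm_wave_phase_le:
  assumes t: "0 \<le> t" "t \<le> b" and r: "0 < r" "\<tau> \<noteq> r" "\<tau> \<noteq> - r"
  shows "norm (wave_phase t \<tau> r) \<le> (resonance_bound b (\<tau> + r) + resonance_bound b (\<tau> - r)) / (2 * r)"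
proof -
  have "norm (wave_phase t \<tau> r) = norm ((iexp (- (t * \<tau>)) - iexp (t * r)) / of_real (\<tau> + r)
      - (iexp (- (t * \<tau>)) - iexp (- (t * r))) / of_real (\<tau> - r)) / (2 * r)"
    using r unfolding wave_phase_def norm_divide[of _ "of_real (2 * r)"] by (simp only: norm_of_real)
  also have "\<dots> \<le> (resonance_bound b (\<tau> + r) + resonance_bound b (\<tau> - r)) / (2 * r)"
    using r by (intro divide_right_mono order_trans[OF norm_triangle_ineq4] add_mono wave_phase_resonances t) auto
  finally show ?thesis .
qed

text \<open>The time derivative of the phase again consists of the two resonances, without the factor \<open>1 / r\<close>.\<close>
lemma norm_wave_phase_diff_le:
  assumes t: "0 \<le> t" "t \<le> b" and s: "0 \<le> s" "s \<le> b" and r: "0 < r" "\<tau> \<noteq> r" "\<tau> \<noteq> - r"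
  shows "norm (wave_phase t \<tau> r - wave_phase s \<tau> r)
    \<le> (resonance_bound b (\<tau> + r) + resonance_bound b (\<tau> - r)) / 2 * \<bar>t - s\<bar>"
proof -
  \<comment> \<open>Time is made complex so that the mean value inequality for complex derivatives
    applies along the segment from 0 to \<open>b\<close>; \<open>f\<close> agrees with
    \<open>wave_phase\<close> at real points.\<close>
  define f where "f z = ((exp (- (\<i> * z * of_real \<tau>)) - exp (\<i> * z * of_real r)) / of_real (\<tau> + r)
      - (exp (- (\<i> * z * of_real \<tau>)) - exp (- (\<i> * z * of_real r))) / of_real (\<tau> - r)) / of_real (2 * r)"
    for z :: complex
  define f' where "f' z = \<i> / 2 * ((exp (- (\<i> * z * of_real \<tau>)) - exp (\<i> * z * of_real r)) / of_real (\<tau> + r)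
      + (exp (- (\<i> * z * of_real \<tau>)) - exp (- (\<i> * z * of_real r))) / of_real (\<tau> - r))"
    for z :: complex
  have f: "f (of_real u) = wave_phase u \<tau> r" for u
    by (simp add: f_def wave_phase_def mult_ac)
  have nz: "complex_of_real (\<tau> + r) \<noteq> 0" "complex_of_real (\<tau> - r) \<noteq> 0" "complex_of_real r \<noteq> 0"
    using r by (simp_all only: of_real_eq_0_iff)
  have deriv: "(f has_field_derivative f' z) (at z)" for z
  proof -
    let ?A = "exp (- (\<i> * z * of_real \<tau>))" and ?B = "exp (\<i> * z * of_real r)" and ?D = "exp (- (\<i> * z * of_real r))"
    have "(f has_field_derivative
       ((- (\<i> * of_real \<tau>) * ?A - \<i> * of_real r * ?B) / of_real (\<tau> + r)
        - (- (\<i> * of_real \<tau>) * ?A + \<i> * of_real r * ?D) / of_real (\<tau> - r)) / of_real (2 * r)) (at z)"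
      unfolding f_def using nz
      by (auto intro!: derivative_eq_intros simp del: of_real_add of_real_diff of_real_mult)
         (simp add: mult.commute mult.left_commute)
    \<comment> \<open>Partial fractions: \<open>2 * \<tau> / (\<tau>^2 - r^2)\<close> is the sum of
      the two reciprocals. This trades the \<open>\<tau>\<close> produced by differentiating
      \<open>?A\<close> for a factor \<open>r\<close>, which cancels the denominator
      \<open>2 * r\<close>.\<close>
    moreover have "((- (\<i> * of_real \<tau>) * ?A - \<i> * of_real r * ?B) / of_real (\<tau> + r)
        - (- (\<i> * of_real \<tau>) * ?A + \<i> * of_real r * ?D) / of_real (\<tau> - r)) / of_real (2 * r) = f' z"
      using nz unfolding f'_def by (simp add: divide_simps) (simp add: algebra_simps)
    ultimately show ?thesis by simp
  qed
  have bound: "norm (f' z) \<le> (resonance_bound b (\<tau> + r) + resonance_bound b (\<tau> - r)) / 2"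
    if z: "z \<in> closed_segment 0 (of_real b)" for z
  proof -
    obtain u where u: "z = of_real u" "0 \<le> u" "u \<le> b"
    proof -
      obtain v where v: "0 \<le> v" "v \<le> 1" "z = of_real (v * b)"
        using z by (auto simp: in_segment scaleR_conv_of_real)
      have "v * b \<le> 1 * b" using v t by (intro mult_right_mono) auto
      then show ?thesis using v t that[of "v * b"] by simp
    qed
    have eq: "f' z = \<i> / 2 * ((iexp (- (u * \<tau>)) - iexp (u * r)) / of_real (\<tau> + r)
      + (iexp (- (u * \<tau>)) - iexp (- (u * r))) / of_real (\<tau> - r))"
      by (simp add: f'_def u mult_ac)
    have "norm (f' z) = norm ((iexp (- (u * \<tau>)) - iexp (u * r)) / of_real (\<tau> + r)
      + (iexp (- (u * \<tau>)) - iexp (- (u * r))) / of_real (\<tau> - r)) / 2"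
      unfolding eq norm_mult by simp
    also have "\<dots> \<le> (resonance_bound b (\<tau> + r) + resonance_bound b (\<tau> - r)) / 2"
      using r by (intro divide_right_mono order_trans[OF norm_triangle_ineq] add_mono wave_phase_resonances u) auto
    finally show ?thesis .
  qed
  have seg: "complex_of_real u \<in> closed_segment 0 (of_real b)" if "0 \<le> u" "u \<le> b" for u
  proof (cases "b = 0")
    case False
    then show ?thesis using that
      by (auto simp: in_segment scaleR_conv_of_real intro!: exI[of _ "u / b"])
  qed (use that in auto)
  have "norm (f (of_real t) - f (of_real s))
      \<le> (resonance_bound b (\<tau> + r) + resonance_bound b (\<tau> - r)) / 2 * norm (complex_of_real t - of_real s)"
    by (rule field_differentiable_bound[OF convex_closed_segment _ bound])
       (auto intro!: has_field_derivative_at_within[OF deriv] seg t s)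
  then show ?thesis by (simp add: f norm_of_real flip: of_real_diff)
qed

text \<open>The space part is a phase increment, at most a multiple of
  \<open>min 1 (\<rho> * r)\<close>, times a kernel of size \<open>1 / r\<close>. The time part has
  a derivative without \<open>1 / r\<close>, so it contributes
  \<open>\<rho> = (\<rho> * r) / r\<close> for small \<open>\<rho> * r\<close> and the trivial
  \<open>1 / r\<close> otherwise. Both therefore take the common form
  \<open>min 1 (\<rho> * r) / r\<close>, to which the scaling integral applies.\<close>

lemma norm_Fg_diff_le:
  fixes x y \<xi> :: "real^'n"
  assumes t: "0 \<le> t" "t \<le> b" and s: "0 \<le> s" "s \<le> b" and r: "\<xi> \<noteq> 0" "\<tau> \<noteq> norm \<xi>" "\<tau> \<noteq> - norm \<xi>"
  shows "norm (Fg t x \<tau> \<xi> - Fg s y \<tau> \<xi>)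
    \<le> 2 * min 1 ((\<bar>t - s\<bar> + norm (x - y)) * norm \<xi>) / norm \<xi>
        * (resonance_bound b (\<tau> + norm \<xi>) + resonance_bound b (\<tau> - norm \<xi>))"
proof -
  let ?r = "norm \<xi>" and ?\<rho> = "\<bar>t - s\<bar> + norm (x - y)"
  let ?B = "resonance_bound b (\<tau> + ?r) + resonance_bound b (\<tau> - ?r)"
  have r0: "0 < ?r" using r by simp
  have b: "0 \<le> b" using t by simp
  have B: "0 \<le> ?B" using b by simp
  have "Fg t x \<tau> \<xi> - Fg s y \<tau> \<xi> = (iexp (- (x \<bullet> \<xi>)) - iexp (- (y \<bullet> \<xi>))) * wave_phase t \<tau> ?r
      + iexp (- (y \<bullet> \<xi>)) * (wave_phase t \<tau> ?r - wave_phase s \<tau> ?r)"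
    unfolding Fg_eq by (simp add: algebra_simps)
  moreover have "norm (iexp (- (y \<bullet> \<xi>))) = 1" by (rule norm_exp_i_times)
  ultimately have "norm (Fg t x \<tau> \<xi> - Fg s y \<tau> \<xi>)
      \<le> norm (iexp (- (x \<bullet> \<xi>)) - iexp (- (y \<bullet> \<xi>))) * norm (wave_phase t \<tau> ?r)
        + norm (wave_phase t \<tau> ?r - wave_phase s \<tau> ?r)"
    using norm_triangle_ineq[of "(iexp (- (x \<bullet> \<xi>)) - iexp (- (y \<bullet> \<xi>))) * wave_phase t \<tau> ?r"
        "iexp (- (y \<bullet> \<xi>)) * (wave_phase t \<tau> ?r - wave_phase s \<tau> ?r)"]
    by (simp only: norm_mult mult_1)
  also have "\<dots> \<le> (2 * min 1 (?\<rho> * ?r)) * (?B / (2 * ?r)) + min 1 (?\<rho> * ?r) / ?r * ?B"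
  proof (intro add_mono mult_mono)
    have "\<bar>- (x \<bullet> \<xi>) - - (y \<bullet> \<xi>)\<bar> \<le> norm (x - y) * ?r"
      using Cauchy_Schwarz_ineq2[of "x - y" \<xi>] by (simp add: inner_diff_left abs_minus_commute)
    also have "\<dots> \<le> ?\<rho> * ?r" by (intro mult_right_mono) auto
    finally have "norm (iexp (- (x \<bullet> \<xi>)) - iexp (- (y \<bullet> \<xi>))) \<le> ?\<rho> * ?r"
      using norm_iexp_diff_le[of "- (x \<bullet> \<xi>)" "- (y \<bullet> \<xi>)"] by linarith
    moreover have "0 \<le> ?\<rho> * ?r" by simp
    ultimately show "norm (iexp (- (x \<bullet> \<xi>)) - iexp (- (y \<bullet> \<xi>))) \<le> 2 * min 1 (?\<rho> * ?r)"
      using norm_iexp_diff_le_2[of "- (x \<bullet> \<xi>)" "- (y \<bullet> \<xi>)"] by linarith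
    show "norm (wave_phase t \<tau> ?r) \<le> ?B / (2 * ?r)"
      using r r0 t by (intro norm_wave_phase_le) auto
    show "norm (wave_phase t \<tau> ?r - wave_phase s \<tau> ?r) \<le> min 1 (?\<rho> * ?r) / ?r * ?B"
    proof (cases "?\<rho> * ?r \<le> 1")
      case True
      have "norm (wave_phase t \<tau> ?r - wave_phase s \<tau> ?r) \<le> ?B / 2 * \<bar>t - s\<bar>"
        using r r0 t s by (intro norm_wave_phase_diff_le) auto
      also have "\<dots> \<le> ?B * ?\<rho>" using B by (intro mult_mono) auto
      finally show ?thesis using True r0 by (simp add: mult.commute)
    next
      case False
      have "norm (wave_phase t \<tau> ?r - wave_phase s \<tau> ?r) \<le> ?B / (2 * ?r) + ?B / (2 * ?r)"
        using r r0 t s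
        by (intro order_trans[OF norm_triangle_ineq4] add_mono norm_wave_phase_le) auto
      also have "\<dots> = ?B / ?r" by (simp add: field_simps)
      finally show ?thesis using False by simp
    qed
  qed (use b in auto)
  also have "\<dots> = 2 * min 1 (?\<rho> * ?r) / ?r * ?B" using r0 by (simp add: field_simps)
  finally show ?thesis .
qed

section \<open>The spectral metric\<close>

text \<open>The constants are an error budget. The resonant main term \<open>D\<close> has modulus
  at least \<open>a\<close>. The two nonresonant terms cost \<open>2 / r \<le> a / 4\<close> by the
  assumption on \<open>norm \<xi>\<close>, and the two linearization errors cost
  \<open>a / 8\<close> each by the assumption on \<open>\<eta>\<close>. Half of the main term
  survives, and the factor \<open>1 / (2 * r)\<close> of the kernel turns \<open>a / 2\<close> into
  \<open>a / (4 * r)\<close>.\<close>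

lemma norm_Fg_diff_ge:
  fixes x y \<xi> :: "real^'n"
  assumes a: "0 < a" "a \<le> s" "s \<le> t" "t \<le> b"
    and cos: "cos ((x - y) \<bullet> \<xi> + (t - s) * norm \<xi>) \<le> 0"
    and r: "8 / a \<le> norm \<xi>"
    and \<eta>: "0 < \<eta>" "\<eta> \<le> a / (4 * b\<^sup>2)"
  shows "a / (4 * norm \<xi>) \<le> norm (Fg t x (norm \<xi> + \<eta>) \<xi> - Fg s y (norm \<xi> + \<eta>) \<xi>)"
proof -
  define r where "r = norm \<xi>"
  define \<tau> where "\<tau> = r + \<eta>"
  have r0: "0 < r" "2 / r \<le> a / 4"
  proof -
    have "0 < 8 / a" using a by simp
    then show "0 < r" using assms(6) unfolding r_def by linarith
    then show "2 / r \<le> a / 4" using assms(6) a by (simp add: r_def field_simps)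
  qed
  \<comment> \<open>\<open>P\<close> is the nonresonant quotient. \<open>E\<close> is the error of
    replacing the resonant quotient, with its phase removed, by its limit \<open>- \<i> * u\<close>
    as \<open>\<eta>\<close> tends to 0.\<close>
  define P where "P u = (iexp (- (u * \<tau>)) - iexp (u * r)) / complex_of_real (\<tau> + r)" for u
  define E where "E u = (iexp (- (u * \<eta>)) - 1) / complex_of_real \<eta> + \<i> * u" for u
  define A where "A = x \<bullet> \<xi> + t * r"
  define B where "B = y \<bullet> \<xi> + s * r"
  have P: "norm (P u) \<le> 1 / r" for u
  proof -
    have "norm (P u) = norm (iexp (- (u * \<tau>)) - iexp (u * r)) / (2 * r + \<eta>)"
      using r0 \<eta> unfolding P_def norm_divide norm_of_real by (simp add: \<tau>_def)
    also have "\<dots> \<le> 2 / (2 * r)"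
      by (intro frac_le norm_iexp_diff_le_2) (use r0 \<eta> in auto)
    finally show ?thesis by simp
  qed
  have E: "norm (E u) \<le> a / 8" if "0 \<le> u" "u \<le> b" for u
  proof -
    have "E u = (iexp (- (u * \<eta>)) - (\<Sum>k\<le>1. (\<i> * complex_of_real (- (u * \<eta>))) ^ k / fact k)) / complex_of_real \<eta>"
      using \<eta> by (simp add: E_def field_simps)
    then have "norm (E u) = norm (iexp (- (u * \<eta>)) - (\<Sum>k\<le>1. (\<i> * complex_of_real (- (u * \<eta>))) ^ k / fact k)) / \<eta>"
      using \<eta> by (simp only: norm_divide norm_of_real abs_of_pos)
    also have "\<dots> \<le> (\<bar>- (u * \<eta>)\<bar> ^ Suc 1 / fact (Suc 1)) / \<eta>"
      using \<eta> by (intro divide_right_mono iexp_approx1) auto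
    also have "\<dots> = (u * \<eta>)\<^sup>2 / 2 / \<eta>"
      by (simp add: power2_eq_square)
    finally have "norm (E u) \<le> (u * \<eta>)\<^sup>2 / 2 / \<eta>" .
    also have "\<dots> = u\<^sup>2 * \<eta> / 2" using \<eta> by (simp add: power2_eq_square)
    also have "\<dots> \<le> b\<^sup>2 * (a / (4 * b\<^sup>2)) / 2"
      using that \<eta> by (intro divide_right_mono mult_mono power_mono) auto
    also have "\<dots> = a / 8" using a by simp
    finally show ?thesis .
  qed
  have Fg: "Fg u z \<tau> \<xi> = (iexp (- (z \<bullet> \<xi>)) * P u + \<i> * u * iexp (- (z \<bullet> \<xi> + u * r)) - iexp (- (z \<bullet> \<xi> + u * r)) * E u) / of_real (2 * r)"
    for u z
  proof -
    have "(iexp (- (u * \<tau>)) - iexp (- (u * r))) / of_real (\<tau> - r) = iexp (- (u * r)) * (E u - \<i> * u)"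
      using \<eta> by (simp add: E_def \<tau>_def field_simps flip: exp_add)
    moreover have "iexp (- (z \<bullet> \<xi> + u * r)) = iexp (- (z \<bullet> \<xi>)) * iexp (- (u * r))"
      by (simp add: exp_add[symmetric]) (simp add: algebra_simps)
    ultimately show ?thesis
      unfolding Fg_eq wave_phase_def P_def r_def[symmetric] by (simp only:) (simp add: algebra_simps)
  qed
  define D where "D = of_real t * iexp (- A) - of_real s * iexp (- B)"
  \<comment> \<open>After the unit phase \<open>iexp (- A)\<close> is factored out, the real part is
    \<open>t - s * cos (A - B)\<close>. The nonpositive cosine excludes cancellation, so this is at
    least \<open>t\<close>.\<close>
  have D: "a \<le> norm D"
  proof -
    have "D = iexp (- A) * (of_real t - of_real s * iexp (A - B))"
      by (simp add: D_def algebra_simps flip: exp_add)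
    then have "norm D = norm (of_real t - of_real s * iexp (A - B))"
      by (simp only: norm_mult norm_exp_i_times mult_1)
    moreover have "Re (of_real t - of_real s * iexp (A - B)) = t - s * cos (A - B)"
      by (simp add: Re_exp)
    moreover have "A - B = (x - y) \<bullet> \<xi> + (t - s) * norm \<xi>"
      by (simp add: A_def B_def r_def inner_diff_left algebra_simps)
    ultimately have "t - s * cos (A - B) \<le> norm D" "cos (A - B) \<le> 0"
      using cos complex_Re_le_cmod[of "of_real t - of_real s * iexp (A - B)"] by auto
    moreover have "s * cos (A - B) \<le> 0" using a calculation by (intro mult_nonneg_nonpos) auto
    ultimately show ?thesis using a by linarith
  qed
  define R where "R = iexp (- (x \<bullet> \<xi>)) * P t - iexp (- (y \<bullet> \<xi>)) * P s - (iexp (- A) * E t - iexp (- B) * E s)"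
  have R: "norm R \<le> a / 2"
  proof -
    have "norm R \<le> (norm (P t) + norm (P s)) + (norm (E t) + norm (E s))"
      unfolding R_def
      by (intro order_trans[OF norm_triangle_ineq4] add_mono; simp only: norm_mult norm_exp_i_times mult_1 order_refl)
    also have "\<dots> \<le> (1 / r + 1 / r) + (a / 8 + a / 8)"
      using a by (intro add_mono P E) auto
    also have "\<dots> \<le> a / 2" using r0 by simp
    finally show ?thesis .
  qed
  have "Fg t x \<tau> \<xi> - Fg s y \<tau> \<xi> = (\<i> * D + R) / of_real (2 * r)"
    unfolding Fg A_def[symmetric] B_def[symmetric] D_def R_def
    by (simp only: diff_divide_distrib[symmetric]) (simp add: algebra_simps)
  then have eq: "norm (Fg t x \<tau> \<xi> - Fg s y \<tau> \<xi>) = norm (\<i> * D + R) / (2 * r)"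
    using r0 by (simp only: norm_divide norm_of_real)
  have "a - a / 2 \<le> norm (\<i> * D) - norm R" using D R by (simp add: norm_mult)
  also have "\<dots> \<le> norm (\<i> * D + R)" by (rule norm_diff_ineq)
  finally have "(a / 2) / (2 * r) \<le> norm (\<i> * D + R) / (2 * r)"
    using r0 by (intro divide_right_mono) auto
  then show ?thesis unfolding eq[symmetric] by (simp add: r_def \<tau>_def)
qed

lemma Fg_measurable [measurable]:
  "(\<lambda>z. Fg t x (fst z) (snd z)) \<in> borel_measurable (borel \<Otimes>\<^sub>M borel)"
  unfolding Fg_def by measurable

abbreviation Fg_incr :: "real \<times> (real^'n) \<Rightarrow> real \<times> (real^'n) \<Rightarrow> real \<Rightarrow> real^'n \<Rightarrow> real" where
  "Fg_incr p q \<tau> \<xi> \<equiv> norm (Fg (fst p) (snd p) \<tau> \<xi> - Fg (fst q) (snd q) \<tau> \<xi>)"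

locale wave_spectrum =
  fixes H \<beta> c1 c2 :: real and h :: "real^'n \<Rightarrow> real"
  assumes H: "1/2 \<le> H" "H < 1"
    and \<beta>: "0 < \<beta>" "real CARD('n) - 2*H - 1 < \<beta>" "\<beta> < real CARD('n) - 2*H + 1"
    and h_measurable [measurable]: "h \<in> borel_measurable borel"
    and h_nonneg: "\<And>\<xi>. 0 \<le> h \<xi>"
    and c: "0 < c1" "c1 \<le> c2"
    and h_bounds: "\<And>\<xi>. \<xi> \<noteq> 0 \<Longrightarrow> c1 * norm \<xi> powr - \<beta> \<le> h \<xi> \<and> h \<xi> \<le> c2 * norm \<xi> powr - \<beta>"
begin

definition spectral_weight :: "real \<times> (real^'n) \<Rightarrow> real" where
  "spectral_weight z = \<bar>fst z\<bar> powr (1 - 2 * H) * h (snd z)"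

text \<open>The squared L^2 distance of the two kernels, hence up to the factor \<open>cH\<close>
  the variance of an increment. Values in \<open>ennreal\<close> allow estimates before finiteness
  is known, and the \<open>\<tau>\<close> integral is innermost because it is estimated at fixed
  frequency \<open>\<xi>\<close>.\<close>

definition spectral_dist :: "real \<times> (real^'n) \<Rightarrow> real \<times> (real^'n) \<Rightarrow> ennreal" where
  "spectral_dist p q = (\<integral>\<^sup>+\<xi>. \<integral>\<^sup>+\<tau>.
     ennreal ((Fg_incr p q \<tau> \<xi>)\<^sup>2 * spectral_weight (\<tau>, \<xi>)) \<partial>lborel \<partial>lborel)"

lemma spectral_weight_nonneg [simp]: "0 \<le> spectral_weight z"
  using h_nonneg by (simp add: spectral_weight_def)

lemma spectral_weight_measurable [measurable]: "spectral_weight \<in> borel_measurable (borel \<Otimes>\<^sub>M borel)"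
  unfolding spectral_weight_def by measurable

lemma spectral_integrand_measurable [measurable]:
  "(\<lambda>z. Fg t x (fst z) (snd z) * cnj (Fg s y (fst z) (snd z)) * complex_of_real (spectral_weight z))
     \<in> borel_measurable (borel \<Otimes>\<^sub>M borel)"
proof -
  have [measurable]: "cnj \<in> borel_measurable borel"
    by (intro borel_measurable_continuous_onI continuous_intros)
  show ?thesis by measurable
qed

lemma spectral_dist_commute: "spectral_dist p q = spectral_dist q p"
  unfolding spectral_dist_def by (subst norm_minus_commute) (rule refl)

lemma spectral_dist_eq_nn_integral:
  "spectral_dist p q = (\<integral>\<^sup>+z. ennreal ((norm (Fg (fst p) (snd p) (fst z) (snd z) - Fg (fst q) (snd q) (fst z) (snd z)))\<^sup>2
     * spectral_weight z) \<partial>(lborel \<Otimes>\<^sub>M lborel))"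
  unfolding spectral_dist_def
  using lborel_pair.nn_integral_snd[of "\<lambda>z. ennreal ((norm (Fg (fst p) (snd p) (fst z) (snd z) - Fg (fst q) (snd q) (fst z) (snd z)))\<^sup>2 * spectral_weight z)"]
  by simp

lemma spectral_dist_upper:
  assumes b: "0 \<le> b"
  shows "\<exists>C\<ge>0. \<forall>p q. fst p \<in> {0..b} \<longrightarrow> fst q \<in> {0..b} \<longrightarrow>
     spectral_dist p q \<le> ennreal (C * (\<bar>fst p - fst q\<bar> + norm (snd p - snd q)) powr (2*H + 1 - real CARD('n) + \<beta>))"
proof -
  obtain C1 where C1: "0 \<le> C1" "\<And>\<sigma>. \<sigma> \<noteq> 0 \<Longrightarrow>
    (\<integral>\<^sup>+\<tau>. ennreal ((resonance_bound b (\<tau> - \<sigma>))\<^sup>2 * \<bar>\<tau>\<bar> powr (1 - 2 * H)) \<partial>lborel) \<le> ennreal (C1 * \<bar>\<sigma>\<bar> powr (1 - 2 * H))"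
    using nn_integral_resonance_bound_weighted[OF b, of "2 * H - 1"] H by auto
  \<comment> \<open>The decay exponent left after the \<open>\<tau>\<close> integration: 2 from the
    squared \<open>1 / r\<close>, \<open>2 * H - 1\<close> from the temporal weight and
    \<open>\<beta>\<close> from \<open>h\<close>.\<close>
  define g where "g = 2 * H + 1 + \<beta>"
  obtain C2 where C2: "0 \<le> C2" "\<And>\<rho>. 0 \<le> \<rho> \<Longrightarrow>
    (\<integral>\<^sup>+x. ennreal ((min 1 (\<rho> * norm (x::real^'n)))\<^sup>2 * norm x powr - g) \<partial>lborel) \<le> ennreal (C2 * \<rho> powr (g - real CARD('n)))"
    using nn_integral_min_norm_powr[of g, where 'k="real^'n"] \<beta> H by (auto simp: g_def)
  \<comment> \<open>The 16 is made of 4 from squaring the factor 2 in the kernel bound, 2 from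
    squaring a sum of two resonances, and 2 because each resonance contributes
    \<open>C1\<close>.\<close>
  let ?C = "16 * c2 * C1 * C2"
  have c2: "0 \<le> c2" using c by simp
  show ?thesis
  proof (intro exI[of _ ?C] conjI allI impI)
    show "0 \<le> ?C" using C1 C2 c2 by simp
    fix p q :: "real \<times> (real^'n)" assume p: "fst p \<in> {0..b}" and q: "fst q \<in> {0..b}"
    define \<rho> where "\<rho> = \<bar>fst p - fst q\<bar> + norm (snd p - snd q)"
    have \<rho>: "0 \<le> \<rho>" by (simp add: \<rho>_def)
    let ?V = "\<lambda>\<tau> \<xi>. (Fg_incr p q \<tau> \<xi>)\<^sup>2 * spectral_weight (\<tau>, \<xi>)"
    have inner: "(\<integral>\<^sup>+\<tau>. ennreal (?V \<tau> \<xi>) \<partial>lborel)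
       \<le> ennreal (16 * c2 * C1) * ennreal ((min 1 (\<rho> * norm \<xi>))\<^sup>2 * norm \<xi> powr - g)" if \<xi>: "\<xi> \<noteq> 0" for \<xi>
    proof -
      define r where "r = norm \<xi>"
      have r: "0 < r" using \<xi> by (simp add: r_def)
      define K where "K = 8 * (min 1 (\<rho> * r))\<^sup>2 / r\<^sup>2 * h \<xi>"
      have K: "0 \<le> K" using h_nonneg by (simp add: K_def)
      let ?U = "\<lambda>\<tau>. ennreal ((resonance_bound b (\<tau> - - r))\<^sup>2 * \<bar>\<tau>\<bar> powr (1 - 2 * H)) + ennreal ((resonance_bound b (\<tau> - r))\<^sup>2 * \<bar>\<tau>\<bar> powr (1 - 2 * H))"
      have pw: "ennreal (?V \<tau> \<xi>)
        \<le> ennreal K * ?U \<tau>"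
        if \<tau>: "\<tau> \<noteq> r" "\<tau> \<noteq> - r" for \<tau>
      proof -
        let ?B1 = "resonance_bound b (\<tau> - - r)" and ?B2 = "resonance_bound b (\<tau> - r)"
        have "Fg_incr p q \<tau> \<xi> \<le> 2 * min 1 (\<rho> * r) / r * (?B1 + ?B2)"
          using norm_Fg_diff_le[of "fst p" b "fst q" \<xi> \<tau> "snd p" "snd q"] p q \<xi> \<tau> by (simp add: \<rho>_def r_def)
        then have "(Fg_incr p q \<tau> \<xi>)\<^sup>2 \<le> (2 * min 1 (\<rho> * r) / r * (?B1 + ?B2))\<^sup>2"
          by (intro power_mono) auto
        also have "\<dots> = 4 * (min 1 (\<rho> * r))\<^sup>2 / r\<^sup>2 * (?B1 + ?B2)\<^sup>2"
          by (simp add: power_mult_distrib power_divide)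
        also have "\<dots> \<le> 4 * (min 1 (\<rho> * r))\<^sup>2 / r\<^sup>2 * (2 * (?B1\<^sup>2 + ?B2\<^sup>2))"
          using sum_squares_bound[of ?B1 ?B2]
          by (intro mult_left_mono) (auto simp: power2_sum)
        finally have "?V \<tau> \<xi>
           \<le> 4 * (min 1 (\<rho> * r))\<^sup>2 / r\<^sup>2 * (2 * (?B1\<^sup>2 + ?B2\<^sup>2)) * spectral_weight (\<tau>, \<xi>)"
          by (intro mult_right_mono) auto
        also have "\<dots> = K * (?B1\<^sup>2 * \<bar>\<tau>\<bar> powr (1 - 2 * H) + ?B2\<^sup>2 * \<bar>\<tau>\<bar> powr (1 - 2 * H))"
          by (simp add: spectral_weight_def K_def algebra_simps)
        finally have "ennreal (?V \<tau> \<xi>)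
           \<le> ennreal (K * (?B1\<^sup>2 * \<bar>\<tau>\<bar> powr (1 - 2 * H) + ?B2\<^sup>2 * \<bar>\<tau>\<bar> powr (1 - 2 * H)))"
          by (rule ennreal_leI)
        also have "\<dots> = ennreal K * (ennreal (?B1\<^sup>2 * \<bar>\<tau>\<bar> powr (1 - 2 * H)) + ennreal (?B2\<^sup>2 * \<bar>\<tau>\<bar> powr (1 - 2 * H)))"
          using K by (subst ennreal_mult'[OF K], subst ennreal_plus) auto
        finally show ?thesis .
      qed
      have "(\<integral>\<^sup>+\<tau>. ennreal (?V \<tau> \<xi>) \<partial>lborel)
        \<le> (\<integral>\<^sup>+\<tau>. ennreal K * ?U \<tau> \<partial>lborel)"
      proof (rule nn_integral_mono_AE)
        show "AE \<tau> in lborel. ennreal (?V \<tau> \<xi>)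
        \<le> ennreal K * ?U \<tau>"
          using AE_lborel_singleton[of r] AE_lborel_singleton[of "- r"] by eventually_elim (rule pw)
      qed
      also have "\<dots> = ennreal K * (\<integral>\<^sup>+\<tau>. ?U \<tau> \<partial>lborel)"
        by (rule nn_integral_cmult) measurable
      also have "\<dots> = ennreal K * ((\<integral>\<^sup>+\<tau>. ennreal ((resonance_bound b (\<tau> - - r))\<^sup>2 * \<bar>\<tau>\<bar> powr (1 - 2 * H)) \<partial>lborel)
            + (\<integral>\<^sup>+\<tau>. ennreal ((resonance_bound b (\<tau> - r))\<^sup>2 * \<bar>\<tau>\<bar> powr (1 - 2 * H)) \<partial>lborel))"
        by (rule arg_cong[where f="(*) (ennreal K)"], rule nn_integral_add) measurable
      also have "\<dots> \<le> ennreal K * (ennreal (C1 * r powr (1 - 2 * H)) + ennreal (C1 * r powr (1 - 2 * H)))"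
        using C1(2)[of r] C1(2)[of "- r"] r by (intro mult_left_mono add_mono) auto
      also have "\<dots> = ennreal (K * (2 * C1 * r powr (1 - 2 * H)))"
        using C1 K by (simp flip: ennreal_plus ennreal_mult')
      also have "\<dots> \<le> ennreal ((16 * c2 * C1) * ((min 1 (\<rho> * norm \<xi>))\<^sup>2 * norm \<xi> powr - g))"
      proof (rule ennreal_leI)
        have "K \<le> 8 * (min 1 (\<rho> * r))\<^sup>2 / r\<^sup>2 * (c2 * r powr - \<beta>)"
          unfolding K_def using h_bounds[OF \<xi>] by (intro mult_left_mono) (auto simp: r_def)
        then have "K * (2 * C1 * r powr (1 - 2 * H))
           \<le> 8 * (min 1 (\<rho> * r))\<^sup>2 / r\<^sup>2 * (c2 * r powr - \<beta>) * (2 * C1 * r powr (1 - 2 * H))"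
          using C1 by (intro mult_right_mono) auto
        also have "\<dots> = (16 * c2 * C1) * ((min 1 (\<rho> * r))\<^sup>2 * (r powr - \<beta> * r powr (1 - 2 * H) / r\<^sup>2))"
          by simp
        also have "r powr - \<beta> * r powr (1 - 2 * H) / r\<^sup>2 = r powr - g"
          using r by (simp add: g_def powr_diff powr_add powr_minus powr_numeral power2_eq_square field_simps)
        finally show "K * (2 * C1 * r powr (1 - 2 * H)) \<le> (16 * c2 * C1) * ((min 1 (\<rho> * norm \<xi>))\<^sup>2 * norm \<xi> powr - g)"
          by (simp add: r_def)
      qed
      also have "\<dots> = ennreal (16 * c2 * C1) * ennreal ((min 1 (\<rho> * norm \<xi>))\<^sup>2 * norm \<xi> powr - g)"
        using c2 C1 by (intro ennreal_mult) auto
      finally show ?thesis .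
    qed
    have "spectral_dist p q \<le> (\<integral>\<^sup>+\<xi>. ennreal (16 * c2 * C1) * ennreal ((min 1 (\<rho> * norm (\<xi>::real^'n)))\<^sup>2 * norm \<xi> powr - g) \<partial>lborel)"
      unfolding spectral_dist_def
    proof (rule nn_integral_mono_AE)
      show "AE \<xi> in lborel. (\<integral>\<^sup>+\<tau>. ennreal (?V \<tau> \<xi>) \<partial>lborel)
       \<le> ennreal (16 * c2 * C1) * ennreal ((min 1 (\<rho> * norm \<xi>))\<^sup>2 * norm \<xi> powr - g)"
        using AE_lborel_singleton[of "0::real^'n"] by eventually_elim (rule inner)
    qed
    also have "\<dots> = ennreal (16 * c2 * C1) * (\<integral>\<^sup>+\<xi>. ennreal ((min 1 (\<rho> * norm (\<xi>::real^'n)))\<^sup>2 * norm \<xi> powr - g) \<partial>lborel)"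
      by (rule nn_integral_cmult; measurable)
    also have "\<dots> \<le> ennreal (16 * c2 * C1) * ennreal (C2 * \<rho> powr (g - real CARD('n)))"
      using \<rho> by (intro mult_left_mono C2) auto
    also have "\<dots> = ennreal (?C * \<rho> powr (g - real CARD('n)))"
      using C2 C1 c2 by (subst ennreal_mult[symmetric]) (auto simp: mult_ac)
    also have "g - real CARD('n) = 2*H + 1 - real CARD('n) + \<beta>" by (simp add: g_def)
    finally show "spectral_dist p q \<le> ennreal (?C * (\<bar>fst p - fst q\<bar> + norm (snd p - snd q)) powr (2*H + 1 - real CARD('n) + \<beta>))"
      unfolding \<rho>_def .
  qed
qed

lemma spectral_dist_finite:
  assumes "0 \<le> fst p" "0 \<le> fst q"
  shows "spectral_dist p q < \<infinity>"
proof -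
  obtain C where C: "\<And>p' q'. fst p' \<in> {0..max (fst p) (fst q)} \<Longrightarrow> fst q' \<in> {0..max (fst p) (fst q)} \<Longrightarrow>
      spectral_dist p' q' \<le> ennreal (C * (\<bar>fst p' - fst q'\<bar> + norm (snd p' - snd q')) powr (2*H + 1 - real CARD('n) + \<beta>))"
    using spectral_dist_upper[of "max (fst p) (fst q)"] assms by (metis max.coboundedI1)
  have "spectral_dist p q \<le> ennreal (C * (\<bar>fst p - fst q\<bar> + norm (snd p - snd q)) powr (2*H + 1 - real CARD('n) + \<beta>))"
    using assms by (intro C) auto
  then show ?thesis by (rule le_less_trans) simp
qed

lemma cos_nonpos_near_pi:
  assumes "\<bar>\<theta> - pi\<bar> \<le> pi / 2" shows "cos \<theta> \<le> 0"
proof -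
  have "- (pi / 2) \<le> \<theta> - pi" "\<theta> - pi \<le> pi / 2" using assms by linarith+
  then have "0 \<le> cos (\<theta> - pi)" by (rule cos_ge_zero)
  then show ?thesis by (simp add: cos_diff)
qed

text \<open>On a ball of radius \<open>pi / (6 \<rho>)\<close> around \<open>(pi / \<rho>) e\<close>, where \<open>e\<close> is the direction of \<open>x - y\<close>,
  the relative phase stays close to \<open>pi\<close>, so that the resonances at \<open>\<tau> \<approx> norm \<xi>\<close> cannot cancel.\<close>
lemma spectral_dist_lower_ordered:
  assumes a: "0 < a" "a \<le> b"
  shows "\<exists>c>0. \<forall>s t x y. a \<le> s \<longrightarrow> s \<le> t \<longrightarrow> t \<le> b \<longrightarrow> 0 < t - s + norm (x - y) \<longrightarrow> t - s + norm (x - y) \<le> a / 4 \<longrightarrow>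
     ennreal (c * (t - s + norm (x - y)) powr (2*H + 1 - real CARD('n) + \<beta>)) \<le> spectral_dist (t, x) (s, y)"
proof -
  \<comment> \<open>\<open>\<eta>0\<close> is the length of the window in \<open>\<tau>\<close>
    allowed by the kernel lower bound and does not depend on \<open>\<rho>\<close>. In
    \<open>K\<close>, \<open>a\<^sup>2 / 16\<close> is the square of the bound
    \<open>a / (4 * r)\<close> without \<open>r\<close>, while 5 and 10 come from
    \<open>norm \<xi> \<le> 5 / \<rho>\<close> and \<open>\<tau> \<le> 10 / \<rho>\<close>.
    \<open>V\<close> is the volume of the frequency ball for \<open>\<rho> = 1\<close>.\<close>
  define \<eta>0 where "\<eta>0 = a / (4 * b\<^sup>2)"
  define K where "K = (a\<^sup>2 / 16) * c1 * 5 powr (- 2 - \<beta>) * 10 powr (1 - 2 * H)"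
  define V where "V = unit_ball_vol (real CARD('n)) * (pi / 6) ^ CARD('n)"
  have pos: "0 < \<eta>0" "0 < K" "0 < V"
    using a c by (auto simp: \<eta>0_def K_def V_def)
  let ?c = "K * \<eta>0 * V"
  show ?thesis
  proof (intro exI[of _ ?c] conjI allI impI)
    show "0 < ?c" using pos by simp
    fix s t :: real and x y :: "real^'n"
    assume st: "a \<le> s" "s \<le> t" "t \<le> b"
      and \<rho>0: "0 < t - s + norm (x - y)" "t - s + norm (x - y) \<le> a / 4"
    define \<rho> where "\<rho> = t - s + norm (x - y)"
    have \<rho>: "0 < \<rho>" "\<rho> \<le> a / 4" using \<rho>0 by (simp_all add: \<rho>_def)
    obtain e :: "real^'n" where e: "norm e = 1" "x - y = norm (x - y) *\<^sub>R e"
    proof (cases "x - y = 0")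
      \<comment> \<open>For \<open>x = y\<close> the relative phase is
        \<open>(t - s) * norm \<xi>\<close> alone, so every direction serves.\<close>
      case True
      obtain e :: "real^'n" where "norm e = 1" using vector_choose_size[of 1] by auto
      then show ?thesis using that[of e] True by simp
    next
      case False
      then show ?thesis using that[of "(1 / norm (x - y)) *\<^sub>R (x - y)"] by simp
    qed
    define \<xi>0 where "\<xi>0 = (pi / \<rho>) *\<^sub>R e"
    \<comment> \<open>Pointwise lower bound of the integrand on the window:
      \<open>2 + \<beta>\<close> powers of \<open>\<rho>\<close> come from \<open>r\<close> and
      \<open>2 * H - 1\<close> from the temporal weight. The volume of the ball then contributes
      \<open>\<rho> powr - N\<close>, which leaves the desired exponent.\<close>
    define L where "L = K * \<rho> powr (1 + \<beta> + 2 * H)"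
    have pw: "L \<le> (norm (Fg t x \<tau> \<xi> - Fg s y \<tau> \<xi>))\<^sup>2 * spectral_weight (\<tau>, \<xi>)"
      if \<xi>: "\<xi> \<in> cball \<xi>0 (pi / (6 * \<rho>))" and \<tau>: "\<tau> \<in> {norm \<xi> <.. norm \<xi> + \<eta>0}" for \<xi> \<tau>
    proof -
      have nd: "norm (\<xi> - \<xi>0) \<le> pi / (6 * \<rho>)" using \<xi> by (simp add: dist_norm norm_minus_commute)
      have "norm \<xi>0 = pi / \<rho>" using \<rho> e by (simp add: \<xi>0_def)
      then have r: "pi / \<rho> - pi / (6 * \<rho>) \<le> norm \<xi>" "norm \<xi> \<le> pi / \<rho> + pi / (6 * \<rho>)"
        using nd norm_triangle_ineq2[of \<xi>0 \<xi>] norm_triangle_ineq2[of \<xi> \<xi>0] by (auto simp: norm_minus_commute)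
      have "\<bar>e \<bullet> (\<xi> - \<xi>0)\<bar> \<le> pi / (6 * \<rho>)"
        using Cauchy_Schwarz_ineq2[of e "\<xi> - \<xi>0"] nd e by simp
      moreover have "e \<bullet> \<xi>0 = pi / \<rho>" using e by (simp add: \<xi>0_def dot_square_norm)
      ultimately have es: "\<bar>e \<bullet> \<xi> - pi / \<rho>\<bar> \<le> pi / (6 * \<rho>)" by (simp add: inner_diff_right)
      \<comment> \<open>The numbers \<open>e \<bullet> \<xi>\<close> and \<open>norm \<xi>\<close>
        both lie within \<open>pi / (6 * \<rho>)\<close> of \<open>pi / \<rho>\<close>. The phase
        weights them by \<open>norm (x - y)\<close> and \<open>t - s\<close>, nonnegative by the
        ordering of the times and of sum \<open>\<rho>\<close>, so it stays within
        \<open>pi / 6\<close> of \<open>pi\<close>.\<close>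
      let ?\<theta> = "(x - y) \<bullet> \<xi> + (t - s) * norm \<xi>"
      have \<rho>m: "\<rho> * (pi / \<rho>) = pi" "\<rho> * (pi / (6 * \<rho>)) = pi / 6" using \<rho> by simp_all
      have \<rho>d: "\<rho> * m = norm (x - y) * m + (t - s) * m" for m by (simp add: \<rho>_def algebra_simps)
      have "(x - y) \<bullet> \<xi> = norm (x - y) * (e \<bullet> \<xi>)" by (subst e(2)) simp
      then have "?\<theta> - pi = norm (x - y) * (e \<bullet> \<xi> - pi / \<rho>) + (t - s) * (norm \<xi> - pi / \<rho>)"
        using \<rho>m(1) \<rho>d[of "pi / \<rho>"] by (simp only: right_diff_distrib)
      also have "\<bar>\<dots>\<bar> \<le> \<bar>norm (x - y) * (e \<bullet> \<xi> - pi / \<rho>)\<bar> + \<bar>(t - s) * (norm \<xi> - pi / \<rho>)\<bar>"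
        by (rule abs_triangle_ineq)
      also have "\<dots> = norm (x - y) * \<bar>e \<bullet> \<xi> - pi / \<rho>\<bar> + (t - s) * \<bar>norm \<xi> - pi / \<rho>\<bar>"
        using st by (simp add: abs_mult)
      also have "\<dots> \<le> norm (x - y) * (pi / (6 * \<rho>)) + (t - s) * (pi / (6 * \<rho>))"
        using st r by (intro add_mono mult_left_mono es) (simp_all only: abs_le_iff norm_ge_zero, linarith+)
      also have "\<dots> = pi / 6" using \<rho>m(2) \<rho>d[of "pi / (6 * \<rho>)"] by (simp only:)
      also have "\<dots> \<le> pi / 2" by simp
      finally have cos: "cos ?\<theta> \<le> 0" by (rule cos_nonpos_near_pi)
      have r1: "2 / \<rho> \<le> norm \<xi>"
      proof -
        have "2 / \<rho> \<le> (pi - pi / 6) / \<rho>" using \<rho> pi_gt3 by (intro divide_right_mono) auto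
        also have "\<dots> = pi / \<rho> - pi / (6 * \<rho>)" by (simp add: diff_divide_distrib)
        finally show ?thesis using r by simp
      qed
      have r2: "norm \<xi> \<le> 5 / \<rho>"
      proof -
        have "pi / \<rho> + pi / (6 * \<rho>) = (pi + pi / 6) / \<rho>" by (simp add: add_divide_distrib)
        also have "\<dots> \<le> 5 / \<rho>" using \<rho> pi_less_4 by (intro divide_right_mono) auto
        finally show ?thesis using r by simp
      qed
      \<comment> \<open>Here the restriction to nearby parameters enters: it places the whole
        frequency ball in the range where the resonance dominates.\<close>
      have "8 / a \<le> 2 / \<rho>" using \<rho> a by (simp add: field_simps)
      then have r3: "8 / a \<le> norm \<xi>" using r1 by simp
      have r0: "0 < norm \<xi>" using a r3 by (smt (verit) divide_pos_pos)
      have "\<eta>0 \<le> norm \<xi>"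
      proof -
        have "a * a \<le> b * b" using a by (intro mult_mono) auto
        then have "\<eta>0 \<le> a / (4 * a\<^sup>2)"
          unfolding \<eta>0_def using a by (intro divide_left_mono) (auto simp: power2_eq_square)
        also have "\<dots> \<le> 8 / a" using a by (simp add: power2_eq_square field_simps)
        finally show ?thesis using r3 by simp
      qed
      then have \<tau>2: "0 < \<tau>" "\<tau> \<le> 10 / \<rho>" using \<tau> r2 r0 by auto
      have "a / (4 * norm \<xi>) \<le> norm (Fg t x \<tau> \<xi> - Fg s y \<tau> \<xi>)"
        using norm_Fg_diff_ge[of a s t b x y \<xi> "\<tau> - norm \<xi>"] a st cos r3 \<tau> by (simp add: \<eta>0_def)
      then have "(a / (4 * norm \<xi>))\<^sup>2 \<le> (norm (Fg t x \<tau> \<xi> - Fg s y \<tau> \<xi>))\<^sup>2"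
        using a by (intro power_mono) auto
      then have "a\<^sup>2 / 16 * norm \<xi> powr - 2 \<le> (norm (Fg t x \<tau> \<xi> - Fg s y \<tau> \<xi>))\<^sup>2"
        using r0 by (simp add: powr_minus powr_numeral power_divide power_mult_distrib divide_simps)
      moreover have "(10 / \<rho>) powr (1 - 2 * H) * (c1 * norm \<xi> powr - \<beta>) \<le> spectral_weight (\<tau>, \<xi>)"
        unfolding spectral_weight_def fst_conv snd_conv
        using \<tau>2 H h_bounds[of \<xi>] r0 c by (intro mult_mono powr_mono2') auto
      ultimately have "(a\<^sup>2 / 16 * norm \<xi> powr - 2) * ((10 / \<rho>) powr (1 - 2 * H) * (c1 * norm \<xi> powr - \<beta>))
         \<le> (norm (Fg t x \<tau> \<xi> - Fg s y \<tau> \<xi>))\<^sup>2 * spectral_weight (\<tau>, \<xi>)"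
        using c by (intro mult_mono) auto
      moreover have "L \<le> (a\<^sup>2 / 16 * norm \<xi> powr - 2) * ((10 / \<rho>) powr (1 - 2 * H) * (c1 * norm \<xi> powr - \<beta>))"
      proof -
        have "L = (a\<^sup>2 / 16 * c1) * (10 / \<rho>) powr (1 - 2 * H) * (5 / \<rho>) powr (- 2 - \<beta>)"
          using \<rho> by (simp add: L_def K_def powr_divide divide_simps flip: powr_add)
        also have "\<dots> \<le> (a\<^sup>2 / 16 * c1) * (10 / \<rho>) powr (1 - 2 * H) * norm \<xi> powr (- 2 - \<beta>)"
          using r0 r2 \<beta> c by (intro mult_left_mono powr_mono2') auto
        also have "norm \<xi> powr (- 2 - \<beta>) = norm \<xi> powr - 2 * norm \<xi> powr - \<beta>"
          by (simp flip: powr_add)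
        finally show ?thesis by (simp only: mult_ac)
      qed
      ultimately show ?thesis by linarith
    qed
    have L: "0 \<le> L" using pos by (simp add: L_def)
    have "ennreal (?c * \<rho> powr (2*H + 1 - real CARD('n) + \<beta>)) = ennreal (L * \<eta>0) * emeasure lborel (cball \<xi>0 (pi / (6 * \<rho>)))"
    proof -
      have "(pi / (6 * \<rho>)) ^ CARD('n) = (pi / 6) ^ CARD('n) * \<rho> powr - real CARD('n)"
        using \<rho> by (simp add: powr_minus powr_realpow power_divide power_mult_distrib field_simps)
      then have "?c * \<rho> powr (2*H + 1 - real CARD('n) + \<beta>) = (L * \<eta>0) * (unit_ball_vol (real CARD('n)) * (pi / (6 * \<rho>)) ^ CARD('n))"
        by (simp add: L_def V_def mult_ac flip: powr_add) (simp add: algebra_simps)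
      moreover have "emeasure lborel (cball \<xi>0 (pi / (6 * \<rho>))) = ennreal (unit_ball_vol (real CARD('n)) * (pi / (6 * \<rho>)) ^ CARD('n))"
        using \<rho> by (simp add: emeasure_cball)
      moreover have "0 \<le> L * \<eta>0" using L pos by simp
      ultimately show ?thesis by (simp only: ennreal_mult')
    qed
    also have "\<dots> = (\<integral>\<^sup>+\<xi>. ennreal (L * \<eta>0) * indicator (cball \<xi>0 (pi / (6 * \<rho>))) \<xi> \<partial>lborel)"
      by (rule nn_integral_cmult_indicator[symmetric]) simp
    also have "\<dots> \<le> spectral_dist (t, x) (s, y)"
      unfolding spectral_dist_def
    proof (intro nn_integral_mono)
      fix \<xi> :: "real^'n"
      show "ennreal (L * \<eta>0) * indicator (cball \<xi>0 (pi / (6 * \<rho>))) \<xi>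
         \<le> (\<integral>\<^sup>+\<tau>. ennreal ((Fg_incr (t, x) (s, y) \<tau> \<xi>)\<^sup>2 * spectral_weight (\<tau>, \<xi>)) \<partial>lborel)"
      proof (cases "\<xi> \<in> cball \<xi>0 (pi / (6 * \<rho>))")
        case True
        have "ennreal (L * \<eta>0) = ennreal L * emeasure lborel {norm \<xi> <.. norm \<xi> + \<eta>0}"
          using L pos by (simp add: ennreal_mult')
        also have "\<dots> = (\<integral>\<^sup>+\<tau>. ennreal L * indicator {norm \<xi> <.. norm \<xi> + \<eta>0} \<tau> \<partial>lborel)"
          by (rule nn_integral_cmult_indicator[symmetric]) simp
        also have "\<dots> \<le> (\<integral>\<^sup>+\<tau>. ennreal ((Fg_incr (t, x) (s, y) \<tau> \<xi>)\<^sup>2 * spectral_weight (\<tau>, \<xi>)) \<partial>lborel)"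
        proof (intro nn_integral_mono)
          fix \<tau> :: real
          show "ennreal L * indicator {norm \<xi> <.. norm \<xi> + \<eta>0} \<tau> \<le> ennreal ((Fg_incr (t, x) (s, y) \<tau> \<xi>)\<^sup>2 * spectral_weight (\<tau>, \<xi>))"
            using pw[OF True, of \<tau>] by (cases "\<tau> \<in> {norm \<xi> <.. norm \<xi> + \<eta>0}") (simp_all add: ennreal_leI)
        qed
        finally show ?thesis using True by simp
      qed simp
    qed
    finally show "ennreal (?c * (t - s + norm (x - y)) powr (2*H + 1 - real CARD('n) + \<beta>)) \<le> spectral_dist (t, x) (s, y)"
      unfolding \<rho>_def .
  qed
qed

lemma spectral_dist_lower:
  assumes a: "0 < a" "a \<le> b"
  shows "\<exists>c>0. \<forall>p q. fst p \<in> {a..b} \<longrightarrow> fst q \<in> {a..b} \<longrightarrow> p \<noteq> q \<longrightarrow>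
     \<bar>fst p - fst q\<bar> + norm (snd p - snd q) \<le> a / 4 \<longrightarrow>
     ennreal (c * (\<bar>fst p - fst q\<bar> + norm (snd p - snd q)) powr (2*H + 1 - real CARD('n) + \<beta>)) \<le> spectral_dist p q"
proof -
  obtain c where c: "0 < c" "\<And>s t x y. a \<le> s \<Longrightarrow> s \<le> t \<Longrightarrow> t \<le> b \<Longrightarrow> 0 < t - s + norm (x - y) \<Longrightarrow> t - s + norm (x - y) \<le> a / 4 \<Longrightarrow>
     ennreal (c * (t - s + norm (x - y)) powr (2*H + 1 - real CARD('n) + \<beta>)) \<le> spectral_dist (t, x) (s, y)"
    using spectral_dist_lower_ordered[OF a] by blast
  show ?thesis
  proof (intro exI[of _ c] conjI allI impI c(1))
    fix p q :: "real \<times> (real^'n)"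
    assume pq: "fst p \<in> {a..b}" "fst q \<in> {a..b}" "p \<noteq> q" "\<bar>fst p - fst q\<bar> + norm (snd p - snd q) \<le> a / 4"
    have pos: "0 < \<bar>fst p - fst q\<bar> + norm (snd p - snd q)"
      using pq(3) by (cases "fst p = fst q") (auto simp: prod_eq_iff add_pos_nonneg)
    show "ennreal (c * (\<bar>fst p - fst q\<bar> + norm (snd p - snd q)) powr (2*H + 1 - real CARD('n) + \<beta>)) \<le> spectral_dist p q"
    proof (cases "fst q \<le> fst p")
      case True
      then show ?thesis using c(2)[of "fst q" "fst p" "snd p" "snd q"] pq pos by simp
    next
      case False
      then have "\<bar>fst p - fst q\<bar> = fst q - fst p" by simp
      then show ?thesis
        using c(2)[of "fst p" "fst q" "snd q" "snd p"] pq pos False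
        by (simp add: norm_minus_commute spectral_dist_commute[of p])
    qed
  qed
qed

text \<open>Each kernel is square integrable because its norm is its distance to the point
  \<open>(0, snd p)\<close>, where the transform vanishes, and distances are finite. The product is
  dominated by the sum of the two squares.\<close>

lemma spectral_integrable:
  assumes p: "0 \<le> fst p" and q: "0 \<le> fst q"
  shows "integrable (lborel \<Otimes>\<^sub>M lborel) (\<lambda>z. Fg (fst p) (snd p) (fst z) (snd z) * cnj (Fg (fst q) (snd q) (fst z) (snd z))
     * complex_of_real (spectral_weight z))"
proof (rule integrableI_bounded)
  let ?F = "\<lambda>p z. Fg (fst p) (snd p) (fst z) (snd z :: real^'n)"
  let ?\<nu> = "lborel \<Otimes>\<^sub>M lborel :: (real \<times> (real^'n)) measure"
  have fin: "(\<integral>\<^sup>+z. ennreal ((norm (?F p z))\<^sup>2 * spectral_weight z) \<partial>?\<nu>) < \<infinity>" if "0 \<le> fst p" for p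
    using spectral_dist_finite[of p "(0, snd p)"] that
    unfolding spectral_dist_eq_nn_integral by (simp add: Fg_eq)
  have le: "ennreal (norm (?F p z * cnj (?F q z) * complex_of_real (spectral_weight z)))
     \<le> ennreal ((norm (?F p z))\<^sup>2 * spectral_weight z) + ennreal ((norm (?F q z))\<^sup>2 * spectral_weight z)" for z
  proof -
    have am_gm: "m * n \<le> m\<^sup>2 + n\<^sup>2" if "0 \<le> m" "0 \<le> n" for m n :: real
      using sum_squares_bound[of m n] mult_nonneg_nonneg[OF that] by linarith
    have "norm (?F p z) * norm (?F q z) \<le> (norm (?F p z))\<^sup>2 + (norm (?F q z))\<^sup>2"
      by (rule am_gm) simp_all
    then have "norm (?F p z) * norm (?F q z) * spectral_weight z \<le> ((norm (?F p z))\<^sup>2 + (norm (?F q z))\<^sup>2) * spectral_weight z"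
      by (rule mult_right_mono) simp
    then have "norm (?F p z * cnj (?F q z) * complex_of_real (spectral_weight z))
        \<le> (norm (?F p z))\<^sup>2 * spectral_weight z + (norm (?F q z))\<^sup>2 * spectral_weight z"
      by (simp add: norm_mult distrib_right)
    then have "ennreal (norm (?F p z * cnj (?F q z) * complex_of_real (spectral_weight z)))
        \<le> ennreal ((norm (?F p z))\<^sup>2 * spectral_weight z + (norm (?F q z))\<^sup>2 * spectral_weight z)"
      by (rule ennreal_leI)
    also have "\<dots> = ennreal ((norm (?F p z))\<^sup>2 * spectral_weight z) + ennreal ((norm (?F q z))\<^sup>2 * spectral_weight z)"
      by (rule ennreal_plus) auto
    finally show ?thesis .
  qed
  have "(\<integral>\<^sup>+z. ennreal (norm (?F p z * cnj (?F q z) * complex_of_real (spectral_weight z))) \<partial>?\<nu>)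
     \<le> (\<integral>\<^sup>+z. ennreal ((norm (?F p z))\<^sup>2 * spectral_weight z) + ennreal ((norm (?F q z))\<^sup>2 * spectral_weight z) \<partial>?\<nu>)"
    by (intro nn_integral_mono le)
  also have "\<dots> = (\<integral>\<^sup>+z. ennreal ((norm (?F p z))\<^sup>2 * spectral_weight z) \<partial>?\<nu>) + (\<integral>\<^sup>+z. ennreal ((norm (?F q z))\<^sup>2 * spectral_weight z) \<partial>?\<nu>)"
    by (rule nn_integral_add) measurable
  also have "\<dots> < \<infinity>" using fin[OF p] fin[OF q] by simp
  finally show "(\<integral>\<^sup>+z. ennreal (norm (?F p z * cnj (?F q z) * complex_of_real (spectral_weight z))) \<partial>?\<nu>) < \<infinity>" .
  show "(\<lambda>z. ?F p z * cnj (?F q z) * complex_of_real (spectral_weight z)) \<in> borel_measurable ?\<nu>"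
    using spectral_integrand_measurable by (simp cong: measurable_cong_sets)
qed

lemma wave_cov_eq_integral:
  assumes "0 \<le> fst p" "0 \<le> fst q"
  shows "wave_cov cH H h p q = of_real cH * (LINT z|(lborel \<Otimes>\<^sub>M lborel). Fg (fst p) (snd p) (fst z) (snd z)
     * cnj (Fg (fst q) (snd q) (fst z) (snd z)) * complex_of_real (spectral_weight z))"
  unfolding wave_cov_def
  using lborel_pair.integral_fst'[OF spectral_integrable[OF assms]]
  by (simp add: spectral_weight_def mult.assoc)

text \<open>Polarization: the four covariance entries assemble the squared modulus of the kernel
  difference. The distance is handed over as a real number \<open>v\<close>, so that it can be
  compared with expectations.\<close>

lemma wave_cov_increment:
  assumes p: "0 \<le> fst p" and q: "0 \<le> fst q"
  shows "\<exists>v\<ge>0. ennreal v = spectral_dist p q \<and>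
     wave_cov cH H h p p - wave_cov cH H h p q - wave_cov cH H h q p + wave_cov cH H h q q = of_real (cH * v)"
proof -
  let ?F = "\<lambda>p z. Fg (fst p) (snd p) (fst z) (snd z :: real^'n)"
  let ?\<nu> = "lborel \<Otimes>\<^sub>M lborel :: (real \<times> (real^'n)) measure"
  let ?I = "\<lambda>p q. LINT z|?\<nu> . ?F p z * cnj (?F q z) * complex_of_real (spectral_weight z)"
  let ?D = "\<lambda>z. (norm (?F p z - ?F q z))\<^sup>2 * spectral_weight z"
  note int = spectral_integrable
  have "enn2real (spectral_dist p q) = (LINT z|?\<nu> . ?D z)"
    unfolding spectral_dist_eq_nn_integral by (subst integral_eq_nn_integral) auto
  moreover have "ennreal (enn2real (spectral_dist p q)) = spectral_dist p q"
    using spectral_dist_finite[OF p q] by (simp add: less_top[symmetric])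
  moreover have "?I p p - ?I p q - ?I q p + ?I q q = of_real (LINT z|?\<nu> . ?D z)"
  proof -
    have D: "complex_of_real (?D z) = ?F p z * cnj (?F p z) * complex_of_real (spectral_weight z)
       - ?F p z * cnj (?F q z) * complex_of_real (spectral_weight z)
       - ?F q z * cnj (?F p z) * complex_of_real (spectral_weight z)
       + ?F q z * cnj (?F q z) * complex_of_real (spectral_weight z)" for z
      unfolding of_real_mult complex_norm_square by (simp add: algebra_simps)
    have "of_real (LINT z|?\<nu> . ?D z) = (LINT z|?\<nu> . complex_of_real (?D z))"
      by (rule integral_complex_of_real[symmetric])
    also have "\<dots> = ?I p p - ?I p q - ?I q p + ?I q q"
      unfolding D using int[OF p p] int[OF p q] int[OF q p] int[OF q q]
      by (simp only: Bochner_Integration.integral_add Bochner_Integration.integral_diff Bochner_Integration.integrable_diff)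
    finally show ?thesis by simp
  qed
  ultimately show ?thesis
    by (intro exI[of _ "enn2real (spectral_dist p q)"])
       (simp add: wave_cov_eq_integral p q flip: right_diff_distrib distrib_left of_real_mult)
qed

end

section \<open>Dyadic densities\<close>

definition dyadic_index :: "nat \<Rightarrow> real^'d \<Rightarrow> 'd \<Rightarrow> int" where
  "dyadic_index n v = (\<lambda>j. \<lfloor>2 ^ n * v $ j\<rfloor>)"

text \<open>Mass of the cell containing \<open>v\<close> divided by its volume. It is written as an
  integral of a kernel so that Fubini and the transfer of occupation integrals to the parameter
  space apply directly.\<close>

definition dyadic_density :: "(real^'d::finite) measure \<Rightarrow> nat \<Rightarrow> real^'d \<Rightarrow> ennreal" where
  "dyadic_density \<nu> n v = (\<integral>\<^sup>+w. ennreal (2 ^ (n * CARD('d))) * indicator {w. dyadic_index n w = dyadic_index n v} w \<partial>\<nu>)"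

text \<open>Integer division recovers the coarse floor from the fine one. Consequently, functions
  constant on cells of generation \<open>n\<close> are constant on all finer cells, which is the
  filtration property behind the martingale.\<close>

lemma dyadic_index_coarsen:
  assumes "n \<le> m" "dyadic_index m v = dyadic_index m w"
  shows "dyadic_index n v = dyadic_index n w"
proof
  fix j
  have "\<lfloor>2 ^ n * x\<rfloor> = \<lfloor>2 ^ m * x\<rfloor> div 2 ^ (m - n)" for x :: real
  proof -
    have "(2::real) ^ m = 2 ^ n * 2 ^ (m - n)" using assms(1) by (simp flip: power_add)
    then have "2 ^ n * x = (2 ^ m * x) / real_of_int (2 ^ (m - n))" by simp
    then show ?thesis by (simp only: floor_divide_real_eq_div zero_le_power zero_le_numeral)
  qed
  then show "dyadic_index n v j = dyadic_index n w j"
    using fun_cong[OF assms(2), of j] by (simp add: dyadic_index_def)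
qed

lemma dyadic_index_eq_imp_close:
  assumes "dyadic_index n v = dyadic_index n w"
  shows "\<bar>v $ j - w $ j\<bar> \<le> 1 / 2 ^ n"
proof -
  have "\<lfloor>2 ^ n * v $ j\<rfloor> = \<lfloor>2 ^ n * w $ j\<rfloor>"
    using fun_cong[OF assms, of j] by (simp add: dyadic_index_def)
  then have "\<bar>2 ^ n * v $ j - 2 ^ n * w $ j\<bar> \<le> 1" by linarith
  then have "2 ^ n * \<bar>v $ j - w $ j\<bar> \<le> 1"
    by (simp add: abs_mult flip: right_diff_distrib)
  then show ?thesis by (simp add: field_simps)
qed

lemma vec_nth_measurable [measurable (raw)]:
  fixes f :: "'a \<Rightarrow> real^'d::finite"
  assumes "f \<in> borel_measurable M"
  shows "(\<lambda>x. f x $ j) \<in> borel_measurable M"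
  by (rule measurable_compose[OF assms borel_measurable_nth])

lemma dyadic_index_eq_measurable [measurable (raw)]:
  fixes f g :: "'a \<Rightarrow> real^'d::finite"
  assumes [measurable]: "f \<in> borel_measurable M" "g \<in> borel_measurable M"
  shows "Measurable.pred M (\<lambda>x. dyadic_index n (f x) = dyadic_index n (g x))"
proof -
  have "Measurable.pred M (\<lambda>x. \<forall>j\<in>UNIV. \<lfloor>2 ^ n * f x $ j\<rfloor> = \<lfloor>2 ^ n * g x $ j\<rfloor>)"
    by (rule pred_intros_finite) (simp, measurable)
  then show ?thesis by (simp add: dyadic_index_def fun_eq_iff)
qed

lemma dyadic_cell_nonempty: "\<exists>w :: real^'d::finite. dyadic_index n w = c"
  by (rule exI[of _ "\<chi> j. of_int (c j) / 2 ^ n"]) (simp add: dyadic_index_def)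

lemma dyadic_cell_measurable [measurable]:
  "{w :: real^'d::finite. dyadic_index n w = c} \<in> sets borel"
proof -
  obtain v :: "real^'d" where "dyadic_index n v = c" using dyadic_cell_nonempty by blast
  then show ?thesis
    using dyadic_index_eq_measurable[of "\<lambda>x. x" borel "\<lambda>_. v" n] by (simp add: pred_def)
qed

lemma emeasure_dyadic_cell:
  "emeasure lborel {w :: real^'d::finite. dyadic_index n w = c} = ennreal (1 / 2 ^ (n * CARD('d)))"
proof -
  define l u :: "real^'d" where "l = (\<chi> j. of_int (c j) / 2 ^ n)" and "u = (\<chi> j. (of_int (c j) + 1) / 2 ^ n)"
  let ?A = "{w :: real^'d. dyadic_index n w = c}"
  have mem: "w \<in> ?A \<longleftrightarrow> (\<forall>j. l $ j \<le> w $ j \<and> w $ j < u $ j)" for w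
    by (simp add: dyadic_index_def fun_eq_iff l_def u_def floor_eq_iff field_simps)
  have lu: "(u - l) \<bullet> b = 1 / 2 ^ n" "l \<bullet> b \<le> u \<bullet> b" if "b \<in> Basis" for b
    using that by (auto simp: Basis_vec_def l_def u_def inner_axis diff_divide_distrib[symmetric] divide_right_mono)
  have "(\<Prod>b\<in>Basis. (u - l) \<bullet> b) = (1 / 2 ^ n) ^ CARD('d)"
    by (subst prod.cong[OF refl lu(1)]) simp_all
  then have vol: "emeasure lborel (box l u) = ennreal (1 / 2 ^ (n * CARD('d)))"
    "emeasure lborel (cbox l u) = ennreal (1 / 2 ^ (n * CARD('d)))"
    using lu by (simp_all add: emeasure_lborel_box_eq emeasure_lborel_cbox_eq power_mult power_divide)
  have "box l u \<subseteq> ?A" "?A \<subseteq> cbox l u"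
    unfolding subset_iff mem by (simp_all add: mem_box_cart less_imp_le)
  then have "emeasure lborel (box l u) \<le> emeasure lborel ?A" "emeasure lborel ?A \<le> emeasure lborel (cbox l u)"
    by (auto intro!: emeasure_mono)
  then show ?thesis unfolding vol by (rule antisym[rotated])
qed

lemma open_eq_Union_dyadic_cells:
  fixes U :: "(real^'d::finite) set"
  assumes "open U"
  shows "U = (\<Union>(n, c) \<in> {(n, c). {w. dyadic_index n w = c} \<subseteq> U}. {w. dyadic_index n w = c})"
proof (intro equalityI subsetI)
  fix v assume "v \<in> U"
  then obtain e where e: "0 < e" "ball v e \<subseteq> U" using assms by (auto simp: open_contains_ball)
  obtain n where n: "real CARD('d) / e < 2 ^ n"
    using real_arch_pow[of 2 "real CARD('d) / e"] by auto
  have "w \<in> ball v e" if "dyadic_index n w = dyadic_index n v" for w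
  proof -
    have "norm (v - w) \<le> (\<Sum>j\<in>UNIV. \<bar>(v - w) $ j\<bar>)" by (rule norm_le_l1_cart)
    also have "\<dots> \<le> (\<Sum>j\<in>(UNIV :: 'd set). 1 / 2 ^ n)"
      using dyadic_index_eq_imp_close[OF that[symmetric]] by (intro sum_mono) simp
    also have "\<dots> = real CARD('d) / 2 ^ n" by simp
    also have "\<dots> < e" using n e by (simp add: field_simps)
    finally show ?thesis by (simp add: dist_norm)
  qed
  then have "{w. dyadic_index n w = dyadic_index n v} \<subseteq> U" using e by blast
  then show "v \<in> (\<Union>(n, c) \<in> {(n, c). {w. dyadic_index n w = c} \<subseteq> U}. {w. dyadic_index n w = c})"
    by blast
qed auto

text \<open>Two dyadic cells are nested or disjoint, so together with the empty set they are stable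
  under intersection. They generate the Borel sets because every open set is a countable union of
  cells, and the unit cells exhaust the space with finite mass.\<close>

lemma measure_eqI_dyadic:
  fixes \<mu> \<nu> :: "(real^'d::finite) measure"
  assumes sets: "sets \<mu> = sets borel" "sets \<nu> = sets borel"
    and eq: "\<And>n c. emeasure \<mu> {w. dyadic_index n w = c} = emeasure \<nu> {w. dyadic_index n w = c}"
    and fin: "\<And>c. emeasure \<mu> {w. dyadic_index 0 w = c} \<noteq> \<infinity>"
  shows "\<mu> = \<nu>"
proof -
  define E where "E = insert {} (range (\<lambda>(n, c). {w :: real^'d. dyadic_index n w = c}))"
  have sig: "sets borel = sigma_sets UNIV E"
  proof -
    have "sigma_sets UNIV (Collect open) = sigma_sets UNIV E"
    proof (rule sigma_sets_eqI)
      fix U :: "(real^'d) set" assume "U \<in> Collect open"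
      moreover have "(\<Union>(n, c) \<in> {(n, c). {w. dyadic_index n w = c} \<subseteq> U}. {w. dyadic_index n w = c}) \<in> sigma_sets UNIV E"
        by (rule sigma_sets_UNION) (auto simp: E_def intro!: sigma_sets.Basic)
      ultimately show "U \<in> sigma_sets UNIV E" using open_eq_Union_dyadic_cells[of U] by simp
    next
      fix A assume "A \<in> E"
      then have "A \<in> sets borel" by (auto simp: E_def)
      then show "A \<in> sigma_sets UNIV (Collect open)" by (simp add: borel_def)
    qed
    then show ?thesis by (simp add: borel_def)
  qed
  have "Int_stable E"
  proof (rule Int_stableI)
    fix A B assume "A \<in> E" "B \<in> E"
    have nested: "{w. dyadic_index n w = c} \<inter> {w. dyadic_index m w = c'} \<in> E" if "n \<le> m" for n m and c c' :: "'d \<Rightarrow> int"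
    proof -
      obtain v :: "real^'d" where v: "dyadic_index m v = c'" using dyadic_cell_nonempty by blast
      have "{w. dyadic_index m w = c'} \<subseteq> {w. dyadic_index n w = c} \<or> {w. dyadic_index n w = c} \<inter> {w. dyadic_index m w = c'} = {}"
        using dyadic_index_coarsen[OF that] v by (smt (verit) Collect_mono disjoint_iff mem_Collect_eq)
      then show ?thesis
        by (auto simp: E_def Int_absorb1 intro!: rev_image_eqI[of "(m, c')"])
    qed
    show "A \<inter> B \<in> E"
    proof (cases "A = {} \<or> B = {}")
      case False
      then obtain n c m c' where *: "A = {w. dyadic_index n w = c}" "B = {w. dyadic_index m w = c'}"
        using \<open>A \<in> E\<close> \<open>B \<in> E\<close> by (auto simp: E_def)
      show ?thesis
        using nested[of n m c c'] nested[of m n c' c] unfolding * by (cases "n \<le> m") (auto simp: Int_commute)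
    qed (auto simp: E_def)
  qed
  then show ?thesis
  proof (rule measure_eqI_generator_eq[where A="\<lambda>i. {w. dyadic_index 0 w = from_nat i}" and \<Omega>=UNIV])
    show "emeasure \<mu> X = emeasure \<nu> X" if "X \<in> E" for X
      using that eq by (auto simp: E_def)
    show "(\<Union>i. {w :: real^'d. dyadic_index 0 w = from_nat i}) = UNIV"
    proof (intro equalityI subsetI UNIV_I)
      show "v \<in> (\<Union>i. {w. dyadic_index 0 w = from_nat i})" for v :: "real^'d"
        by (rule UN_I[of "to_nat (dyadic_index 0 v)"]) auto
    qed
  qed (use sets sig fin in \<open>auto simp: E_def\<close>)
qed

lemma dyadic_density_measurable [measurable]:
  assumes "finite_measure \<nu>" "sets \<nu> = sets borel"
  shows "dyadic_density \<nu> n \<in> borel_measurable borel"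
proof -
  interpret finite_measure \<nu> by fact
  have [measurable_cong]: "sets \<nu> = sets borel" by fact
  show ?thesis
    unfolding dyadic_density_def[abs_def] by measurable
qed

text \<open>\<open>dyadic_density \<nu> n\<close> is the density of the conditional expectation of \<open>\<nu>\<close> on the dyadic cells
  of generation \<open>n\<close>.\<close>
lemma nn_integral_dyadic_density:
  fixes g :: "real^'d::finite \<Rightarrow> ennreal"
  assumes "finite_measure \<nu>" and [measurable_cong]: "sets \<nu> = sets borel"
    and [measurable]: "g \<in> borel_measurable borel"
    and g: "\<And>v w. dyadic_index n v = dyadic_index n w \<Longrightarrow> g v = g w"
  shows "(\<integral>\<^sup>+v. g v * dyadic_density \<nu> n v \<partial>lborel) = (\<integral>\<^sup>+v. g v \<partial>\<nu>)"
proof -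
  interpret finite_measure \<nu> by fact
  interpret pair_sigma_finite lborel \<nu> ..
  let ?c = "ennreal (2 ^ (n * CARD('d)))"
  define k where "k v w = ?c * indicator {w. dyadic_index n w = dyadic_index n v} w" for v w :: "real^'d"
  have k_measurable [measurable]: "case_prod k \<in> borel_measurable (borel \<Otimes>\<^sub>M borel)"
    unfolding k_def[abs_def] by measurable
  have "(\<integral>\<^sup>+v. g v * dyadic_density \<nu> n v \<partial>lborel) = (\<integral>\<^sup>+v. \<integral>\<^sup>+w. g v * k v w \<partial>\<nu> \<partial>lborel)"
    unfolding dyadic_density_def k_def[symmetric]
  proof (intro nn_integral_cong nn_integral_cmult[symmetric])
    show "k v \<in> borel_measurable \<nu>" for v by measurable
  qed
  also have "\<dots> = (\<integral>\<^sup>+w. \<integral>\<^sup>+v. g v * k v w \<partial>lborel \<partial>\<nu>)"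
  proof (rule Fubini'[symmetric])
    have "(\<lambda>z. g (fst z) * case_prod k z) \<in> borel_measurable (borel \<Otimes>\<^sub>M borel)"
      by measurable
    then show "(\<lambda>(v, w). g v * k v w) \<in> borel_measurable (lborel \<Otimes>\<^sub>M \<nu>)"
      by (simp add: case_prod_beta' assms(2) cong: measurable_cong_sets sets_pair_measure_cong)
  qed
  also have "\<dots> = (\<integral>\<^sup>+w. g w \<partial>\<nu>)"
  proof (intro nn_integral_cong)
    fix w
    have "g v * k v w = (g w * ?c) * indicator {v. dyadic_index n v = dyadic_index n w} v" for v
      using g[of v w] by (auto simp: indicator_def k_def)
    then have "(\<integral>\<^sup>+v. g v * k v w \<partial>lborel) = (\<integral>\<^sup>+v. (g w * ?c) * indicator {v. dyadic_index n v = dyadic_index n w} v \<partial>lborel)"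
      by simp
    also have "\<dots> = (g w * ?c) * emeasure lborel {v. dyadic_index n v = dyadic_index n w}"
      by (rule nn_integral_cmult_indicator) simp
    also have "\<dots> = g w * (?c * ennreal (1 / 2 ^ (n * CARD('d))))"
      by (simp only: emeasure_dyadic_cell mult.assoc)
    also have "?c * ennreal (1 / 2 ^ (n * CARD('d))) = 1"
      by (subst ennreal_mult[symmetric]) simp_all
    finally show "(\<integral>\<^sup>+v. g v * k v w \<partial>lborel) = g w" by simp
  qed
  finally show ?thesis .
qed

lemma dyadic_density_cong:
  "dyadic_index n v = dyadic_index n w \<Longrightarrow> dyadic_density \<nu> n v = dyadic_density \<nu> n w"
  by (simp add: dyadic_density_def)

text \<open>Martingale orthogonality: the value does not depend on \<open>m\<close>. Taking
  \<open>m = n\<close> as well shows that the squared L^2 distance of two generations is the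
  difference of their energies.\<close>

lemma nn_integral_dyadic_density_mult:
  assumes \<nu>: "finite_measure \<nu>" "sets \<nu> = sets borel" and "n \<le> m"
  shows "(\<integral>\<^sup>+v. dyadic_density \<nu> n v * dyadic_density \<nu> m v \<partial>lborel) = (\<integral>\<^sup>+v. dyadic_density \<nu> n v \<partial>\<nu>)"
  by (intro nn_integral_dyadic_density[OF \<nu>] dyadic_density_measurable[OF \<nu>] dyadic_density_cong)
     (rule dyadic_index_coarsen[OF \<open>n \<le> m\<close>])

lemma dyadic_density_le:
  assumes "sets \<nu> = sets borel"
  shows "dyadic_density \<nu> n (v::real^'d::finite) \<le> ennreal (2 ^ (n * CARD('d))) * emeasure \<nu> UNIV"
proof -
  have "dyadic_density \<nu> n v = ennreal (2 ^ (n * CARD('d))) * emeasure \<nu> {w. dyadic_index n w = dyadic_index n v}"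
    unfolding dyadic_density_def by (rule nn_integral_cmult_indicator) (simp add: assms)
  also have "\<dots> \<le> ennreal (2 ^ (n * CARD('d))) * emeasure \<nu> UNIV"
    by (intro mult_left_mono emeasure_mono) (use assms sets_eq_imp_space_eq[OF assms] sets.top[of \<nu>] in auto)
  finally show ?thesis .
qed

section \<open>Existence of local times\<close>

text \<open>The weight \<open>4 ^ k\<close> lies between 1 and the available \<open>16 ^ k\<close>:
  the integral of \<open>G\<close> is a convergent geometric series, while each increment is still
  at most \<open>sqrt G * (1/2) ^ k\<close>. The bound \<open>sqrt g \<le> 1 + g\<close> turns this
  into a majorant that is integrable on sets of finite measure. The pointwise limit and the majorant
  are both needed, for the local time and for dominated convergence.\<close>

lemma fast_L2_convergence:
  fixes f :: "nat \<Rightarrow> 'b \<Rightarrow> real"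
  assumes [measurable]: "\<And>k. f k \<in> borel_measurable P"
    and fast: "\<And>k. (\<integral>\<^sup>+x. ennreal ((f (Suc k) x - f k x)\<^sup>2) \<partial>P) \<le> ennreal ((1/16) ^ k)"
  obtains G where "G \<in> borel_measurable P" "(\<integral>\<^sup>+x. G x \<partial>P) < \<infinity>"
    "AE x in P. convergent (\<lambda>k. f k x) \<and> (\<forall>k. ennreal (f k x) \<le> ennreal (f 0 x) + 2 * (1 + G x))"
proof
  define G where "G x = (\<Sum>k. ennreal (4 ^ k * (f (Suc k) x - f k x)\<^sup>2))" for x
  show [measurable]: "G \<in> borel_measurable P" unfolding G_def[abs_def] by measurable
  have "(\<integral>\<^sup>+x. G x \<partial>P) = (\<Sum>k. \<integral>\<^sup>+x. ennreal (4 ^ k * (f (Suc k) x - f k x)\<^sup>2) \<partial>P)"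
    unfolding G_def by (rule nn_integral_suminf) measurable
  also have "\<dots> \<le> (\<Sum>k. ennreal ((1/4) ^ k))"
  proof (rule suminf_le)
    fix k
    have "(\<integral>\<^sup>+x. ennreal (4 ^ k * (f (Suc k) x - f k x)\<^sup>2) \<partial>P) = ennreal (4 ^ k) * (\<integral>\<^sup>+x. ennreal ((f (Suc k) x - f k x)\<^sup>2) \<partial>P)"
      by (subst nn_integral_cmult[symmetric]) (simp_all add: ennreal_mult')
    also have "\<dots> \<le> ennreal (4 ^ k) * ennreal ((1/16) ^ k)" by (intro mult_left_mono fast) simp
    also have "\<dots> = ennreal ((1/4) ^ k)"
      by (subst ennreal_mult[symmetric]) (simp_all add: power_mult_distrib[symmetric])
    finally show "(\<integral>\<^sup>+x. ennreal (4 ^ k * (f (Suc k) x - f k x)\<^sup>2) \<partial>P) \<le> ennreal ((1/4) ^ k)" .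
  qed simp_all
  also have "\<dots> < \<infinity>"
    using summable_geometric[of "1/4 :: real"] by (simp add: suminf_ennreal2 less_top[symmetric])
  finally show G_fin: "(\<integral>\<^sup>+x. G x \<partial>P) < \<infinity>" .
  have "AE x in P. G x \<noteq> \<infinity>"
    using G_fin by (intro nn_integral_noteq_infinite) auto
  then show "AE x in P. convergent (\<lambda>k. f k x) \<and> (\<forall>k. ennreal (f k x) \<le> ennreal (f 0 x) + 2 * (1 + G x))"
  proof eventually_elim
    fix x assume "G x \<noteq> \<infinity>"
    then obtain g where g: "0 \<le> g" "G x = ennreal g" by (cases "G x") auto
    define d where "d k = f (Suc k) x - f k x" for k
    have d: "\<bar>d k\<bar> \<le> sqrt g * (1/2) ^ k" for k
    proof -
      have "ennreal (4 ^ k * (d k)\<^sup>2) \<le> G x"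
        unfolding G_def d_def by (rule le_suminf_ennreal)
      then have "4 ^ k * (d k)\<^sup>2 \<le> g" using g by simp
      then have "(d k)\<^sup>2 \<le> g * (1/4) ^ k" by (simp add: power_divide field_simps)
      also have "\<dots> = (sqrt g * (1/2) ^ k)\<^sup>2"
      proof -
        have "((1/2 :: real) ^ k)\<^sup>2 = (1/4) ^ k" by (simp add: power2_eq_square flip: power_mult_distrib)
        then show ?thesis using g by (simp add: power_mult_distrib)
      qed
      finally have "\<bar>d k\<bar>\<^sup>2 \<le> (sqrt g * (1/2) ^ k)\<^sup>2" by simp
      then show ?thesis by (rule power2_le_imp_le) (use g in simp)
    qed
    have geo: "summable (\<lambda>k. sqrt g * (1/2) ^ k)" by (intro summable_mult summable_geometric) simp
    have tele: "f k x = f 0 x + (\<Sum>i<k. d i)" for k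
      unfolding d_def by (subst sum_lessThan_telescope) simp
    have "summable d" using geo d by (intro summable_comparison_test'[OF geo]) auto
    then have "(\<lambda>k. f 0 x + (\<Sum>i<k. d i)) \<longlonglongrightarrow> f 0 x + suminf d"
      by (intro tendsto_intros summable_LIMSEQ)
    then have "convergent (\<lambda>k. f k x)" unfolding tele[symmetric] by (rule convergentI)
    moreover have "ennreal (f k x) \<le> ennreal (f 0 x) + 2 * (1 + G x)" for k
    proof -
      have "(\<Sum>i<k. d i) \<le> (\<Sum>i<k. sqrt g * (1/2) ^ i)"
        using d by (intro sum_mono) (simp add: abs_le_iff)
      also have "\<dots> \<le> (\<Sum>i. sqrt g * (1/2) ^ i)"
        using g by (intro sum_le_suminf geo) auto
      also have "\<dots> = 2 * sqrt g"
        using suminf_geometric[of "1/2 :: real"] by (subst suminf_mult) auto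
      also have "sqrt g \<le> 1 + g"
        using g by (intro real_le_lsqrt) (auto simp: power2_eq_square algebra_simps)
      finally have "f k x \<le> f 0 x + 2 * (1 + g)" using tele[of k] by simp
      then have "ennreal (f k x) \<le> ennreal (f 0 x + 2 * (1 + g))" by (rule ennreal_leI)
      also have "\<dots> \<le> ennreal (f 0 x) + ennreal (2 * (1 + g))"
        using g by (cases "0 \<le> f 0 x") (simp_all add: ennreal_neg ennreal_leI del: ennreal_plus flip: ennreal_plus)
      also have "ennreal (2 * (1 + g)) = 2 * (1 + G x)" using g by (simp add: ennreal_mult')
      finally show ?thesis .
    qed
    ultimately show "convergent (\<lambda>k. f k x) \<and> (\<forall>k. ennreal (f k x) \<le> ennreal (f 0 x) + 2 * (1 + G x))" by blast
  qed
qed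

section \<open>The martingale limit of the occupation densities\<close>

locale measurable_random_field = prob_space M for M :: "'a measure" +
  fixes X :: "'k::euclidean_space \<Rightarrow> 'a \<Rightarrow> real^'d::finite"
  assumes X_measurable [measurable]: "(\<lambda>(z, \<omega>). X z \<omega>) \<in> borel_measurable (borel \<Otimes>\<^sub>M M)"
begin

sublocale pair: pair_sigma_finite "lborel :: (real^'d) measure" M ..

abbreviation "occ A \<omega> \<equiv> occupation_measure A (\<lambda>z. X z \<omega>)"

text \<open>The squared L^2 norm of the density of generation \<open>n\<close>. Integrating one
  density against the occupation measure makes it a double integral over pairs of parameters, whose
  expectation is a two-point quantity.\<close>

definition energy :: "'k set \<Rightarrow> nat \<Rightarrow> 'a \<Rightarrow> ennreal" where
  "energy A n \<omega> = (\<integral>\<^sup>+v. dyadic_density (occ A \<omega>) n v \<partial>occ A \<omega>)"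

lemma X_section [measurable]: "\<omega> \<in> space M \<Longrightarrow> (\<lambda>z. X z \<omega>) \<in> borel_measurable borel"
  using measurable_compose[OF measurable_Pair2' X_measurable, of \<omega>] by (simp add: split_beta')

lemma sets_occ [simp]: "sets (occ A \<omega>) = sets borel"
  by (simp add: occupation_measure_def)

lemma nn_integral_occ:
  assumes \<omega>: "\<omega> \<in> space M" and A: "A \<in> sets borel" and f [measurable]: "f \<in> borel_measurable borel"
  shows "(\<integral>\<^sup>+v. f v \<partial>occ A \<omega>) = (\<integral>\<^sup>+z. f (X z \<omega>) * indicator A z \<partial>lborel)"
proof -
  have [measurable]: "(\<lambda>z. X z \<omega>) \<in> borel_measurable borel" using \<omega> by (rule X_section)
  have m: "(\<lambda>z. X z \<omega>) \<in> restrict_space lborel A \<rightarrow>\<^sub>M lborel"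
    by (rule measurable_restrict_space1) simp
  show ?thesis
    unfolding occupation_measure_def
    by (subst nn_integral_distr[OF m]) (use A in \<open>simp_all add: nn_integral_restrict_space\<close>)
qed

lemma emeasure_occ:
  assumes \<omega>: "\<omega> \<in> space M" and A: "A \<in> sets borel" and B: "B \<in> sets borel"
  shows "emeasure (occ A \<omega>) B = (\<integral>\<^sup>+z. indicator B (X z \<omega>) * indicator A z \<partial>lborel)"
  using nn_integral_occ[OF \<omega> A, of "indicator B"] B by simp

lemma occ_finite:
  assumes "\<omega> \<in> space M" "A \<in> sets borel" "emeasure lborel A < \<infinity>"
  shows "finite_measure (occ A \<omega>)" "emeasure (occ A \<omega>) UNIV = emeasure lborel A"
proof -
  show *: "emeasure (occ A \<omega>) UNIV = emeasure lborel A"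
    using assms by (subst emeasure_occ) simp_all
  have "space (occ A \<omega>) = UNIV" by (simp add: occupation_measure_def)
  then show "finite_measure (occ A \<omega>)"
    using * assms by (intro finite_measureI) simp
qed

lemma dyadic_density_occ:
  assumes "\<omega> \<in> space M" "A \<in> sets borel"
  shows "dyadic_density (occ A \<omega>) n v
    = (\<integral>\<^sup>+z. ennreal (2 ^ (n * CARD('d))) * indicator {w. dyadic_index n w = dyadic_index n v} (X z \<omega>) * indicator A z \<partial>lborel)"
  unfolding dyadic_density_def by (rule nn_integral_occ[OF assms]) measurable

lemma dyadic_density_occ_measurable:
  assumes [measurable]: "A \<in> sets borel"
  shows "(\<lambda>p. dyadic_density (occ A (snd p)) n (fst p)) \<in> borel_measurable (lborel \<Otimes>\<^sub>M M)"
proof -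
  let ?g = "\<lambda>p. \<integral>\<^sup>+z. ennreal (2 ^ (n * CARD('d))) * indicator {q. dyadic_index n (fst q) = dyadic_index n (snd q)} (X z (snd p), fst p)
     * indicator A z \<partial>lborel"
  have [measurable]: "{q :: (real^'d) \<times> (real^'d). dyadic_index n (fst q) = dyadic_index n (snd q)} \<in> sets (borel \<Otimes>\<^sub>M borel)"
  proof -
    have "Measurable.pred (borel \<Otimes>\<^sub>M borel) (\<lambda>q :: (real^'d) \<times> (real^'d). dyadic_index n (fst q) = dyadic_index n (snd q))"
      by measurable
    then show ?thesis by (simp add: pred_def space_pair_measure)
  qed
  have "?g \<in> borel_measurable (lborel \<Otimes>\<^sub>M M)" by measurable
  moreover have "?g p = dyadic_density (occ A (snd p)) n (fst p)" if "p \<in> space (lborel \<Otimes>\<^sub>M M)" for p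
    using that assms by (subst dyadic_density_occ) (auto simp: space_pair_measure indicator_def intro!: nn_integral_cong)
  ultimately show ?thesis
    using measurable_cong[of "lborel \<Otimes>\<^sub>M M" ?g "\<lambda>p. dyadic_density (occ A (snd p)) n (fst p)" borel] by blast
qed

lemma energy_eq:
  assumes "\<omega> \<in> space M" "A \<in> sets borel" "emeasure lborel A < \<infinity>"
  shows "energy A n \<omega> = (\<integral>\<^sup>+v. dyadic_density (occ A \<omega>) n v * dyadic_density (occ A \<omega>) n v \<partial>lborel)"
  unfolding energy_def using assms by (intro nn_integral_dyadic_density_mult[symmetric] occ_finite) auto

text \<open>The martingale is handled in L^2 of the product of value space and probability space:
  Pythagoras and a fast subsequence replace a convergence theorem. Working on the product makes the
  limit jointly measurable in value and sample point, as the local time must be.\<close>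

lemma local_time_exists:
  assumes S [measurable]: "S \<in> sets borel" and S_fin: "emeasure lborel S < \<infinity>"
    and K: "K < \<infinity>" "\<And>n. (\<integral>\<^sup>+\<omega>. energy S n \<omega> \<partial>M) \<le> K"
  shows "has_sq_int_local_time M X S"
proof -
  let ?P = "lborel \<Otimes>\<^sub>M M :: ((real^'d) \<times> 'a) measure"
  let ?dd = "\<lambda>n \<omega>. dyadic_density (occ S \<omega>) n"
  define B where "B n = 2 ^ (n * CARD('d)) * measure lborel S" for n
  have dd_le: "?dd n \<omega> v \<le> ennreal (B n)" if "\<omega> \<in> space M" for n \<omega> v
  proof -
    have "?dd n \<omega> v \<le> ennreal (2 ^ (n * CARD('d))) * emeasure lborel S"
      using dyadic_density_le[of "occ S \<omega>" n v] occ_finite[OF that S S_fin] by simp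
    also have "\<dots> = ennreal (B n)"
      using S_fin by (simp add: B_def ennreal_mult' emeasure_eq_ennreal_measure)
    finally show ?thesis .
  qed
  define \<Lambda> where "\<Lambda> n p = enn2real (?dd n (snd p) (fst p))" for n p
  have \<Lambda>_measurable [measurable]: "\<Lambda> n \<in> borel_measurable ?P" for n
    unfolding \<Lambda>_def[abs_def] using dyadic_density_occ_measurable[OF S, of n] by measurable
  have \<Lambda>: "ennreal (\<Lambda> n (v, \<omega>)) = ?dd n \<omega> v" if "\<omega> \<in> space M" for n v \<omega>
    using dd_le[OF that, of n v] unfolding \<Lambda>_def by (simp add: ennreal_enn2real_if) (metis ennreal_less_top le_less_trans less_irrefl)
  have \<Lambda>_nonneg: "0 \<le> \<Lambda> n p" for n p by (simp add: \<Lambda>_def)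
  define a where "a n = (\<integral>\<^sup>+\<omega>. energy S n \<omega> \<partial>M)" for n
  \<comment> \<open>Used twice: with a coarser density for \<open>g\<close> to compute products, and
    with the indicator of a cell times an event to identify the limit.\<close>
  have cell: "(\<integral>\<^sup>+p. g (fst p) (snd p) * ennreal (\<Lambda> m p) \<partial>?P) = (\<integral>\<^sup>+\<omega>. \<integral>\<^sup>+v. g v \<omega> \<partial>occ S \<omega> \<partial>M)"
    if g [measurable]: "(\<lambda>p. g (fst p) (snd p)) \<in> borel_measurable ?P"
      and const: "\<And>\<omega> v w. \<omega> \<in> space M \<Longrightarrow> dyadic_index m v = dyadic_index m w \<Longrightarrow> g v \<omega> = g w \<omega>" for g m
  proof -
    have "(\<integral>\<^sup>+p. g (fst p) (snd p) * ennreal (\<Lambda> m p) \<partial>?P) = (\<integral>\<^sup>+\<omega>. \<integral>\<^sup>+v. g v \<omega> * ennreal (\<Lambda> m (v, \<omega>)) \<partial>lborel \<partial>M)"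
      by (subst pair.nn_integral_snd[symmetric]) simp_all
    also have "\<dots> = (\<integral>\<^sup>+\<omega>. \<integral>\<^sup>+v. g v \<omega> \<partial>occ S \<omega> \<partial>M)"
    proof (intro nn_integral_cong)
      fix \<omega> assume \<omega>: "\<omega> \<in> space M"
      have "(\<lambda>v. g v \<omega>) \<in> borel_measurable borel"
        using measurable_compose[OF measurable_Pair2'[OF \<omega>] g] by simp
      then show "(\<integral>\<^sup>+v. g v \<omega> * ennreal (\<Lambda> m (v, \<omega>)) \<partial>lborel) = (\<integral>\<^sup>+v. g v \<omega> \<partial>occ S \<omega>)"
        unfolding \<Lambda>[OF \<omega>]
        by (intro nn_integral_dyadic_density occ_finite \<omega> S S_fin const[OF \<omega>]) simp_all
    qed
    finally show ?thesis .
  qed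
  have prod: "(\<integral>\<^sup>+p. ennreal (\<Lambda> n p * \<Lambda> m p) \<partial>?P) = a n" if "n \<le> m" for n m
  proof -
    have "(\<integral>\<^sup>+p. ennreal (\<Lambda> n p * \<Lambda> m p) \<partial>?P) = (\<integral>\<^sup>+p. ennreal (\<Lambda> n (fst p, snd p)) * ennreal (\<Lambda> m p) \<partial>?P)"
      by (simp add: ennreal_mult' \<Lambda>_nonneg)
    also have "\<dots> = (\<integral>\<^sup>+\<omega>. \<integral>\<^sup>+v. ennreal (\<Lambda> n (v, \<omega>)) \<partial>occ S \<omega> \<partial>M)"
    proof (rule cell)
      fix \<omega> and v w :: "real^'d" assume vw: "dyadic_index m v = dyadic_index m w"
      show "ennreal (\<Lambda> n (v, \<omega>)) = ennreal (\<Lambda> n (w, \<omega>))"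
        using dyadic_density_cong[OF dyadic_index_coarsen[OF that vw], of "occ S \<omega>"] by (simp add: \<Lambda>_def)
    qed simp
    also have "\<dots> = a n"
      unfolding a_def energy_def by (intro nn_integral_cong) (simp add: \<Lambda>)
    finally show ?thesis .
  qed
  obtain A where A: "\<And>n. 0 \<le> A n" "\<And>n. a n = ennreal (A n)"
  proof -
    have "a n < \<infinity>" for n using K by (auto simp: a_def intro: le_less_trans)
    then show ?thesis using that[of "\<lambda>n. enn2real (a n)"] by simp
  qed
  have diff: "(\<integral>\<^sup>+p. ennreal ((\<Lambda> m p - \<Lambda> n p)\<^sup>2) \<partial>?P) = ennreal (A m - A n)" "A n \<le> A m" if "n \<le> m" for n m
  proof -
    let ?I = "\<integral>\<^sup>+p. ennreal ((\<Lambda> m p - \<Lambda> n p)\<^sup>2) \<partial>?P"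
    \<comment> \<open>The square is expanded with sums only, because subtraction on
      \<open>ennreal\<close> is truncated; the cross terms are moved to the other side again once
      all integrals are known to be finite.\<close>
    have "ennreal ((\<Lambda> m p - \<Lambda> n p)\<^sup>2) + (ennreal (\<Lambda> n p * \<Lambda> m p) + ennreal (\<Lambda> n p * \<Lambda> m p))
       = ennreal (\<Lambda> n p * \<Lambda> n p) + ennreal (\<Lambda> m p * \<Lambda> m p)" for p
    proof -
      have "(\<Lambda> m p - \<Lambda> n p)\<^sup>2 + (\<Lambda> n p * \<Lambda> m p + \<Lambda> n p * \<Lambda> m p) = \<Lambda> n p * \<Lambda> n p + \<Lambda> m p * \<Lambda> m p"
        by (simp add: power2_eq_square algebra_simps)
      from arg_cong[OF this, of ennreal] show ?thesis
        by (simp only: ennreal_plus zero_le_power2 mult_nonneg_nonneg add_nonneg_nonneg \<Lambda>_nonneg)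
    qed
    then have "(\<integral>\<^sup>+p. ennreal ((\<Lambda> m p - \<Lambda> n p)\<^sup>2) + (ennreal (\<Lambda> n p * \<Lambda> m p) + ennreal (\<Lambda> n p * \<Lambda> m p)) \<partial>?P)
      = (\<integral>\<^sup>+p. ennreal (\<Lambda> n p * \<Lambda> n p) + ennreal (\<Lambda> m p * \<Lambda> m p) \<partial>?P)" by simp
    then have eq: "?I + (ennreal (A n) + ennreal (A n)) = ennreal (A n) + ennreal (A m)"
      by (simp add: nn_integral_add prod that A(2))
    have "?I \<le> ?I + (ennreal (A n) + ennreal (A n))" by (rule add_increasing2) simp_all
    also have "\<dots> < \<infinity>" unfolding eq by simp
    finally obtain i where i: "0 \<le> i" "?I = ennreal i" by (cases ?I) auto
    have "ennreal (i + (A n + A n)) = ennreal (A n + A m)"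
      using eq unfolding i(2) by (simp only: ennreal_plus add_nonneg_nonneg A(1) i(1))
    then have "i + (A n + A n) = A n + A m" using i A(1) by (subst (asm) ennreal_inj) auto
    then show "?I = ennreal (A m - A n)" "A n \<le> A m" using i by (auto simp: algebra_simps)
  qed
  have "incseq A" using diff(2) by (simp add: incseq_def)
  moreover have "A n \<le> enn2real K" for n
  proof -
    have "ennreal (A n) \<le> K" using K(2)[of n] A(2)[of n] by (simp add: a_def)
    then show ?thesis using K(1) A(1)[of n] by (cases K) auto
  qed
  ultimately obtain Ainf where Ainf: "A \<longlonglongrightarrow> Ainf" "\<And>n. A n \<le> Ainf"
    using incseq_convergent[of A "enn2real K"] by blast
  have "\<exists>N. \<forall>n\<ge>N. Ainf - A n \<le> (1/16) ^ k" for k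
  proof -
    have "eventually (\<lambda>n. Ainf - (1/16) ^ k < A n) sequentially"
      by (rule order_tendstoD(1)[OF Ainf(1)]) simp
    then show ?thesis unfolding eventually_sequentially by (smt (verit))
  qed
  then obtain N where N: "\<And>k n. N k \<le> n \<Longrightarrow> Ainf - A n \<le> (1/16) ^ k" by metis
  \<comment> \<open>The chosen \<open>N\<close> need not be monotone; summing its values makes
    \<open>r\<close> increasing and at least \<open>N\<close>. The summand \<open>k\<close> sends
    \<open>r\<close> to infinity, so that each fixed generation is eventually refined.\<close>
  define r where "r k = k + (\<Sum>i\<le>k. N i)" for k
  have r: "k \<le> r k" "r k \<le> r (Suc k)" "N k \<le> r k" for k
    by (simp_all add: r_def) (metis atMost_iff finite_atMost le_add2 member_le_sum order.refl trans_le_add2 zero_le)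
  obtain G where G [measurable]: "G \<in> borel_measurable ?P" and G_fin: "(\<integral>\<^sup>+p. G p \<partial>?P) < \<infinity>"
    and AE: "AE p in ?P. convergent (\<lambda>k. \<Lambda> (r k) p) \<and> (\<forall>k. ennreal (\<Lambda> (r k) p) \<le> ennreal (\<Lambda> (r 0) p) + 2 * (1 + G p))"
  proof (rule fast_L2_convergence[of "\<lambda>k. \<Lambda> (r k)" ?P])
    show "(\<integral>\<^sup>+p. ennreal ((\<Lambda> (r (Suc k)) p - \<Lambda> (r k) p)\<^sup>2) \<partial>?P) \<le> ennreal ((1/16) ^ k)" for k
      unfolding diff(1)[OF r(2)]
      using N[OF r(3)[of k]] Ainf(2)[of "r (Suc k)"] by (intro ennreal_leI) simp
  qed (rule \<Lambda>_measurable)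
  define L where "L v \<omega> = lim (\<lambda>k. \<Lambda> (r k) (v, \<omega>))" for v \<omega>
  have L_measurable [measurable]: "(\<lambda>p. L (fst p) (snd p)) \<in> borel_measurable ?P"
    unfolding L_def by simp
  have lim: "AE p in ?P. (\<lambda>k. \<Lambda> (r k) p) \<longlonglongrightarrow> L (fst p) (snd p)"
    using AE by eventually_elim (simp add: L_def convergent_LIMSEQ_iff)
  have L2: "(\<integral>\<^sup>+p. ennreal ((L (fst p) (snd p))\<^sup>2) \<partial>?P) < \<infinity>"
  proof -
    have "(\<integral>\<^sup>+p. ennreal ((L (fst p) (snd p))\<^sup>2) \<partial>?P) = (\<integral>\<^sup>+p. liminf (\<lambda>k. ennreal ((\<Lambda> (r k) p)\<^sup>2)) \<partial>?P)"
    proof (rule nn_integral_cong_AE)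
      show "AE p in ?P. ennreal ((L (fst p) (snd p))\<^sup>2) = liminf (\<lambda>k. ennreal ((\<Lambda> (r k) p)\<^sup>2))"
        using lim
      proof eventually_elim
        fix p assume "(\<lambda>k. \<Lambda> (r k) p) \<longlonglongrightarrow> L (fst p) (snd p)"
        then have "(\<lambda>k. ennreal ((\<Lambda> (r k) p)\<^sup>2)) \<longlonglongrightarrow> ennreal ((L (fst p) (snd p))\<^sup>2)"
          by (intro tendsto_ennrealI tendsto_power)
        then show "ennreal ((L (fst p) (snd p))\<^sup>2) = liminf (\<lambda>k. ennreal ((\<Lambda> (r k) p)\<^sup>2))"
          by (intro lim_imp_Liminf[symmetric]) simp_all
      qed
    qed
    also have "\<dots> \<le> liminf (\<lambda>k. \<integral>\<^sup>+p. ennreal ((\<Lambda> (r k) p)\<^sup>2) \<partial>?P)"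
      by (rule nn_integral_liminf) measurable
    also have "\<dots> = liminf (\<lambda>k. a (r k))"
      using prod by (simp add: power2_eq_square)
    also have "\<dots> \<le> K"
      using K(2) unfolding a_def[symmetric] by (intro Liminf_le) simp_all
    finally show ?thesis using K(1) by (rule le_less_trans)
  qed
  \<comment> \<open>On a cell of generation \<open>j\<close> the approximants already have the exact
    occupation mass as soon as \<open>r k\<close> reaches \<open>j\<close>, so one of the two limits
    is eventually constant. The other is dominated convergence, and finite measure of
    \<open>Q \<times> E\<close> makes the constant part of the majorant integrable.\<close>
  have ident: "(\<integral>\<^sup>+p. ennreal (L (fst p) (snd p)) * indicator (Q \<times> E) p \<partial>?P) = (\<integral>\<^sup>+\<omega>. emeasure (occ S \<omega>) Q * indicator E \<omega> \<partial>M)"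
    if E [measurable]: "E \<in> sets M" and Q_def: "Q = {w. dyadic_index j w = c}" for E Q j c
  proof -
    have Q [measurable]: "Q \<in> sets borel" unfolding Q_def by simp
    let ?u = "\<lambda>k p. ennreal (\<Lambda> (r k) p) * indicator (Q \<times> E) p"
    let ?w = "\<lambda>p. (ennreal (\<Lambda> (r 0) p) + 2 * (1 + G p)) * indicator (Q \<times> E) p"
    have "(\<lambda>k. \<integral>\<^sup>+p. ?u k p \<partial>?P) \<longlonglongrightarrow> (\<integral>\<^sup>+p. ennreal (L (fst p) (snd p)) * indicator (Q \<times> E) p \<partial>?P)"
    proof (rule nn_integral_dominated_convergence[where w="?w"])
      show "AE p in ?P. ?u k p \<le> ?w p" for k
        using AE by eventually_elim (auto intro!: mult_right_mono)
      show "AE p in ?P. (\<lambda>k. ?u k p) \<longlonglongrightarrow> ennreal (L (fst p) (snd p)) * indicator (Q \<times> E) p"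
        using lim
      proof eventually_elim
        fix p assume "(\<lambda>k. \<Lambda> (r k) p) \<longlonglongrightarrow> L (fst p) (snd p)"
        then show "(\<lambda>k. ?u k p) \<longlonglongrightarrow> ennreal (L (fst p) (snd p)) * indicator (Q \<times> E) p"
          by (cases "p \<in> Q \<times> E") (auto intro: tendsto_ennrealI)
      qed
      have "(\<integral>\<^sup>+p. ?w p \<partial>?P) \<le> (\<integral>\<^sup>+p. ennreal (B (r 0) + 2) * indicator (Q \<times> E) p + 2 * G p \<partial>?P)"
      proof (rule nn_integral_mono)
        fix p assume "p \<in> space ?P"
        then have "snd p \<in> space M" by (auto simp: space_pair_measure)
        then have "ennreal (\<Lambda> (r 0) (fst p, snd p)) \<le> ennreal (B (r 0))" unfolding \<Lambda>[OF \<open>snd p \<in> space M\<close>] by (rule dd_le)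
        then have "ennreal (\<Lambda> (r 0) p) + 2 * (1 + G p) \<le> ennreal (B (r 0)) + 2 * (1 + G p)"
          by (intro add_right_mono) simp
        also have "\<dots> = ennreal (B (r 0) + 2) + 2 * G p"
          by (simp add: B_def distrib_left add.assoc)
        finally show "?w p \<le> ennreal (B (r 0) + 2) * indicator (Q \<times> E) p + 2 * G p"
          by (cases "p \<in> Q \<times> E") simp_all
      qed
      also have "\<dots> = ennreal (B (r 0) + 2) * emeasure ?P (Q \<times> E) + 2 * (\<integral>\<^sup>+p. G p \<partial>?P)"
        by (simp add: nn_integral_add nn_integral_cmult nn_integral_cmult_indicator)
      also have "emeasure ?P (Q \<times> E) = emeasure lborel Q * emeasure M E"
        by (rule emeasure_pair_measure_Times) simp_all
      also have "ennreal (B (r 0) + 2) * (emeasure lborel Q * emeasure M E) + 2 * (\<integral>\<^sup>+p. G p \<partial>?P) < \<infinity>"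
        using G_fin unfolding Q_def emeasure_dyadic_cell by (auto simp: ennreal_mult_less_top emeasure_eq_measure)
      finally show "(\<integral>\<^sup>+p. ?w p \<partial>?P) < \<infinity>" .
    qed measurable
    moreover have "(\<lambda>k. \<integral>\<^sup>+p. ?u k p \<partial>?P) \<longlonglongrightarrow> (\<integral>\<^sup>+\<omega>. emeasure (occ S \<omega>) Q * indicator E \<omega> \<partial>M)"
    proof (rule tendsto_eventually, unfold eventually_sequentially, intro exI[of _ j] allI impI)
      fix k assume "j \<le> k"
      then have "j \<le> r k" using r(1)[of k] by simp
      have "(\<integral>\<^sup>+p. ?u k p \<partial>?P) = (\<integral>\<^sup>+p. (indicator Q (fst p) * indicator E (snd p)) * ennreal (\<Lambda> (r k) p) \<partial>?P)"
        by (intro nn_integral_cong) (auto simp: indicator_def)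
      also have "\<dots> = (\<integral>\<^sup>+\<omega>. \<integral>\<^sup>+v. indicator Q v * indicator E \<omega> \<partial>occ S \<omega> \<partial>M)"
      proof (rule cell)
        show "indicator Q v * indicator E \<omega> = (indicator Q w * indicator E \<omega> :: ennreal)"
          if "dyadic_index (r k) v = dyadic_index (r k) w" for \<omega> v w
          using dyadic_index_coarsen[OF \<open>j \<le> r k\<close> that] by (simp add: Q_def indicator_def)
      qed simp
      also have "\<dots> = (\<integral>\<^sup>+\<omega>. emeasure (occ S \<omega>) Q * indicator E \<omega> \<partial>M)"
      proof (intro nn_integral_cong)
        fix \<omega>
        have m: "Q \<in> sets (occ S \<omega>)" by simp
        then show "(\<integral>\<^sup>+v. indicator Q v * indicator E \<omega> \<partial>occ S \<omega>) = emeasure (occ S \<omega>) Q * indicator E \<omega>"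
          by (subst nn_integral_multc[OF borel_measurable_indicator[OF m]]) (simp only: nn_integral_indicator)
      qed
      finally show "(\<integral>\<^sup>+p. ?u k p \<partial>?P) = (\<integral>\<^sup>+\<omega>. emeasure (occ S \<omega>) Q * indicator E \<omega> \<partial>M)" .
    qed
    ultimately show ?thesis by (rule LIMSEQ_unique)
  qed
  let ?R = "\<lambda>\<omega> j c. (\<integral>\<^sup>+v. ennreal (L v \<omega>) * indicator {w. dyadic_index j w = c} v \<partial>lborel) = emeasure (occ S \<omega>) {w. dyadic_index j w = c}"
  have cells: "AE \<omega> in M. ?R \<omega> j c" for j c
  proof -
    define Q where "Q = {w :: real^'d. dyadic_index j w = c}"
    have Q [measurable]: "Q \<in> sets borel" unfolding Q_def by simp
    define f where "f \<omega> = (\<integral>\<^sup>+v. ennreal (L v \<omega>) * indicator Q v \<partial>lborel)" for \<omega>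
    define g where "g \<omega> = emeasure (occ S \<omega>) Q" for \<omega>
    have f_measurable [measurable]: "f \<in> borel_measurable M"
    proof -
      have "(\<lambda>q. ennreal (L (snd q) (fst q)) * indicator Q (snd q)) \<in> borel_measurable (M \<Otimes>\<^sub>M lborel)"
        using measurable_compose[OF measurable_pair_swap' L_measurable] by (simp add: split_beta')
      then show ?thesis unfolding f_def[abs_def] by (intro lborel.borel_measurable_nn_integral) (simp add: split_beta')
    qed
    have g_measurable [measurable]: "g \<in> borel_measurable M"
    proof -
      have "(\<lambda>\<omega>. \<integral>\<^sup>+z. indicator Q (X z \<omega>) * indicator S z \<partial>lborel) \<in> borel_measurable M" by measurable
      then show ?thesis unfolding g_def by (subst measurable_cong[OF emeasure_occ]) simp_all
    qed
    \<comment> \<open>Equal integrals over every event force equality almost surely, by uniqueness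
      of densities.\<close>
    have "density M f = density M g"
    proof (rule measure_eqI)
      fix E assume "E \<in> sets (density M f)"
      then have E [measurable]: "E \<in> sets M" by simp
      have "emeasure (density M f) E = (\<integral>\<^sup>+\<omega>. f \<omega> * indicator E \<omega> \<partial>M)" by (rule emeasure_density) simp_all
      also have "\<dots> = (\<integral>\<^sup>+\<omega>. \<integral>\<^sup>+v. ennreal (L v \<omega>) * indicator (Q \<times> E) (v, \<omega>) \<partial>lborel \<partial>M)"
      proof (intro nn_integral_cong)
        fix \<omega> assume "\<omega> \<in> space M"
        show "f \<omega> * indicator E \<omega> = (\<integral>\<^sup>+v. ennreal (L v \<omega>) * indicator (Q \<times> E) (v, \<omega>) \<partial>lborel)"
          by (cases "\<omega> \<in> E") (simp_all add: f_def indicator_times)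
      qed
      also have "\<dots> = (\<integral>\<^sup>+p. ennreal (L (fst p) (snd p)) * indicator (Q \<times> E) p \<partial>?P)"
        by (subst pair.nn_integral_snd[symmetric]) simp_all
      also have "\<dots> = emeasure (density M g) E"
        unfolding ident[OF E Q_def] g_def[symmetric] by (rule emeasure_density[symmetric]) simp_all
      finally show "emeasure (density M f) E = emeasure (density M g) E" .
    qed simp
    then have "AE \<omega> in M. f \<omega> = g \<omega>" by (subst (asm) density_unique_iff) simp_all
    then show ?thesis by (simp add: f_def g_def Q_def)
  qed
  \<comment> \<open>Generations and cell labels are countable, so the exceptional null sets can be
    united.\<close>
  then have "AE \<omega> in M. \<forall>j c. ?R \<omega> j c"
    unfolding AE_all_countable by blast
  then have "AE \<omega> in M. occ S \<omega> = density lborel (\<lambda>v. ennreal (L v \<omega>))"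
    using AE_space
  proof eventually_elim
    fix \<omega> assume *: "\<forall>j c. ?R \<omega> j c"
      and \<omega>: "\<omega> \<in> space M"
    have [measurable]: "(\<lambda>v. L v \<omega>) \<in> borel_measurable lborel"
      using measurable_compose[OF measurable_Pair2'[OF \<omega>] L_measurable] by simp
    interpret occ: finite_measure "occ S \<omega>" by (rule occ_finite[OF \<omega> S S_fin])
    show "occ S \<omega> = density lborel (\<lambda>v. ennreal (L v \<omega>))"
      by (rule measure_eqI_dyadic) (simp_all add: * emeasure_density)
  qed
  then have "AE \<omega> in M. (\<lambda>z. X z \<omega>) \<in> borel_measurable (restrict_space lborel S) \<and> occ S \<omega> = density lborel (\<lambda>v. ennreal (L v \<omega>))"
    using AE_space by eventually_elim (auto intro: measurable_restrict_space1)
  then show ?thesis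
    unfolding has_sq_int_local_time_def using L_measurable L2
    by (intro exI[of _ L]) (simp add: split_beta')
qed

end

section \<open>Small balls and local times\<close>

lemma nn_integral_lborel_translate:
  fixes f :: "'k::euclidean_space \<Rightarrow> ennreal"
  assumes [measurable]: "f \<in> borel_measurable borel"
  shows "(\<integral>\<^sup>+x. f (x - z) \<partial>lborel) = (\<integral>\<^sup>+x. f x \<partial>lborel)"
proof -
  have "(\<integral>\<^sup>+x. f (x - z) \<partial>lborel) = (\<integral>\<^sup>+x. f x \<partial>distr lborel borel ((+) (- z)))"
    by (subst nn_integral_distr) simp_all
  then show ?thesis by (simp add: lborel_distr_plus)
qed

lemma nn_integral_norm_diff_powr_cball:
  "(\<integral>\<^sup>+x\<in>cball (z::'k::euclidean_space) R. ennreal (norm (x - z) powr - s) \<partial>lborel)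
     = (\<integral>\<^sup>+x\<in>cball 0 R. ennreal (norm (x::'k) powr - s) \<partial>lborel)"
proof -
  have "indicator (cball z R) x = (indicator (cball 0 R) (x - z) :: ennreal)" for x
    by (simp add: indicator_def dist_norm norm_minus_commute)
  then show ?thesis
    using nn_integral_lborel_translate[of "\<lambda>x. ennreal (norm x powr - s) * indicator (cball 0 R) x" z] by simp
qed

lemma ennreal_mult_le_add_squares: "a * b \<le> a * a + b * (b :: ennreal)"
proof (cases "a \<le> b")
  case True
  then have "a * b \<le> b * b" by (intro mult_right_mono) auto
  then show ?thesis by (simp add: add_increasing)
next
  case False
  then have "a * b \<le> a * a" by (intro mult_left_mono) auto
  then show ?thesis by (simp add: add_increasing2)
qed

text \<open>The factor 2 is the price of using \<open>a * b \<le> a * a + b * b\<close>, an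
  inequality with a proof by cases that also covers infinite values; only finiteness of the constant
  matters later.\<close>

lemma ennreal_sum_square_le:
  fixes a :: "'i \<Rightarrow> ennreal"
  assumes "finite I"
  shows "(\<Sum>i\<in>I. a i) * (\<Sum>i\<in>I. a i) \<le> of_nat (2 * card I) * (\<Sum>i\<in>I. a i * a i)"
proof -
  have "(\<Sum>i\<in>I. a i) * (\<Sum>i\<in>I. a i) = (\<Sum>i\<in>I. \<Sum>j\<in>I. a i * a j)" by (rule sum_product)
  also have "\<dots> \<le> (\<Sum>i\<in>I. \<Sum>j\<in>I. a i * a i + a j * a j)"
    by (intro sum_mono ennreal_mult_le_add_squares)
  also have "\<dots> = of_nat (2 * card I) * (\<Sum>i\<in>I. a i * a i)"
    by (simp add: sum.distrib sum_distrib_left[symmetric] distrib_right mult.assoc)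
       (simp add: algebra_simps mult_2)
  finally show ?thesis .
qed

text \<open>Closeness coordinate by coordinate: for independent components the probability of such
  an event is a product of one-dimensional small-ball probabilities.\<close>

definition close_in_sup :: "real \<Rightarrow> real^'d \<Rightarrow> real^'d \<Rightarrow> bool" where
  "close_in_sup \<epsilon> v w \<longleftrightarrow> (\<forall>j. \<bar>v $ j - w $ j\<bar> \<le> \<epsilon>)"

lemma close_in_sup_commute: "close_in_sup \<epsilon> v w \<longleftrightarrow> close_in_sup \<epsilon> w v"
  by (simp add: close_in_sup_def abs_minus_commute)

lemma close_in_sup_measurable [measurable (raw)]:
  fixes f g :: "'a \<Rightarrow> real^'d::finite"
  assumes [measurable]: "f \<in> borel_measurable M" "g \<in> borel_measurable M"
  shows "Measurable.pred M (\<lambda>x. close_in_sup \<epsilon> (f x) (g x))"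
  unfolding close_in_sup_def by measurable

lemma close_in_sup_eq_cbox: "{w. close_in_sup \<epsilon> v w} = cbox (\<chi> j. v $ j - \<epsilon>) (\<chi> j. v $ j + \<epsilon>)"
  by (auto simp: close_in_sup_def mem_box_cart abs_le_iff algebra_simps)

lemma emeasure_close_in_sup:
  assumes "0 \<le> \<epsilon>"
  shows "emeasure lborel {w :: real^'d::finite. close_in_sup \<epsilon> v w} = ennreal ((2 * \<epsilon>) ^ CARD('d))"
proof -
  define l u :: "real^'d" where "l = (\<chi> j. v $ j - \<epsilon>)" and "u = (\<chi> j. v $ j + \<epsilon>)"
  have "{w. close_in_sup \<epsilon> v w} = cbox l u"
    unfolding close_in_sup_eq_cbox l_def u_def ..
  moreover have lu: "(u - l) \<bullet> b = 2 * \<epsilon>" "l \<bullet> b \<le> u \<bullet> b" if "b \<in> Basis" for b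
    using that assms by (auto simp: Basis_vec_def l_def u_def inner_axis)
  moreover have "(\<Prod>b\<in>Basis. (u - l) \<bullet> b) = (2 * \<epsilon>) ^ CARD('d)"
    by (subst prod.cong[OF refl lu(1)]) simp_all
  ultimately show ?thesis by (simp add: emeasure_lborel_cbox_eq)
qed

text \<open>A Schur-type estimate: the product \<open>l v * l w\<close> is at most the sum of the
  squares, and the symmetric closeness kernel has total mass
  \<open>(2 * \<epsilon>) ^ CARD('d)\<close> in each row. Negative values of \<open>l\<close> are
  cut off by \<open>ennreal\<close>.\<close>

lemma nn_integral_close_in_sup_le:
  fixes l :: "real^'d::finite \<Rightarrow> real"
  assumes [measurable]: "l \<in> borel_measurable borel" and \<epsilon>: "0 \<le> \<epsilon>"
  shows "(\<integral>\<^sup>+v. \<integral>\<^sup>+w. indicator {q. close_in_sup \<epsilon> (fst q) (snd q)} (v, w)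
      \<partial>density lborel (\<lambda>v. ennreal (l v)) \<partial>density lborel (\<lambda>v. ennreal (l v)))
    \<le> 2 * ennreal ((2 * \<epsilon>) ^ CARD('d)) * (\<integral>\<^sup>+v. ennreal ((l v)\<^sup>2) \<partial>lborel)"
proof -
  define q :: "real^'d \<Rightarrow> real^'d \<Rightarrow> ennreal" where "q v w = indicator {q. close_in_sup \<epsilon> (fst q) (snd q)} (v, w)" for v w
  have q_measurable [measurable]: "case_prod q \<in> borel_measurable (borel \<Otimes>\<^sub>M borel)"
  proof -
    have "Measurable.pred (borel \<Otimes>\<^sub>M borel) (\<lambda>q :: (real^'d) \<times> (real^'d). close_in_sup \<epsilon> (fst q) (snd q))"
      by measurable
    then have "{q :: (real^'d) \<times> (real^'d). close_in_sup \<epsilon> (fst q) (snd q)} \<in> sets (borel \<Otimes>\<^sub>M borel)"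
      by (simp add: pred_def space_pair_measure)
    then show ?thesis by (simp add: q_def split_beta')
  qed
  define m where "m v = ennreal ((l v)\<^sup>2)" for v
  have [measurable]: "m \<in> borel_measurable borel" unfolding m_def[abs_def] by measurable
  have row: "(\<integral>\<^sup>+w. q v w \<partial>lborel) = ennreal ((2 * \<epsilon>) ^ CARD('d))" for v
  proof -
    have "{w. close_in_sup \<epsilon> v w} \<in> sets lborel"
      unfolding close_in_sup_eq_cbox by simp
    then have "(\<integral>\<^sup>+w. indicator {w. close_in_sup \<epsilon> v w} w \<partial>lborel) = ennreal ((2 * \<epsilon>) ^ CARD('d))"
      by (simp only: nn_integral_indicator emeasure_close_in_sup[OF \<epsilon>])
    moreover have "q v = indicator {w. close_in_sup \<epsilon> v w}"
      by (simp add: q_def indicator_def fun_eq_iff)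
    ultimately show ?thesis by simp
  qed
  have q_commute: "q v w = q w v" for v w
    by (simp add: q_def indicator_def close_in_sup_commute)
  have "(\<integral>\<^sup>+v. \<integral>\<^sup>+w. q v w \<partial>density lborel (\<lambda>v. ennreal (l v)) \<partial>density lborel (\<lambda>v. ennreal (l v)))
     = (\<integral>\<^sup>+v. ennreal (l v) * (\<integral>\<^sup>+w. ennreal (l w) * q v w \<partial>lborel) \<partial>lborel)"
  proof (subst nn_integral_density)
    have "(\<lambda>v. \<integral>\<^sup>+w. ennreal (l w) * q v w \<partial>lborel) \<in> borel_measurable lborel"
      using lborel.borel_measurable_nn_integral[of "\<lambda>v w. ennreal (l w) * q v w" lborel] by (simp add: split_beta')
    then show "(\<lambda>v. \<integral>\<^sup>+w. q v w \<partial>density lborel (\<lambda>v. ennreal (l v))) \<in> borel_measurable lborel"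
      by (simp add: nn_integral_density)
  qed (simp_all add: nn_integral_density)
  also have "\<dots> \<le> (\<integral>\<^sup>+v. \<integral>\<^sup>+w. (m v * q v w + m w * q v w) \<partial>lborel \<partial>lborel)"
  proof (rule nn_integral_mono)
    fix v
    have l_sq: "ennreal (l x) * ennreal (l x) \<le> m x" for x
      unfolding m_def by (cases "0 \<le> l x") (simp_all add: power2_eq_square ennreal_mult ennreal_neg)
    have "ennreal (l v) * (\<integral>\<^sup>+w. ennreal (l w) * q v w \<partial>lborel) = (\<integral>\<^sup>+w. (ennreal (l v) * ennreal (l w)) * q v w \<partial>lborel)"
      by (subst nn_integral_cmult[symmetric]) (simp_all add: mult.assoc)
    also have "\<dots> \<le> (\<integral>\<^sup>+w. (m v + m w) * q v w \<partial>lborel)"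
      by (intro nn_integral_mono mult_right_mono order_trans[OF ennreal_mult_le_add_squares] add_mono l_sq) simp_all
    finally show "ennreal (l v) * (\<integral>\<^sup>+w. ennreal (l w) * q v w \<partial>lborel) \<le> (\<integral>\<^sup>+w. m v * q v w + m w * q v w \<partial>lborel)"
      by (simp add: distrib_right)
  qed
  also have "\<dots> = (\<integral>\<^sup>+v. \<integral>\<^sup>+w. m v * q v w \<partial>lborel \<partial>lborel) + (\<integral>\<^sup>+v. \<integral>\<^sup>+w. m w * q v w \<partial>lborel \<partial>lborel)"
  proof (subst nn_integral_add[symmetric])
    show "(\<lambda>v. \<integral>\<^sup>+w. m v * q v w \<partial>lborel) \<in> borel_measurable lborel"
      using lborel.borel_measurable_nn_integral[of "\<lambda>v w. m v * q v w" lborel] by (simp add: split_beta')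
    show "(\<lambda>v. \<integral>\<^sup>+w. m w * q v w \<partial>lborel) \<in> borel_measurable lborel"
      using lborel.borel_measurable_nn_integral[of "\<lambda>v w. m w * q v w" lborel] by (simp add: split_beta')
  qed (simp add: nn_integral_add)
  also have "(\<integral>\<^sup>+v. \<integral>\<^sup>+w. m w * q v w \<partial>lborel \<partial>lborel) = (\<integral>\<^sup>+w. \<integral>\<^sup>+v. m w * q v w \<partial>lborel \<partial>lborel)"
    by (rule lborel_pair.Fubini') (simp add: split_beta')
  also have "\<dots> = (\<integral>\<^sup>+v. \<integral>\<^sup>+w. m v * q v w \<partial>lborel \<partial>lborel)"
    by (subst q_commute) (rule refl)
  also have "(\<integral>\<^sup>+v. \<integral>\<^sup>+w. m v * q v w \<partial>lborel \<partial>lborel) = (\<integral>\<^sup>+v. m v * ennreal ((2 * \<epsilon>) ^ CARD('d)) \<partial>lborel)"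
    by (simp add: nn_integral_cmult row)
  also have "\<dots> = (\<integral>\<^sup>+v. m v \<partial>lborel) * ennreal ((2 * \<epsilon>) ^ CARD('d))"
    by (rule nn_integral_multc) simp
  finally show ?thesis unfolding q_def m_def by (simp add: mult_2 algebra_simps)
qed

context measurable_random_field
begin

sublocale param: pair_sigma_finite "lborel :: 'k measure" M ..

text \<open>Moves expectations of double occupation integrals to pairs of parameters. The kernel of
  dyadic cells gives the energy, the closeness kernel gives the necessary condition.\<close>

lemma nn_integral_occ_pair:
  assumes A [measurable]: "A \<in> sets borel" and q [measurable]: "q \<in> borel_measurable (borel \<Otimes>\<^sub>M borel)"
  shows "(\<integral>\<^sup>+\<omega>. \<integral>\<^sup>+v. \<integral>\<^sup>+w. q (v, w) \<partial>occ A \<omega> \<partial>occ A \<omega> \<partial>M)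
    = (\<integral>\<^sup>+z\<in>A. (\<integral>\<^sup>+z'\<in>A. (\<integral>\<^sup>+\<omega>. q (X z \<omega>, X z' \<omega>) \<partial>M) \<partial>lborel) \<partial>lborel)"
proof -
  let ?J = "\<lambda>z \<omega>. \<integral>\<^sup>+z'. q (X z \<omega>, X z' \<omega>) * indicator A z' \<partial>lborel"
  have inner: "(\<integral>\<^sup>+v. \<integral>\<^sup>+w. q (v, w) \<partial>occ A \<omega> \<partial>occ A \<omega>) = (\<integral>\<^sup>+z. ?J z \<omega> * indicator A z \<partial>lborel)"
    if \<omega>: "\<omega> \<in> space M" for \<omega>
  proof -
    have [measurable]: "(\<lambda>z. X z \<omega>) \<in> borel_measurable borel" using \<omega> by (rule X_section)
    have "(\<integral>\<^sup>+v. \<integral>\<^sup>+w. q (v, w) \<partial>occ A \<omega> \<partial>occ A \<omega>) = (\<integral>\<^sup>+v. \<integral>\<^sup>+z'. q (v, X z' \<omega>) * indicator A z' \<partial>lborel \<partial>occ A \<omega>)"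
      by (intro nn_integral_cong nn_integral_occ[OF \<omega> A]) simp
    also have "\<dots> = (\<integral>\<^sup>+z. ?J z \<omega> * indicator A z \<partial>lborel)"
    proof (rule nn_integral_occ[OF \<omega> A])
      show "(\<lambda>v. \<integral>\<^sup>+z'. q (v, X z' \<omega>) * indicator A z' \<partial>lborel) \<in> borel_measurable borel"
        by (rule lborel.borel_measurable_nn_integral) measurable
    qed
    finally show ?thesis .
  qed
  have m: "(\<lambda>(z, \<omega>). ?J z \<omega>) \<in> borel_measurable (lborel \<Otimes>\<^sub>M M)"
    unfolding split_beta' by (rule lborel.borel_measurable_nn_integral) measurable
  have "(\<integral>\<^sup>+\<omega>. \<integral>\<^sup>+v. \<integral>\<^sup>+w. q (v, w) \<partial>occ A \<omega> \<partial>occ A \<omega> \<partial>M)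
     = (\<integral>\<^sup>+\<omega>. \<integral>\<^sup>+z. ?J z \<omega> * indicator A z \<partial>lborel \<partial>M)"
    by (intro nn_integral_cong inner)
  also have "\<dots> = (\<integral>\<^sup>+z. \<integral>\<^sup>+\<omega>. ?J z \<omega> * indicator A z \<partial>M \<partial>lborel)"
    by (rule param.Fubini') (use m in \<open>simp add: split_beta'\<close>)
  also have "\<dots> = (\<integral>\<^sup>+z. (\<integral>\<^sup>+z'. (\<integral>\<^sup>+\<omega>. q (X z \<omega>, X z' \<omega>) \<partial>M) * indicator A z' \<partial>lborel) * indicator A z \<partial>lborel)"
  proof (intro nn_integral_cong)
    fix z
    have "(\<integral>\<^sup>+\<omega>. ?J z \<omega> * indicator A z \<partial>M)
      = (\<integral>\<^sup>+\<omega>. ?J z \<omega> \<partial>M) * indicator A z"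
      by (rule nn_integral_multc, rule lborel.borel_measurable_nn_integral) measurable
    also have "(\<integral>\<^sup>+\<omega>. ?J z \<omega> \<partial>M) = (\<integral>\<^sup>+z'. \<integral>\<^sup>+\<omega>. q (X z \<omega>, X z' \<omega>) * indicator A z' \<partial>M \<partial>lborel)"
      by (rule param.Fubini') measurable
    also have "\<dots> = (\<integral>\<^sup>+z'. (\<integral>\<^sup>+\<omega>. q (X z \<omega>, X z' \<omega>) \<partial>M) * indicator A z' \<partial>lborel)"
      by (intro nn_integral_cong nn_integral_multc) measurable
    finally show "(\<integral>\<^sup>+\<omega>. ?J z \<omega> * indicator A z \<partial>M)
       = (\<integral>\<^sup>+z'. (\<integral>\<^sup>+\<omega>. q (X z \<omega>, X z' \<omega>) \<partial>M) * indicator A z' \<partial>lborel) * indicator A z" .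
  qed
  finally show ?thesis .
qed

abbreviation "close_event \<epsilon> z z' \<equiv> {\<omega> \<in> space M. close_in_sup \<epsilon> (X z \<omega>) (X z' \<omega>)}"

lemma X_random_variable [measurable]: "X z \<in> borel_measurable M"
  using measurable_compose[OF measurable_Pair1' X_measurable, of z] by simp

text \<open>Two values in the same cell are within \<open>1 / 2 ^ n\<close> of each other. The
  normalization \<open>2 ^ (n * CARD('d))\<close> cancels the power of \<open>\<epsilon>\<close> in
  the small-ball bound, which leaves a bound independent of \<open>n\<close>. The diagonal is a null
  set.\<close>

lemma expected_energy_le:
  assumes A [measurable]: "A \<in> sets borel" and diam: "\<And>z z'. z \<in> A \<Longrightarrow> z' \<in> A \<Longrightarrow> dist z z' \<le> \<rho>"
    and C: "0 \<le> C" "\<And>z z' \<epsilon>. z \<in> A \<Longrightarrow> z' \<in> A \<Longrightarrow> z \<noteq> z' \<Longrightarrow> 0 < \<epsilon> \<Longrightarrow>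
      prob (close_event \<epsilon> z z') \<le> C * (\<epsilon> / norm (z - z') powr \<alpha>) ^ CARD('d)"
  shows "(\<integral>\<^sup>+\<omega>. energy A n \<omega> \<partial>M)
     \<le> emeasure lborel A * (ennreal C * (\<integral>\<^sup>+x\<in>cball 0 \<rho>. ennreal (norm (x::'k) powr - (\<alpha> * real CARD('d))) \<partial>lborel))"
proof -
  let ?s = "\<alpha> * real CARD('d)"
  let ?J = "\<integral>\<^sup>+x\<in>cball 0 \<rho>. ennreal (norm (x::'k) powr - ?s) \<partial>lborel"
  define q :: "(real^'d) \<times> (real^'d) \<Rightarrow> ennreal"
    where "q = (\<lambda>p. ennreal (2 ^ (n * CARD('d))) * indicator {p. dyadic_index n (snd p) = dyadic_index n (fst p)} p)"
  have [measurable]: "q \<in> borel_measurable (borel \<Otimes>\<^sub>M borel)"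
  proof -
    have "Measurable.pred (borel \<Otimes>\<^sub>M borel) (\<lambda>p :: (real^'d) \<times> (real^'d). dyadic_index n (snd p) = dyadic_index n (fst p))"
      by measurable
    then have "{p :: (real^'d) \<times> (real^'d). dyadic_index n (snd p) = dyadic_index n (fst p)} \<in> sets (borel \<Otimes>\<^sub>M borel)"
      by (simp add: pred_def space_pair_measure)
    then show ?thesis unfolding q_def by simp
  qed
  let ?Q = "\<lambda>z z'. \<integral>\<^sup>+\<omega>. q (X z \<omega>, X z' \<omega>) \<partial>M"
  have q_le: "?Q z z' \<le> ennreal C * ennreal (norm (z' - z) powr - ?s)"
    if z: "z \<in> A" "z' \<in> A" "z \<noteq> z'" for z z'
  proof -
    let ?E = "close_event (1 / 2 ^ n) z z'"
    have "?Q z z' \<le> (\<integral>\<^sup>+\<omega>. ennreal (2 ^ (n * CARD('d))) * indicator ?E \<omega> \<partial>M)"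
    proof (intro nn_integral_mono)
      fix \<omega> assume "\<omega> \<in> space M"
      then show "q (X z \<omega>, X z' \<omega>) \<le> ennreal (2 ^ (n * CARD('d))) * indicator ?E \<omega>"
        using dyadic_index_eq_imp_close[of n "X z \<omega>" "X z' \<omega>"]
        by (auto simp: q_def indicator_def close_in_sup_def)
    qed
    also have "\<dots> = ennreal (2 ^ (n * CARD('d))) * emeasure M ?E"
      by (rule nn_integral_cmult_indicator) measurable
    also have "\<dots> = ennreal (2 ^ (n * CARD('d)) * prob ?E)"
      by (simp add: emeasure_eq_measure ennreal_mult')
    also have "\<dots> \<le> ennreal (2 ^ (n * CARD('d)) * (C * ((1 / 2 ^ n) / norm (z - z') powr \<alpha>) ^ CARD('d)))"
      by (intro ennreal_leI mult_left_mono C z) simp_all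
    also have "2 ^ (n * CARD('d)) * (C * ((1 / 2 ^ n) / norm (z - z') powr \<alpha>) ^ CARD('d)) = C * norm (z' - z) powr - ?s"
    proof -
      have "((1 / 2 ^ n) / norm (z - z') powr \<alpha>) ^ CARD('d) = (1 / 2 ^ (n * CARD('d))) * (1 / (norm (z - z') powr \<alpha>) ^ CARD('d))"
        by (simp add: power_divide power_mult power_mult_distrib)
      moreover have "1 / (norm (z - z') powr \<alpha>) ^ CARD('d) = norm (z' - z) powr - ?s"
        using z by (simp add: powr_minus_divide powr_powr norm_minus_commute flip: powr_realpow)
      ultimately show ?thesis by simp
    qed
    also have "ennreal (C * norm (z' - z) powr - ?s) = ennreal C * ennreal (norm (z' - z) powr - ?s)"
      using C by (intro ennreal_mult) auto
    finally show ?thesis .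
  qed
  have "(\<integral>\<^sup>+\<omega>. energy A n \<omega> \<partial>M) = (\<integral>\<^sup>+\<omega>. \<integral>\<^sup>+v. \<integral>\<^sup>+w. q (v, w) \<partial>occ A \<omega> \<partial>occ A \<omega> \<partial>M)"
    unfolding energy_def dyadic_density_def q_def by (simp add: indicator_def)
  also have "\<dots> = (\<integral>\<^sup>+z\<in>A. (\<integral>\<^sup>+z'\<in>A. ?Q z z' \<partial>lborel) \<partial>lborel)"
    by (rule nn_integral_occ_pair) measurable
  also have "\<dots> \<le> (\<integral>\<^sup>+z\<in>A. (ennreal C * ?J) \<partial>lborel)"
  proof (rule nn_integral_mono)
    fix z
    show "(\<integral>\<^sup>+z'\<in>A. ?Q z z' \<partial>lborel) * indicator A z \<le> (ennreal C * ?J) * indicator A z"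
    proof (cases "z \<in> A")
      case True
      have "(\<integral>\<^sup>+z'\<in>A. ?Q z z' \<partial>lborel)
         \<le> (\<integral>\<^sup>+z'. ennreal C * (ennreal (norm (z' - z) powr - ?s) * indicator (cball z \<rho>) z') \<partial>lborel)"
      proof (rule nn_integral_mono_AE)
        show "AE z' in lborel. ?Q z z' * indicator A z' \<le> ennreal C * (ennreal (norm (z' - z) powr - ?s) * indicator (cball z \<rho>) z')"
          using AE_lborel_singleton[of z]
        proof eventually_elim
          fix z' assume "z' \<noteq> z"
          then show "?Q z z' * indicator A z' \<le> ennreal C * (ennreal (norm (z' - z) powr - ?s) * indicator (cball z \<rho>) z')"
            using q_le[OF True, of z'] diam[OF True, of z'] by (cases "z' \<in> A") auto
        qed
      qed
      also have "\<dots> = ennreal C * (\<integral>\<^sup>+z'\<in>cball z \<rho>. ennreal (norm (z' - z) powr - ?s) \<partial>lborel)"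
        by (rule nn_integral_cmult) measurable
      also have "\<dots> = ennreal C * ?J" by (simp only: nn_integral_norm_diff_powr_cball)
      finally show ?thesis using True by simp
    qed simp
  qed
  also have "\<dots> = emeasure lborel A * (ennreal C * ?J)"
    by (subst nn_integral_cmult_indicator) (simp_all add: mult.commute)
  finally show ?thesis .
qed

text \<open>Densities are subadditive over a cover, and the square of a finite sum is controlled by
  the sum of squares. This localizes the energy to pieces on which the small-ball bound
  holds.\<close>

lemma energy_cover_le:
  assumes S: "S \<in> sets borel" "emeasure lborel S < \<infinity>" and I: "finite I" and A: "\<And>i. i \<in> I \<Longrightarrow> A i \<in> sets borel"
    and cover: "S \<subseteq> (\<Union>i\<in>I. A i)" and sub: "\<And>i. i \<in> I \<Longrightarrow> A i \<subseteq> S" and \<omega>: "\<omega> \<in> space M"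
  shows "energy S n \<omega> \<le> of_nat (2 * card I) * (\<Sum>i\<in>I. energy (A i) n \<omega>)"
proof -
  let ?d = "\<lambda>A. dyadic_density (occ A \<omega>) n"
  have A_fin: "emeasure lborel (A i) < \<infinity>" if "i \<in> I" for i
    using emeasure_mono[OF sub[OF that], of lborel] S that A by (auto intro: le_less_trans)
  have meas: "?d (A i) \<in> borel_measurable lborel" if "i \<in> I" for i
    using dyadic_density_measurable[OF occ_finite(1)[OF \<omega> A[OF that] A_fin[OF that]] sets_occ] by simp
  have [measurable]: "(\<lambda>z. X z \<omega>) \<in> borel_measurable borel" using \<omega> by (rule X_section)
  have le: "?d S v \<le> (\<Sum>i\<in>I. ?d (A i) v)" for v
  proof -
    let ?g = "\<lambda>z. ennreal (2 ^ (n * CARD('d))) * indicator {w. dyadic_index n w = dyadic_index n v} (X z \<omega>)"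
    have g: "?g \<in> borel_measurable lborel" by measurable
    have "?d S v = (\<integral>\<^sup>+z. ?g z * indicator S z \<partial>lborel)" by (rule dyadic_density_occ[OF \<omega> S(1)])
    also have "\<dots> \<le> (\<integral>\<^sup>+z. (\<Sum>i\<in>I. ?g z * indicator (A i) z) \<partial>lborel)"
    proof (rule nn_integral_mono)
      fix z
      show "?g z * indicator S z \<le> (\<Sum>i\<in>I. ?g z * indicator (A i) z)"
      proof (cases "z \<in> S")
        case True
        then obtain i where i: "i \<in> I" "z \<in> A i" using cover by auto
        then have "?g z * indicator S z = ?g z * indicator (A i) z" using True by simp
        also have "\<dots> \<le> (\<Sum>i\<in>I. ?g z * indicator (A i) z)"
          by (rule member_le_sum) (use i I in simp_all)
        finally show ?thesis .
      qed simp
    qed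
    also have "\<dots> = (\<Sum>i\<in>I. \<integral>\<^sup>+z. ?g z * indicator (A i) z \<partial>lborel)"
      using A by (intro nn_integral_sum borel_measurable_times_ennreal g borel_measurable_indicator) simp
    also have "\<dots> = (\<Sum>i\<in>I. ?d (A i) v)"
      by (intro sum.cong refl dyadic_density_occ[symmetric] \<omega> A)
    finally show ?thesis .
  qed
  have "energy S n \<omega> = (\<integral>\<^sup>+v. ?d S v * ?d S v \<partial>lborel)" by (rule energy_eq[OF \<omega> S])
  also have "\<dots> \<le> (\<integral>\<^sup>+v. of_nat (2 * card I) * (\<Sum>i\<in>I. ?d (A i) v * ?d (A i) v) \<partial>lborel)"
    by (intro nn_integral_mono order_trans[OF mult_mono ennreal_sum_square_le[OF I]] le) simp_all
  also have "\<dots> = of_nat (2 * card I) * (\<integral>\<^sup>+v. (\<Sum>i\<in>I. ?d (A i) v * ?d (A i) v) \<partial>lborel)"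
    using meas by (intro nn_integral_cmult borel_measurable_sum borel_measurable_times_ennreal) simp_all
  also have "(\<integral>\<^sup>+v. (\<Sum>i\<in>I. ?d (A i) v * ?d (A i) v) \<partial>lborel) = (\<Sum>i\<in>I. \<integral>\<^sup>+v. ?d (A i) v * ?d (A i) v \<partial>lborel)"
    using meas by (intro nn_integral_sum borel_measurable_times_ennreal) simp_all
  also have "\<dots> = (\<Sum>i\<in>I. energy (A i) n \<omega>)"
    by (intro sum.cong refl energy_eq[symmetric] \<omega> A A_fin)
  finally show ?thesis .
qed

lemma energy_measurable:
  assumes A: "A \<in> sets borel" "emeasure lborel A < \<infinity>"
  shows "energy A n \<in> borel_measurable M"
proof -
  note [measurable] = dyadic_density_occ_measurable[OF A(1), of n]
  have "(\<lambda>q. dyadic_density (occ A (fst q)) n (snd q) * dyadic_density (occ A (fst q)) n (snd q)) \<in> borel_measurable (M \<Otimes>\<^sub>M lborel)"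
    using measurable_compose[OF measurable_pair_swap' dyadic_density_occ_measurable[OF A(1), of n]]
    by (intro borel_measurable_times_ennreal) (simp_all add: split_beta')
  then have "(\<lambda>\<omega>. \<integral>\<^sup>+v. dyadic_density (occ A \<omega>) n v * dyadic_density (occ A \<omega>) n v \<partial>lborel) \<in> borel_measurable M"
    by (intro lborel.borel_measurable_nn_integral) (simp add: split_beta')
  then show ?thesis by (subst measurable_cong[OF energy_eq[OF _ A]]) auto
qed

text \<open>The upper small-ball bound is only required for nearby parameters; the parameter set is covered by
  finitely many small balls, and the energy is subadditive up to a constant.\<close>
lemma local_time_of_small_ball:
  assumes S: "compact S" and \<alpha>: "0 \<le> \<alpha>" "\<alpha> * real CARD('d) < real DIM('k)" and \<rho>: "0 < \<rho>"
    and C: "0 \<le> C" "\<And>z z' \<epsilon>. z \<in> S \<Longrightarrow> z' \<in> S \<Longrightarrow> z \<noteq> z' \<Longrightarrow> dist z z' \<le> \<rho> \<Longrightarrow> 0 < \<epsilon> \<Longrightarrow>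
      prob (close_event \<epsilon> z z') \<le> C * (\<epsilon> / norm (z - z') powr \<alpha>) ^ CARD('d)"
  shows "has_sq_int_local_time M X S"
proof -
  have S_borel: "S \<in> sets borel" and S_fin: "emeasure lborel S < \<infinity>"
    using borel_compact[OF S] emeasure_compact_finite[OF S] by simp_all
  let ?J = "\<integral>\<^sup>+x\<in>cball 0 \<rho>. ennreal (norm (x::'k) powr - (\<alpha> * real CARD('d))) \<partial>lborel"
  have J: "?J < \<infinity>"
    using nn_integral_norm_powr_cball_finite[of "\<alpha> * real CARD('d)", where 'k='k] \<alpha>
    by (subst nn_integral_norm_powr_cball_scale[OF \<rho>]) (auto simp: ennreal_mult_less_top)
  \<comment> \<open>Radius \<open>\<rho> / 2\<close> makes any two points of a piece at most
    \<open>\<rho>\<close> apart.\<close>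
  obtain F where F: "finite F" "S \<subseteq> (\<Union>x\<in>F. ball x (\<rho> / 2))"
  proof (rule compactE_image[OF S, of S "\<lambda>x. ball x (\<rho> / 2)"])
    show "S \<subseteq> (\<Union>x\<in>S. ball x (\<rho> / 2))" using \<rho> by auto
  qed auto
  define A where "A x = S \<inter> ball x (\<rho> / 2)" for x
  have A: "A x \<in> sets borel" "A x \<subseteq> S" for x using S_borel by (auto simp: A_def)
  have A_fin: "emeasure lborel (A x) < \<infinity>" for x
    using emeasure_mono[OF A(2)[of x], of lborel] S_borel S_fin by (auto intro: le_less_trans)
  define K where "K = of_nat (2 * card F) * (\<Sum>x\<in>F. emeasure lborel (A x) * (ennreal C * ?J))"
  show ?thesis
  proof (rule local_time_exists[OF S_borel S_fin])
    show "K < \<infinity>"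
      unfolding K_def using A_fin J by (auto simp: ennreal_mult_less_top F(1) of_nat_less_top)
    fix n
    have "(\<integral>\<^sup>+\<omega>. energy S n \<omega> \<partial>M) \<le> (\<integral>\<^sup>+\<omega>. of_nat (2 * card F) * (\<Sum>x\<in>F. energy (A x) n \<omega>) \<partial>M)"
      by (intro nn_integral_mono energy_cover_le S_borel S_fin F(1) A) (use F(2) in \<open>auto simp: A_def\<close>)
    also have "\<dots> = of_nat (2 * card F) * (\<Sum>x\<in>F. \<integral>\<^sup>+\<omega>. energy (A x) n \<omega> \<partial>M)"
      by (subst nn_integral_cmult) (auto intro!: arg_cong[where f="(*) _"] nn_integral_sum borel_measurable_sum energy_measurable A A_fin)
    also have "\<dots> \<le> K"
      unfolding K_def
    proof (intro mult_left_mono sum_mono expected_energy_le A C(1))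
      fix x z z' assume "z \<in> A x" "z' \<in> A x"
      then show dist: "dist z z' \<le> \<rho>"
        using dist_triangle_half_r[of x z \<rho> z'] by (auto simp: A_def)
      fix \<epsilon> :: real assume "z \<noteq> z'" "0 < \<epsilon>"
      then show "prob (close_event \<epsilon> z z') \<le> C * (\<epsilon> / norm (z - z') powr \<alpha>) ^ CARD('d)"
        using dist \<open>z \<in> A x\<close> \<open>z' \<in> A x\<close> by (intro C(2)) (auto simp: A_def)
    qed simp
    finally show "(\<integral>\<^sup>+\<omega>. energy S n \<omega> \<partial>M) \<le> K" .
  qed
qed

lemma close_event_integral_le:
  assumes S [measurable]: "S \<in> sets borel" and lt: "has_sq_int_local_time M X S"
  obtains I where "0 \<le> I" "\<And>\<epsilon>. 0 \<le> \<epsilon> \<Longrightarrow>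
    (\<integral>\<^sup>+z\<in>S. (\<integral>\<^sup>+z'\<in>S. ennreal (prob (close_event \<epsilon> z z')) \<partial>lborel) \<partial>lborel) \<le> ennreal (\<epsilon> ^ CARD('d) * I)"
proof -
  let ?P = "lborel \<Otimes>\<^sub>M M :: ((real^'d) \<times> 'a) measure"
  obtain L where L: "(\<lambda>p. L (fst p) (snd p)) \<in> borel_measurable ?P"
      "(\<integral>\<^sup>+p. ennreal ((L (fst p) (snd p))\<^sup>2) \<partial>?P) < \<infinity>"
      "AE \<omega> in M. occ S \<omega> = density lborel (\<lambda>v. ennreal (L v \<omega>))"
    using lt unfolding has_sq_int_local_time_def by (auto simp: split_beta')
  note [measurable] = L(1)
  obtain J where J: "0 \<le> J" "(\<integral>\<^sup>+p. ennreal ((L (fst p) (snd p))\<^sup>2) \<partial>?P) = ennreal J"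
    using L(2) by (cases "\<integral>\<^sup>+p. ennreal ((L (fst p) (snd p))\<^sup>2) \<partial>?P") auto
  show ?thesis
  proof (rule that[of "2 * 2 ^ CARD('d) * J"])
    show "0 \<le> 2 * 2 ^ CARD('d) * J" using J by simp
    fix \<epsilon> :: real assume \<epsilon>: "0 \<le> \<epsilon>"
    let ?q = "indicator {q. close_in_sup \<epsilon> (fst q) (snd q)} :: (real^'d) \<times> (real^'d) \<Rightarrow> ennreal"
    have "Measurable.pred (borel \<Otimes>\<^sub>M borel) (\<lambda>q :: (real^'d) \<times> (real^'d). close_in_sup \<epsilon> (fst q) (snd q))"
      by measurable
    then have q: "?q \<in> borel_measurable (borel \<Otimes>\<^sub>M borel)"
      by (simp add: pred_def space_pair_measure)
    have "(\<integral>\<^sup>+\<omega>. ?q (X z \<omega>, X z' \<omega>) \<partial>M) = ennreal (prob (close_event \<epsilon> z z'))" for z z'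
    proof -
      have "(\<integral>\<^sup>+\<omega>. ?q (X z \<omega>, X z' \<omega>) \<partial>M) = (\<integral>\<^sup>+\<omega>. indicator (close_event \<epsilon> z z') \<omega> \<partial>M)"
        by (intro nn_integral_cong) (auto simp: indicator_def)
      also have "\<dots> = emeasure M (close_event \<epsilon> z z')" by (rule nn_integral_indicator) measurable
      finally show ?thesis by (simp add: emeasure_eq_measure)
    qed
    then have "(\<integral>\<^sup>+z\<in>S. (\<integral>\<^sup>+z'\<in>S. ennreal (prob (close_event \<epsilon> z z')) \<partial>lborel) \<partial>lborel)
      = (\<integral>\<^sup>+\<omega>. \<integral>\<^sup>+v. \<integral>\<^sup>+w. ?q (v, w) \<partial>occ S \<omega> \<partial>occ S \<omega> \<partial>M)"
      using nn_integral_occ_pair[OF S q] by simp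
    also have "\<dots> \<le> (\<integral>\<^sup>+\<omega>. 2 * ennreal ((2 * \<epsilon>) ^ CARD('d)) * (\<integral>\<^sup>+v. ennreal ((L v \<omega>)\<^sup>2) \<partial>lborel) \<partial>M)"
    proof (rule nn_integral_mono_AE)
      show "AE \<omega> in M. (\<integral>\<^sup>+v. \<integral>\<^sup>+w. ?q (v, w) \<partial>occ S \<omega> \<partial>occ S \<omega>) \<le> 2 * ennreal ((2 * \<epsilon>) ^ CARD('d)) * (\<integral>\<^sup>+v. ennreal ((L v \<omega>)\<^sup>2) \<partial>lborel)"
        using L(3) AE_space
      proof eventually_elim
        fix \<omega> assume "occ S \<omega> = density lborel (\<lambda>v. ennreal (L v \<omega>))" and \<omega>: "\<omega> \<in> space M"
        moreover have "(\<lambda>v. L v \<omega>) \<in> borel_measurable borel"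
          using measurable_compose[OF measurable_Pair2'[OF \<omega>] L(1)] by simp
        ultimately show "(\<integral>\<^sup>+v. \<integral>\<^sup>+w. ?q (v, w) \<partial>occ S \<omega> \<partial>occ S \<omega>) \<le> 2 * ennreal ((2 * \<epsilon>) ^ CARD('d)) * (\<integral>\<^sup>+v. ennreal ((L v \<omega>)\<^sup>2) \<partial>lborel)"
          using nn_integral_close_in_sup_le[of "\<lambda>v. L v \<omega>" \<epsilon>] \<epsilon> by simp
      qed
    qed
    also have "\<dots> = 2 * ennreal ((2 * \<epsilon>) ^ CARD('d)) * (\<integral>\<^sup>+\<omega>. \<integral>\<^sup>+v. ennreal ((L v \<omega>)\<^sup>2) \<partial>lborel \<partial>M)"
    proof (rule nn_integral_cmult)
      have "(\<lambda>q. ennreal ((L (snd q) (fst q))\<^sup>2)) \<in> borel_measurable (M \<Otimes>\<^sub>M lborel)"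
        using measurable_compose[OF measurable_pair_swap' L(1)] by (simp add: split_beta')
      then show "(\<lambda>\<omega>. \<integral>\<^sup>+v. ennreal ((L v \<omega>)\<^sup>2) \<partial>lborel) \<in> borel_measurable M"
        by (intro lborel.borel_measurable_nn_integral) (simp add: split_beta')
    qed
    also have "(\<integral>\<^sup>+\<omega>. \<integral>\<^sup>+v. ennreal ((L v \<omega>)\<^sup>2) \<partial>lborel \<partial>M) = ennreal J"
      unfolding J(2)[symmetric] by (subst pair.nn_integral_snd[symmetric]) simp_all
    also have "2 * ennreal ((2 * \<epsilon>) ^ CARD('d)) * ennreal J = ennreal (\<epsilon> ^ CARD('d) * (2 * 2 ^ CARD('d) * J))"
      using \<epsilon> J by (simp add: ennreal_mult' power_mult_distrib mult_ac)
    finally show "(\<integral>\<^sup>+z\<in>S. (\<integral>\<^sup>+z'\<in>S. ennreal (prob (close_event \<epsilon> z z')) \<partial>lborel) \<partial>lborel) \<le> ennreal (\<epsilon> ^ CARD('d) * (2 * 2 ^ CARD('d) * J))" .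
  qed
qed

end

section \<open>The wave field\<close>

context measurable_random_field
begin

text \<open>Dividing the strip bound of order \<open>\<epsilon> ^ CARD('d)\<close> by that power and
  letting \<open>\<epsilon>\<close> tend to 0 bounds the double integral of
  \<open>norm (z - z') powr - (\<alpha> * d)\<close> over \<open>S \<times> S\<close>. A ball inside
  \<open>S\<close> makes this integral infinite when the exponent reaches the dimension.\<close>

lemma local_time_imp_small_exponent:
  assumes S: "compact S" and int: "interior S \<noteq> {}" and \<alpha>: "0 < \<alpha>" and c: "0 < c" "0 < K"
    "\<And>z z' \<epsilon>. z \<in> S \<Longrightarrow> z' \<in> S \<Longrightarrow> 0 < \<epsilon> \<Longrightarrow> \<epsilon> \<le> K * norm (z - z') powr \<alpha> \<Longrightarrow>
      c * (\<epsilon> / norm (z - z') powr \<alpha>) ^ CARD('d) \<le> prob (close_event \<epsilon> z z')"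
    and lt: "has_sq_int_local_time M X S"
  shows "\<alpha> * real CARD('d) < real DIM('k)"
proof (rule ccontr)
  let ?s = "\<alpha> * real CARD('d)"
  let ?\<nu> = "lborel \<Otimes>\<^sub>M lborel :: ('k \<times> 'k) measure"
  assume "\<not> ?thesis"
  then have s: "real DIM('k) \<le> ?s" by simp
  have S_borel [measurable]: "S \<in> sets borel" using S by (rule borel_compact)
  obtain I where I: "0 \<le> I" "\<And>\<epsilon>. 0 \<le> \<epsilon> \<Longrightarrow>
    (\<integral>\<^sup>+z\<in>S. (\<integral>\<^sup>+z'\<in>S. ennreal (prob (close_event \<epsilon> z z')) \<partial>lborel) \<partial>lborel) \<le> ennreal (\<epsilon> ^ CARD('d) * I)"
    using close_event_integral_le[OF S_borel lt] by blast
  define \<epsilon> where "\<epsilon> n = 1 / real (Suc n)" for n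
  have \<epsilon>: "0 < \<epsilon> n" for n by (simp add: \<epsilon>_def)
  define f where "f p = ennreal (norm (fst p - snd p) powr - ?s) * indicator (S \<times> S) p" for p :: "'k \<times> 'k"
  \<comment> \<open>The pairs on which the small-ball lower bound is available at scale
    \<open>\<epsilon> n\<close>. They increase to the complement of the diagonal, so monotone
    convergence applies.\<close>
  define D where "D n = {p :: 'k \<times> 'k. \<epsilon> n \<le> K * norm (fst p - snd p) powr \<alpha>}" for n
  define h where "h n p = f p * indicator (D n) p" for n p
  have f_measurable [measurable]: "f \<in> borel_measurable ?\<nu>" and [measurable]: "D n \<in> sets ?\<nu>" for n
  proof -
    have "S \<times> S \<in> sets ?\<nu>" by simp
    then show "f \<in> borel_measurable ?\<nu>" unfolding f_def[abs_def] by measurable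
    have "Measurable.pred ?\<nu> (\<lambda>p. \<epsilon> n \<le> K * norm (fst p - snd p) powr \<alpha>)" by measurable
    then show "D n \<in> sets ?\<nu>" by (simp add: D_def pred_def space_pair_measure)
  qed
  have h_measurable [measurable]: "h n \<in> borel_measurable ?\<nu>" for n
    unfolding h_def[abs_def] by measurable
  have bound: "(\<integral>\<^sup>+p. h n p \<partial>?\<nu>) \<le> ennreal (I / c)" for n
  proof -
    let ?k = "c * \<epsilon> n ^ CARD('d)"
    have k: "0 < ?k" using c \<epsilon> by simp
    have pw: "ennreal ?k * h n (z, z') \<le> ennreal (prob (close_event (\<epsilon> n) z z')) * indicator S z' * indicator S z" for z z'
    proof (cases "z \<in> S \<and> z' \<in> S \<and> (z, z') \<in> D n")
      case True
      then have "norm (z - z') powr \<alpha> \<noteq> 0" using \<epsilon>[of n] by (auto simp: D_def)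
      then have "?k * norm (z - z') powr - ?s = c * (\<epsilon> n / norm (z - z') powr \<alpha>) ^ CARD('d)"
        by (simp add: power_divide powr_minus_divide powr_powr flip: powr_realpow)
      also have "\<dots> \<le> prob (close_event (\<epsilon> n) z z')"
        using True by (intro c(3) \<epsilon>) (auto simp: D_def)
      finally show ?thesis
        using True k by (simp add: h_def f_def ennreal_leI flip: ennreal_mult')
    next
      case False
      then have "h n (z, z') = 0" by (auto simp: h_def f_def)
      then show ?thesis by simp
    qed
    have "ennreal ?k * (\<integral>\<^sup>+p. h n p \<partial>?\<nu>) = (\<integral>\<^sup>+p. ennreal ?k * h n p \<partial>?\<nu>)"
      by (rule nn_integral_cmult[symmetric]) (rule h_measurable)
    also have "\<dots> = (\<integral>\<^sup>+z. \<integral>\<^sup>+z'. ennreal ?k * h n (z, z') \<partial>lborel \<partial>lborel)"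
      by (rule lborel.nn_integral_fst[symmetric]) (intro borel_measurable_times_ennreal h_measurable borel_measurable_const)
    also have "\<dots> \<le> (\<integral>\<^sup>+z. \<integral>\<^sup>+z'. ennreal (prob (close_event (\<epsilon> n) z z')) * indicator S z' * indicator S z \<partial>lborel \<partial>lborel)"
      by (intro nn_integral_mono pw)
    also have "\<dots> \<le> (\<integral>\<^sup>+z\<in>S. (\<integral>\<^sup>+z'\<in>S. ennreal (prob (close_event (\<epsilon> n) z z')) \<partial>lborel) \<partial>lborel)"
      by (intro nn_integral_mono) (simp add: indicator_def)
    also have "\<dots> \<le> ennreal (\<epsilon> n ^ CARD('d) * I)" using \<epsilon>[of n] by (intro I(2)) simp
    also have "\<epsilon> n ^ CARD('d) * I = ?k * (I / c)" using c by simp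
    also have "ennreal (?k * (I / c)) = ennreal ?k * ennreal (I / c)" using k by (intro ennreal_mult') simp
    finally have "ennreal ?k * (\<integral>\<^sup>+p. h n p \<partial>?\<nu>) \<le> ennreal ?k * ennreal (I / c)" .
    then show ?thesis
      by (rule ennreal_mult_le_mult_iff[THEN iffD1, rotated 2]) (use c(1) \<epsilon>[of n] in auto)
  qed
  have "incseq h"
  proof (rule incseq_SucI, rule le_funI)
    fix n p
    have "\<epsilon> (Suc n) \<le> \<epsilon> n" by (simp add: \<epsilon>_def frac_le)
    then have "D n \<subseteq> D (Suc n)" by (auto simp: D_def)
    then show "h n p \<le> h (Suc n) p" unfolding h_def by (intro mult_left_mono) (auto simp: indicator_def)
  qed
  \<comment> \<open>On the diagonal \<open>f\<close> vanishes because \<open>0 powr x\<close> is 0,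
    so the supremum dominates \<open>f\<close> everywhere.\<close>
  have f_le: "f p \<le> (SUP n. h n p)" for p
  proof (cases "fst p = snd p")
    case False
    then have "0 < K * norm (fst p - snd p) powr \<alpha>" using c by simp
    then obtain n where "\<epsilon> n < K * norm (fst p - snd p) powr \<alpha>"
      unfolding \<epsilon>_def by (metis nat_approx_posE)
    then have "f p = h n p" by (simp add: h_def D_def)
    then show ?thesis by (metis SUP_upper UNIV_I)
  qed (simp add: f_def)
  have "(\<integral>\<^sup>+p. f p \<partial>?\<nu>) \<le> (\<integral>\<^sup>+p. (SUP n. h n p) \<partial>?\<nu>)" by (intro nn_integral_mono f_le)
  also have "\<dots> = (SUP n. \<integral>\<^sup>+p. h n p \<partial>?\<nu>)"
    by (rule nn_integral_monotone_convergence_SUP[OF \<open>incseq h\<close>]) simp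
  also have "\<dots> \<le> ennreal (I / c)" by (intro SUP_least bound)
  finally have fin: "(\<integral>\<^sup>+p. f p \<partial>?\<nu>) < \<infinity>" by (rule le_less_trans) simp
  obtain z0 R where z0: "0 < R" "cball z0 R \<subseteq> S"
    using int by (auto simp: mem_interior_cball)
  have "(\<integral>\<^sup>+p. f p \<partial>?\<nu>) = (\<integral>\<^sup>+z. \<integral>\<^sup>+z'. f (z, z') \<partial>lborel \<partial>lborel)"
    by (rule lborel.nn_integral_fst[symmetric]) (rule f_measurable)
  also have "\<dots> \<ge> (\<integral>\<^sup>+z. \<infinity> * indicator (cball z0 (R / 2)) z \<partial>lborel)"
  proof (rule nn_integral_mono)
    fix z
    show "\<infinity> * indicator (cball z0 (R / 2)) z \<le> (\<integral>\<^sup>+z'. f (z, z') \<partial>lborel)"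
    proof (cases "z \<in> cball z0 (R / 2)")
      case True
      have sub: "cball z (R / 2) \<subseteq> S"
      proof
        fix y assume "y \<in> cball z (R / 2)"
        then have "dist z0 y \<le> R" using True dist_triangle[of z0 y z] by simp
        then show "y \<in> S" using z0(2) by auto
      qed
      have "z \<in> S" using sub z0(1) by auto
      have "\<infinity> = (\<integral>\<^sup>+z'\<in>cball z (R / 2). ennreal (norm (z' - z) powr - ?s) \<partial>lborel)"
        unfolding nn_integral_norm_diff_powr_cball
        using nn_integral_norm_powr_cball_infinite[OF s, of "R / 2"] z0(1) by simp
      also have "\<dots> \<le> (\<integral>\<^sup>+z'. f (z, z') \<partial>lborel)"
        using sub \<open>z \<in> S\<close> by (intro nn_integral_mono) (auto simp: f_def indicator_def norm_minus_commute)
      finally show ?thesis using True by simp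
    qed simp
  qed
  finally have "\<infinity> * emeasure lborel (cball z0 (R / 2)) < \<infinity>"
    using fin by (subst (asm) nn_integral_cmult_indicator) (auto intro: le_less_trans)
  moreover have "emeasure lborel (cball z0 (R / 2)) \<noteq> 0"
  proof -
    have "unit_ball_vol (real DIM('k)) \<noteq> 0" by (rule less_imp_neq[symmetric]) simp
    then show ?thesis using z0(1) by (simp add: emeasure_cball)
  qed
  ultimately show False by (simp add: ennreal_top_mult)
qed

end

section \<open>Centered Gaussian variables and their small balls\<close>

lemma centered_gaussian_rv_distr:
  assumes "prob_space M" and Y: "centered_gaussian_rv M Y"
  obtains v where "0 \<le> v" "distr M borel Y = distr std_normal_distribution borel (\<lambda>x. sqrt v * x)"
    "integrable M (\<lambda>\<omega>. (Y \<omega>)\<^sup>2)" "(LINT \<omega>|M. (Y \<omega>)\<^sup>2) = v"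
proof -
  interpret prob_space M by fact
  interpret N: real_distribution std_normal_distribution by (rule real_dist_normal_dist)
  obtain v where Ym [measurable]: "Y \<in> borel_measurable M" and v: "0 \<le> v"
    "\<And>\<theta>. char (distr M borel Y) \<theta> = complex_of_real (exp (- (v * \<theta>\<^sup>2) / 2))"
    using Y unfolding centered_gaussian_rv_def by auto
  have sm: "(\<lambda>x. sqrt v * x) \<in> borel_measurable std_normal_distribution" by simp
  \<comment> \<open>The law is identified through its characteristic function as a scaled standard
    normal. No density is used, so \<open>v = 0\<close>, the point mass at 0, is included.\<close>
  have eq: "distr M borel Y = distr std_normal_distribution borel (\<lambda>x. sqrt v * x)"
  proof (rule Levy_uniqueness)
    show "real_distribution (distr M borel Y)" by (intro real_distribution_distr) simp
    show "real_distribution (distr std_normal_distribution borel (\<lambda>x. sqrt v * x))"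
      by (intro N.real_distribution_distr) simp
    show "char (distr M borel Y) = char (distr std_normal_distribution borel (\<lambda>x. sqrt v * x))"
    proof
      fix t
      have "char (distr std_normal_distribution borel (\<lambda>x. sqrt v * x)) t = char std_normal_distribution (t * sqrt v)"
        unfolding char_def by (subst integral_distr[OF sm]) (simp_all add: mult.assoc)
      also have "\<dots> = complex_of_real (exp (- (v * t\<^sup>2) / 2))"
        using v(1) by (simp add: char_std_normal_distribution power_mult_distrib mult.commute)
      finally show "char (distr M borel Y) t = char (distr std_normal_distribution borel (\<lambda>x. sqrt v * x)) t"
        using v(2) by simp
    qed
  qed
  have int2: "integrable std_normal_distribution (\<lambda>x. x\<^sup>2)" "(LINT x|std_normal_distribution. x\<^sup>2) = 1"
    using std_normal_distribution_even_moments[of 1] by (simp_all add: fact_numeral)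
  have "integrable (distr M borel Y) (\<lambda>x. x\<^sup>2)"
    unfolding eq using int2 by (subst integrable_distr_eq[OF sm]) (simp_all add: power_mult_distrib)
  then have "integrable M (\<lambda>\<omega>. (Y \<omega>)\<^sup>2)" by (subst (asm) integrable_distr_eq) simp_all
  moreover have "(LINT \<omega>|M. (Y \<omega>)\<^sup>2) = v"
  proof -
    have "(LINT \<omega>|M. (Y \<omega>)\<^sup>2) = (LINT x|distr M borel Y. x\<^sup>2)" by (subst integral_distr) simp_all
    also have "\<dots> = (LINT x|std_normal_distribution. (sqrt v * x)\<^sup>2)"
      unfolding eq by (subst integral_distr[OF sm]) simp_all
    also have "\<dots> = v" using v(1) int2 by (simp add: power_mult_distrib)
    finally show ?thesis .
  qed
  ultimately show ?thesis using that v(1) eq by blast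
qed

lemma emeasure_std_normal_Icc:
  "emeasure std_normal_distribution {- \<delta>..\<delta>} = (\<integral>\<^sup>+x. ennreal (std_normal_density x) * indicator {- \<delta>..\<delta>} x \<partial>lborel)"
  by (rule emeasure_density) simp_all

lemma std_normal_small_ball_le:
  assumes "0 \<le> \<delta>"
  shows "emeasure std_normal_distribution {- \<delta>..\<delta>} \<le> ennreal (2 * \<delta>)"
proof -
  have le1: "std_normal_density x \<le> 1" for x
  proof -
    have "1 \<le> sqrt (2 * pi)" using pi_gt3 by simp
    moreover have "exp (- x\<^sup>2 / 2) \<le> 1" by simp
    ultimately have "exp (- x\<^sup>2 / 2) \<le> sqrt (2 * pi)" by linarith
    then show ?thesis unfolding std_normal_density_def by (simp add: field_simps)
  qed
  have "emeasure std_normal_distribution {- \<delta>..\<delta>} \<le> (\<integral>\<^sup>+x. indicator {- \<delta>..\<delta>} x \<partial>lborel)"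
    unfolding emeasure_std_normal_Icc using le1 by (intro nn_integral_mono) (auto simp: indicator_def)
  then show ?thesis using assms by simp
qed

lemma std_normal_small_ball_ge:
  assumes \<delta>: "0 \<le> \<delta>" "\<delta> \<le> 1"
  shows "ennreal (2 * std_normal_density 1 * \<delta>) \<le> emeasure std_normal_distribution {- \<delta>..\<delta>}"
proof -
  have "ennreal (2 * std_normal_density 1 * \<delta>) = (\<integral>\<^sup>+x. ennreal (std_normal_density 1) * indicator {- \<delta>..\<delta>} x \<partial>lborel)"
    using \<delta> by (subst nn_integral_cmult_indicator) (simp_all add: mult_ac flip: ennreal_mult')
  also have "\<dots> \<le> emeasure std_normal_distribution {- \<delta>..\<delta>}"
    unfolding emeasure_std_normal_Icc
  proof (rule nn_integral_mono)
    fix x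
    have "std_normal_density 1 \<le> std_normal_density x" if "x \<in> {- \<delta>..\<delta>}"
    proof -
      have "\<bar>x\<bar> \<le> 1" using that \<delta> by auto
      then have "x\<^sup>2 \<le> 1" by (simp add: abs_square_le_1)
      then show ?thesis by (simp add: std_normal_density_def divide_right_mono)
    qed
    then show "ennreal (std_normal_density 1) * indicator {- \<delta>..\<delta>} x \<le> ennreal (std_normal_density x) * indicator {- \<delta>..\<delta>} x"
      by (cases "x \<in> {- \<delta>..\<delta>}") (simp_all add: ennreal_leI)
  qed
  finally show ?thesis .
qed

text \<open>Both estimates compare the set where \<open>sqrt v * x\<close> has modulus at most
  \<open>\<epsilon>\<close> with the interval of radius \<open>\<epsilon> / \<sigma>\<close>. This
  avoids dividing by \<open>sqrt v\<close>, which may be 0 in the second estimate.\<close>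

lemma centered_gaussian_small_ball:
  assumes "prob_space M" and Y: "centered_gaussian_rv M Y" and \<sigma>: "0 < \<sigma>" and \<epsilon>: "0 < \<epsilon>"
  shows "\<sigma>\<^sup>2 \<le> (LINT \<omega>|M. (Y \<omega>)\<^sup>2) \<Longrightarrow> measure M {\<omega> \<in> space M. \<bar>Y \<omega>\<bar> \<le> \<epsilon>} \<le> 2 * (\<epsilon> / \<sigma>)"
    and "(LINT \<omega>|M. (Y \<omega>)\<^sup>2) \<le> \<sigma>\<^sup>2 \<Longrightarrow> \<epsilon> \<le> \<sigma> \<Longrightarrow> 2 * std_normal_density 1 * (\<epsilon> / \<sigma>) \<le> measure M {\<omega> \<in> space M. \<bar>Y \<omega>\<bar> \<le> \<epsilon>}"
proof -
  interpret prob_space M by fact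
  have [measurable]: "Y \<in> borel_measurable M" using Y by (simp add: centered_gaussian_rv_def)
  obtain v where v: "0 \<le> v" "distr M borel Y = distr std_normal_distribution borel (\<lambda>x. sqrt v * x)" "(LINT \<omega>|M. (Y \<omega>)\<^sup>2) = v"
    using centered_gaussian_rv_distr[OF assms(1) Y] by blast
  have "emeasure M {\<omega> \<in> space M. \<bar>Y \<omega>\<bar> \<le> \<epsilon>} = emeasure (distr M borel Y) {- \<epsilon>..\<epsilon>}"
    by (subst emeasure_distr) (auto intro!: arg_cong2[where f=emeasure])
  also have "\<dots> = emeasure std_normal_distribution {x. \<bar>sqrt v * x\<bar> \<le> \<epsilon>}"
    unfolding v(2) by (subst emeasure_distr) (auto intro!: arg_cong2[where f=emeasure])
  finally have eq: "ennreal (prob {\<omega> \<in> space M. \<bar>Y \<omega>\<bar> \<le> \<epsilon>}) = emeasure std_normal_distribution {x. \<bar>sqrt v * x\<bar> \<le> \<epsilon>}"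
    by (simp add: emeasure_eq_measure)
  have set [measurable]: "{x. \<bar>sqrt v * x\<bar> \<le> \<epsilon>} \<in> sets borel" by measurable
  show "prob {\<omega> \<in> space M. \<bar>Y \<omega>\<bar> \<le> \<epsilon>} \<le> 2 * (\<epsilon> / \<sigma>)" if "\<sigma>\<^sup>2 \<le> (LINT \<omega>|M. (Y \<omega>)\<^sup>2)"
  proof -
    have "\<sigma> \<le> sqrt v" using that \<sigma> v by (simp add: real_le_rsqrt)
    have "{x. \<bar>sqrt v * x\<bar> \<le> \<epsilon>} \<subseteq> {- (\<epsilon> / \<sigma>)..\<epsilon> / \<sigma>}"
    proof
      fix x assume "x \<in> {x. \<bar>sqrt v * x\<bar> \<le> \<epsilon>}"
      then have "\<sigma> * \<bar>x\<bar> \<le> \<epsilon>"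
        using mult_right_mono[OF \<open>\<sigma> \<le> sqrt v\<close>, of "\<bar>x\<bar>"] v(1) by (simp add: abs_mult)
      then have "\<bar>x\<bar> \<le> \<epsilon> / \<sigma>" using \<sigma> by (simp add: field_simps)
      then show "x \<in> {- (\<epsilon> / \<sigma>)..\<epsilon> / \<sigma>}" by auto
    qed
    then have "ennreal (prob {\<omega> \<in> space M. \<bar>Y \<omega>\<bar> \<le> \<epsilon>}) \<le> emeasure std_normal_distribution {- (\<epsilon> / \<sigma>)..\<epsilon> / \<sigma>}"
      unfolding eq by (intro emeasure_mono) simp_all
    also have "\<dots> \<le> ennreal (2 * (\<epsilon> / \<sigma>))" using \<epsilon> \<sigma> by (intro std_normal_small_ball_le) simp
    finally show ?thesis using \<epsilon> \<sigma> by simp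
  qed
  show "2 * std_normal_density 1 * (\<epsilon> / \<sigma>) \<le> prob {\<omega> \<in> space M. \<bar>Y \<omega>\<bar> \<le> \<epsilon>}"
    if "(LINT \<omega>|M. (Y \<omega>)\<^sup>2) \<le> \<sigma>\<^sup>2" "\<epsilon> \<le> \<sigma>"
  proof -
    have "sqrt v \<le> \<sigma>" using that \<sigma> v by (simp add: real_le_lsqrt)
    have sub: "{- (\<epsilon> / \<sigma>)..\<epsilon> / \<sigma>} \<subseteq> {x. \<bar>sqrt v * x\<bar> \<le> \<epsilon>}"
    proof
      fix x assume "x \<in> {- (\<epsilon> / \<sigma>)..\<epsilon> / \<sigma>}"
      then have "\<bar>x\<bar> \<le> \<epsilon> / \<sigma>" by auto
      then have "\<sigma> * \<bar>x\<bar> \<le> \<epsilon>" using \<sigma> by (simp add: field_simps)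
      then show "x \<in> {x. \<bar>sqrt v * x\<bar> \<le> \<epsilon>}"
        using mult_right_mono[OF \<open>sqrt v \<le> \<sigma>\<close>, of "\<bar>x\<bar>"] v(1) by (simp add: abs_mult)
    qed
    have "ennreal (2 * std_normal_density 1 * (\<epsilon> / \<sigma>)) \<le> emeasure std_normal_distribution {- (\<epsilon> / \<sigma>)..\<epsilon> / \<sigma>}"
      using \<epsilon> \<sigma> that by (intro std_normal_small_ball_ge) simp_all
    also have "\<dots> \<le> ennreal (prob {\<omega> \<in> space M. \<bar>Y \<omega>\<bar> \<le> \<epsilon>})"
      unfolding eq by (intro emeasure_mono sub) simp
    finally show ?thesis by simp
  qed
qed

section \<open>The solution field: variance of increments, independence and the criterion\<close>

locale wave_field = wave_spectrum H \<beta> c1 c2 h + prob_space M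
  for H \<beta> c1 c2 :: real and h :: "real^'n \<Rightarrow> real" and M :: "'a measure" +
  fixes u :: "'d::finite \<Rightarrow> real \<times> (real^'n) \<Rightarrow> 'a \<Rightarrow> real" and cH :: real
  assumes cH: "0 < cH"
    and u_measurable: "\<And>j. (\<lambda>(p, \<omega>). u j p \<omega>) \<in> borel_measurable (borel \<Otimes>\<^sub>M M)"
    and u_gaussian: "\<And>j. centered_gaussian_field M {p. 0 \<le> fst p} (u j)"
    and u_cov: "\<And>j p q. 0 \<le> fst p \<Longrightarrow> 0 \<le> fst q \<Longrightarrow>
       complex_of_real (expectation (\<lambda>\<omega>. u j p \<omega> * u j q \<omega>)) = wave_cov cH H h p q"
    and u_indep: "indep_vars (\<lambda>_. PiM {p. 0 \<le> fst p} (\<lambda>_. borel)) (\<lambda>j \<omega>. restrict (\<lambda>p. u j p \<omega>) {p. 0 \<le> fst p}) UNIV"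
begin

lemma u_combination_gaussian:
  "finite F \<Longrightarrow> F \<subseteq> {p. 0 \<le> fst p} \<Longrightarrow> centered_gaussian_rv M (\<lambda>\<omega>. \<Sum>z\<in>F. k z * u j z \<omega>)"
  using u_gaussian[of j] unfolding centered_gaussian_field_def by blast

lemma u_increment_gaussian:
  assumes p: "0 \<le> fst p" and q: "0 \<le> fst q"
  shows "centered_gaussian_rv M (\<lambda>\<omega>. u j p \<omega> - u j q \<omega>)"
\<comment> \<open>For \<open>p = q\<close> the set \<open>{p, q}\<close> has one element and cannot
  carry both coefficients 1 and -1; the zero variable is then the empty combination.\<close>
proof (cases "p = q")
  case True
  have "centered_gaussian_rv M (\<lambda>\<omega>. \<Sum>z\<in>{}. (0::real) * u j z \<omega>)"
    by (rule u_combination_gaussian) simp_all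
  then show ?thesis using True by simp
next
  case False
  have "centered_gaussian_rv M (\<lambda>\<omega>. \<Sum>z\<in>{p, q}. (if z = p then 1 else - 1) * u j z \<omega>)"
    by (rule u_combination_gaussian) (use p q in simp_all)
  then show ?thesis using False by simp
qed

lemma u_gaussian_rv:
  assumes "0 \<le> fst p"
  shows "centered_gaussian_rv M (u j p)"
proof -
  have "centered_gaussian_rv M (\<lambda>\<omega>. \<Sum>z\<in>{p}. 1 * u j z \<omega>)"
    by (rule u_combination_gaussian) (use assms in simp_all)
  then show ?thesis by simp
qed

lemma u_increment_variance:
  assumes p: "0 \<le> fst p" and q: "0 \<le> fst q"
  shows "\<exists>v\<ge>0. ennreal v = spectral_dist p q \<and> expectation (\<lambda>\<omega>. (u j p \<omega> - u j q \<omega>)\<^sup>2) = cH * v"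
proof -
  have sq: "integrable M (\<lambda>\<omega>. (u j r \<omega>)\<^sup>2)" "u j r \<in> borel_measurable M" if "0 \<le> fst r" for r
    using centered_gaussian_rv_distr[OF prob_space_axioms u_gaussian_rv[OF that]] u_gaussian_rv[OF that]
    by (blast, simp add: centered_gaussian_rv_def)
  note [measurable] = sq(2)[OF p] sq(2)[OF q]
  have pq: "integrable M (\<lambda>\<omega>. u j p \<omega> * u j q \<omega>)"
  proof (rule Bochner_Integration.integrable_bound[OF Bochner_Integration.integrable_add[OF sq(1)[OF p] sq(1)[OF q]]])
    show "AE \<omega> in M. norm (u j p \<omega> * u j q \<omega>) \<le> norm ((u j p \<omega>)\<^sup>2 + (u j q \<omega>)\<^sup>2)"
    proof (intro AE_I2)
      fix \<omega>
      have "2 * \<bar>u j p \<omega>\<bar> * \<bar>u j q \<omega>\<bar> \<le> (u j p \<omega>)\<^sup>2 + (u j q \<omega>)\<^sup>2"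
        using sum_squares_bound[of "\<bar>u j p \<omega>\<bar>" "\<bar>u j q \<omega>\<bar>"] by simp
      moreover have "0 \<le> \<bar>u j p \<omega>\<bar> * \<bar>u j q \<omega>\<bar>" by simp
      ultimately have "\<bar>u j p \<omega>\<bar> * \<bar>u j q \<omega>\<bar> \<le> (u j p \<omega>)\<^sup>2 + (u j q \<omega>)\<^sup>2" by linarith
      then show "norm (u j p \<omega> * u j q \<omega>) \<le> norm ((u j p \<omega>)\<^sup>2 + (u j q \<omega>)\<^sup>2)" by (simp add: abs_mult)
    qed
  qed simp
  let ?E = "\<lambda>p q. expectation (\<lambda>\<omega>. u j p \<omega> * u j q \<omega>)"
  obtain v where v: "0 \<le> v" "ennreal v = spectral_dist p q"
    "wave_cov cH H h p p - wave_cov cH H h p q - wave_cov cH H h q p + wave_cov cH H h q q = of_real (cH * v)"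
    using wave_cov_increment[OF p q] by blast
  have "expectation (\<lambda>\<omega>. (u j p \<omega> - u j q \<omega>)\<^sup>2) = expectation (\<lambda>\<omega>. (u j p \<omega>)\<^sup>2 + (u j q \<omega>)\<^sup>2 - 2 * (u j p \<omega> * u j q \<omega>))"
    by (simp add: power2_diff mult.assoc)
  also have "\<dots> = ?E p p - ?E p q - ?E q p + ?E q q"
    using sq(1)[OF p] sq(1)[OF q] pq by (simp add: power2_eq_square mult.commute)
  finally have "complex_of_real (expectation (\<lambda>\<omega>. (u j p \<omega> - u j q \<omega>)\<^sup>2)) = of_real (cH * v)"
    using v(3) by (simp only: u_cov[OF p p, of j, symmetric] u_cov[OF p q, of j, symmetric] u_cov[OF q p, of j, symmetric] u_cov[OF q q, of j, symmetric]
        of_real_diff of_real_add)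
  then show ?thesis using v by (auto simp only: of_real_eq_iff)
qed

text \<open>Independence is given for whole component processes. An increment is the image of its
  process under the measurable map \<open>f \<mapsto> f p - f q\<close>, so the increments are
  independent too.\<close>

lemma prob_close_increments:
  assumes p: "0 \<le> fst p" and q: "0 \<le> fst q"
  shows "prob {\<omega> \<in> space M. \<forall>j. \<bar>u j p \<omega> - u j q \<omega>\<bar> \<le> \<epsilon>} = (\<Prod>j\<in>UNIV. prob {\<omega> \<in> space M. \<bar>u j p \<omega> - u j q \<omega>\<bar> \<le> \<epsilon>})"
proof -
  let ?I = "{p :: real \<times> (real^'n). 0 \<le> fst p}"
  have "indep_vars (\<lambda>_. borel) (\<lambda>j \<omega>. (\<lambda>f. f p - f q) (restrict (\<lambda>p. u j p \<omega>) ?I)) UNIV"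
  proof (rule indep_vars_compose2[OF u_indep])
    have "(\<lambda>f. f p) \<in> borel_measurable (PiM ?I (\<lambda>_. borel))" "(\<lambda>f. f q) \<in> borel_measurable (PiM ?I (\<lambda>_. borel))"
      using p q by (auto intro: measurable_component_singleton)
    then show "(\<lambda>f. f p - f q) \<in> borel_measurable (PiM ?I (\<lambda>_. borel :: real measure))"
      by (rule borel_measurable_diff)
  qed
  then have ind: "indep_vars (\<lambda>_. borel) (\<lambda>j \<omega>. u j p \<omega> - u j q \<omega>) UNIV" using p q by simp
  have mem: "x \<in> {- \<epsilon>..\<epsilon>} \<longleftrightarrow> \<bar>x\<bar> \<le> \<epsilon>" for x by auto
  have "prob (\<Inter>j\<in>UNIV. (\<lambda>\<omega>. u j p \<omega> - u j q \<omega>) -` {- \<epsilon>..\<epsilon>} \<inter> space M)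
      = (\<Prod>j\<in>UNIV. prob ((\<lambda>\<omega>. u j p \<omega> - u j q \<omega>) -` {- \<epsilon>..\<epsilon>} \<inter> space M))"
    by (rule indep_varsD_finite[OF ind]) simp_all
  moreover have "(\<Inter>j\<in>UNIV. (\<lambda>\<omega>. u j p \<omega> - u j q \<omega>) -` {- \<epsilon>..\<epsilon>} \<inter> space M) = {\<omega> \<in> space M. \<forall>j. \<bar>u j p \<omega> - u j q \<omega>\<bar> \<le> \<epsilon>}"
    unfolding vimage_def mem by auto
  moreover have "(\<lambda>\<omega>. u j p \<omega> - u j q \<omega>) -` {- \<epsilon>..\<epsilon>} \<inter> space M = {\<omega> \<in> space M. \<bar>u j p \<omega> - u j q \<omega>\<bar> \<le> \<epsilon>}" for j
    unfolding vimage_def mem by auto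
  ultimately show ?thesis by simp
qed

text \<open>The three parameter sets of the theorem are treated at once, as images under an embedding \<open>\<phi>\<close> into
  space-time that distorts distances at most by the factor 2.\<close>
lemma local_time_iff:
  fixes \<phi> :: "'k::euclidean_space \<Rightarrow> real \<times> (real^'n)"
  defines "\<alpha> \<equiv> (2*H + 1 - real CARD('n) + \<beta>) / 2"
  assumes \<phi>_measurable: "\<phi> \<in> borel_measurable borel"
    and ab: "0 < a" "a \<le> b" and \<phi>_time: "\<And>z. z \<in> S \<Longrightarrow> fst (\<phi> z) \<in> {a..b}"
    and \<phi>_dist: "\<And>z z'. norm (z - z') \<le> \<bar>fst (\<phi> z) - fst (\<phi> z')\<bar> + norm (snd (\<phi> z) - snd (\<phi> z'))"
      "\<And>z z'. \<bar>fst (\<phi> z) - fst (\<phi> z')\<bar> + norm (snd (\<phi> z) - snd (\<phi> z')) \<le> 2 * norm (z - z')"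
    and S: "compact S" "interior S \<noteq> {}"
  shows "has_sq_int_local_time M (\<lambda>z \<omega>. \<chi> j. u j (\<phi> z) \<omega>) S \<longleftrightarrow> \<alpha> * real CARD('d) < real DIM('k)"
proof -
  let ?X = "\<lambda>z \<omega>. \<chi> j. u j (\<phi> z) \<omega>"
  have \<alpha>: "0 < \<alpha>" using \<beta> by (simp add: \<alpha>_def)
  interpret F: measurable_random_field M ?X
  proof
    have "(\<lambda>x. u j (\<phi> (fst x)) (snd x)) \<in> borel_measurable (borel \<Otimes>\<^sub>M M)" for j
      using measurable_compose[OF measurable_Pair[OF measurable_compose[OF measurable_fst \<phi>_measurable] measurable_snd] u_measurable, of j]
      by simp
    then show "(\<lambda>(z, \<omega>). ?X z \<omega>) \<in> borel_measurable (borel \<Otimes>\<^sub>M M)"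
      by (subst borel_measurable_euclidean_space) (auto simp: Basis_vec_def inner_axis split_beta')
  qed
  let ?E = "\<lambda>\<epsilon> j z z'. {\<omega> \<in> space M. \<bar>u j (\<phi> z) \<omega> - u j (\<phi> z') \<omega>\<bar> \<le> \<epsilon>}"
  let ?V = "\<lambda>j z z'. expectation (\<lambda>\<omega>. (u j (\<phi> z) \<omega> - u j (\<phi> z') \<omega>)\<^sup>2)"
  have close: "F.close_event \<epsilon> z z' = {\<omega> \<in> space M. \<forall>j. \<bar>u j (\<phi> z) \<omega> - u j (\<phi> z') \<omega>\<bar> \<le> \<epsilon>}" for \<epsilon> z z'
    by (simp add: close_in_sup_def)
  have pos: "0 \<le> fst (\<phi> z)" "fst (\<phi> z) \<in> {0..b}" if "z \<in> S" for z
    using \<phi>_time[OF that] ab by auto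
  let ?\<rho> = "\<lambda>z z'. \<bar>fst (\<phi> z) - fst (\<phi> z')\<bar> + norm (snd (\<phi> z) - snd (\<phi> z'))"
  have sq: "x powr (2 * \<alpha>) = (x powr \<alpha>)\<^sup>2" for x :: real
    by (simp add: power2_eq_square flip: powr_add)
  have exponent: "2*H + 1 - real CARD('n) + \<beta> = 2 * \<alpha>" by (simp add: \<alpha>_def)
  obtain c where c: "0 < c" "\<And>p q. fst p \<in> {a..b} \<Longrightarrow> fst q \<in> {a..b} \<Longrightarrow> p \<noteq> q \<Longrightarrow>
     \<bar>fst p - fst q\<bar> + norm (snd p - snd q) \<le> a / 4 \<Longrightarrow>
     ennreal (c * (\<bar>fst p - fst q\<bar> + norm (snd p - snd q)) powr (2 * \<alpha>)) \<le> spectral_dist p q"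
    using spectral_dist_lower[OF ab] unfolding exponent by blast
  obtain C where C: "0 \<le> C" "\<And>p q. fst p \<in> {0..b} \<Longrightarrow> fst q \<in> {0..b} \<Longrightarrow>
     spectral_dist p q \<le> ennreal (C * (\<bar>fst p - fst q\<bar> + norm (snd p - snd q)) powr (2 * \<alpha>))"
    using spectral_dist_upper[of b] ab unfolding exponent by auto
  show ?thesis
  proof
    assume lt: "has_sq_int_local_time M ?X S"
    \<comment> \<open>\<open>2 powr \<alpha>\<close> absorbs the distortion factor of
      \<open>\<phi>\<close>; the summand 1 keeps \<open>k\<close> positive even if \<open>C\<close>
      is 0.\<close>
    define k where "k = sqrt (cH * C) * 2 powr \<alpha> + 1"
    have k: "0 < k" using cH C by (simp add: k_def add_nonneg_pos)
    show "\<alpha> * real CARD('d) < real DIM('k)"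
    proof (rule F.local_time_imp_small_exponent[OF S \<alpha> _ k _ lt])
      show "0 < (2 * std_normal_density 1 / k) ^ CARD('d)"
        using k by (simp add: normal_density_pos)
      fix z z' \<epsilon> assume z: "z \<in> S" "z' \<in> S" and \<epsilon>: "0 < \<epsilon>" "\<epsilon> \<le> k * norm (z - z') powr \<alpha>"
      define \<sigma> where "\<sigma> = k * norm (z - z') powr \<alpha>"
      have \<sigma>: "0 < \<sigma>" using \<epsilon> by (simp add: \<sigma>_def)
      have "2 * std_normal_density 1 * (\<epsilon> / \<sigma>) \<le> prob (?E \<epsilon> j z z')" for j
      proof (rule centered_gaussian_small_ball(2)[OF prob_space_axioms u_increment_gaussian \<sigma> \<epsilon>(1)])
        obtain v where v: "0 \<le> v" "ennreal v = spectral_dist (\<phi> z) (\<phi> z')" "?V j z z' = cH * v"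
          using u_increment_variance[OF pos(1)[OF z(1)] pos(1)[OF z(2)]] by blast
        have "ennreal v \<le> ennreal (C * ?\<rho> z z' powr (2 * \<alpha>))"
          unfolding v(2) by (intro C(2) pos z)
        then have "v \<le> C * ?\<rho> z z' powr (2 * \<alpha>)" using C(1) by (simp add: ennreal_le_iff)
        also have "\<dots> \<le> C * (2 * norm (z - z')) powr (2 * \<alpha>)"
          using C(1) \<alpha> \<phi>_dist(2) by (intro mult_left_mono powr_mono2) auto
        finally have "cH * v \<le> cH * (C * (2 * norm (z - z')) powr (2 * \<alpha>))" using cH by simp
        also have "\<dots> = (sqrt (cH * C) * 2 powr \<alpha> * norm (z - z') powr \<alpha>)\<^sup>2"
          using cH C(1) by (simp add: sq powr_mult power_mult_distrib)
        also have "\<dots> \<le> \<sigma>\<^sup>2"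
          using cH C(1) unfolding \<sigma>_def k_def by (intro power_mono mult_right_mono) auto
        finally show "?V j z z' \<le> \<sigma>\<^sup>2" unfolding v(3) .
      qed (use \<epsilon>(2) pos z in \<open>auto simp: \<sigma>_def\<close>)
      then have "(\<Prod>j\<in>(UNIV :: 'd set). 2 * std_normal_density 1 * (\<epsilon> / \<sigma>)) \<le> (\<Prod>j\<in>UNIV. prob (?E \<epsilon> j z z'))"
        using \<epsilon>(1) \<sigma> by (intro prod_mono) simp
      also have "\<dots> = prob (F.close_event \<epsilon> z z')"
        unfolding close by (rule prob_close_increments[symmetric]) (use pos z in auto)
      finally show "(2 * std_normal_density 1 / k) ^ CARD('d) * (\<epsilon> / norm (z - z') powr \<alpha>) ^ CARD('d) \<le> prob (F.close_event \<epsilon> z z')"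
        by (simp add: \<sigma>_def flip: power_mult_distrib)
    qed
  next
    assume small: "\<alpha> * real CARD('d) < real DIM('k)"
    define k where "k = sqrt (cH * c)"
    have k: "0 < k" using cH c by (simp add: k_def)
    show "has_sq_int_local_time M ?X S"
    proof (rule F.local_time_of_small_ball[OF S(1) less_imp_le[OF \<alpha>] small])
      \<comment> \<open>\<open>\<phi>\<close> at most doubles distances, so parameters within
        \<open>a / 8\<close> have images within \<open>a / 4\<close>, the range of the variance
        lower bound.\<close>
      show "0 < a / 8" "0 \<le> (2 / k) ^ CARD('d)" using ab k by simp_all
      fix z z' \<epsilon> assume z: "z \<in> S" "z' \<in> S" and ne: "z \<noteq> z'" and d: "dist z z' \<le> a / 8" and \<epsilon>: "(0::real) < \<epsilon>"
      define \<sigma> where "\<sigma> = k * norm (z - z') powr \<alpha>"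
      have \<sigma>: "0 < \<sigma>" using k ne by (simp add: \<sigma>_def)
      have "prob (?E \<epsilon> j z z') \<le> 2 * (\<epsilon> / \<sigma>)" for j
      proof (rule centered_gaussian_small_ball(1)[OF prob_space_axioms u_increment_gaussian \<sigma> \<epsilon>])
        obtain v where v: "0 \<le> v" "ennreal v = spectral_dist (\<phi> z) (\<phi> z')" "?V j z z' = cH * v"
          using u_increment_variance[OF pos(1)[OF z(1)] pos(1)[OF z(2)]] by blast
        have "\<phi> z \<noteq> \<phi> z'" using \<phi>_dist(1)[of z z'] ne by auto
        moreover have "?\<rho> z z' \<le> a / 4" using \<phi>_dist(2)[of z z'] d by (simp add: dist_norm)
        ultimately have "ennreal (c * ?\<rho> z z' powr (2 * \<alpha>)) \<le> ennreal v"
          unfolding v(2) by (intro c(2) \<phi>_time z)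
        then have "c * ?\<rho> z z' powr (2 * \<alpha>) \<le> v" using v(1) by (simp add: ennreal_le_iff)
        moreover have "c * norm (z - z') powr (2 * \<alpha>) \<le> c * ?\<rho> z z' powr (2 * \<alpha>)"
          using c(1) \<alpha> \<phi>_dist(1) by (intro mult_left_mono powr_mono2) auto
        ultimately have "cH * (c * norm (z - z') powr (2 * \<alpha>)) \<le> cH * v" using cH by simp
        then show "\<sigma>\<^sup>2 \<le> ?V j z z'"
          unfolding v(3) using cH c(1) by (simp add: \<sigma>_def k_def sq power_mult_distrib mult.assoc)
      qed (use pos z in auto)
      then have "(\<Prod>j\<in>UNIV. prob (?E \<epsilon> j z z')) \<le> (\<Prod>j\<in>(UNIV :: 'd set). 2 * (\<epsilon> / \<sigma>))"
        by (intro prod_mono) simp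
      moreover have "(\<Prod>j\<in>UNIV. prob (?E \<epsilon> j z z')) = prob (F.close_event \<epsilon> z z')"
        unfolding close by (rule prob_close_increments[symmetric]) (use pos z in auto)
      ultimately show "prob (F.close_event \<epsilon> z z') \<le> (2 / k) ^ CARD('d) * (\<epsilon> / norm (z - z') powr \<alpha>) ^ CARD('d)"
        by (simp add: \<sigma>_def flip: power_mult_distrib)
    qed
  qed
qed

end

theorem theorem4p1:
  fixes M :: "'a measure"
    and u :: "'d::finite \<Rightarrow> real \<times> (real^'n::finite) \<Rightarrow> 'a \<Rightarrow> real"
    and H \<beta> c1 c2 cH a1 b1 :: real
    and h :: "real^'n \<Rightarrow> real"
    and a2 b2 :: "real^'n"
  assumes "prob_space M"
    and "1/2 \<le> H" and "H < 1"
    and "0 < \<beta>" and "\<beta> < real CARD('n)"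
    and "real CARD('n) - 2*H - 1 < \<beta>" and "\<beta> < real CARD('n) - 2*H + 1"
    and "h \<in> borel_measurable borel"
    and "\<And>\<xi>. h \<xi> \<ge> 0"
    and "0 < c1" and "c1 \<le> c2"
    and "\<And>\<xi>. \<xi> \<noteq> 0 \<Longrightarrow> c1 * norm \<xi> powr (- \<beta>) \<le> h \<xi> \<and> h \<xi> \<le> c2 * norm \<xi> powr (- \<beta>)"
    and "0 < cH"
    \<comment> \<open>jointly measurable version of the field\<close>
    and "\<And>j. (\<lambda>(p, \<omega>). u j p \<omega>) \<in> borel_measurable (borel \<Otimes>\<^sub>M M)"
    \<comment> \<open>each component is a centered Gaussian field on [0,oo) x R^N with the given covariance\<close>
    and "\<And>j. centered_gaussian_field M {p. 0 \<le> fst p} (u j)"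
    and "\<And>j p q. 0 \<le> fst p \<Longrightarrow> 0 \<le> fst q \<Longrightarrow>
           complex_of_real (prob_space.expectation M (\<lambda>\<omega>. u j p \<omega> * u j q \<omega>)) = wave_cov cH H h p q"
    \<comment> \<open>the components are independent\<close>
    and "prob_space.indep_vars M (\<lambda>_. PiM {p. 0 \<le> fst p} (\<lambda>_. borel))
           (\<lambda>j \<omega>. restrict (\<lambda>p. u j p \<omega>) {p. 0 \<le> fst p}) UNIV"
    \<comment> \<open>T1 = [a1,b1] a compact interval in (0,oo), T2 = [a2,b2] a compact box in R^N\<close>
    and "0 < a1" and "a1 < b1"
    and "\<And>i. a2 $ i < b2 $ i"
  shows
   "let \<alpha> = (2*H + 1 - real CARD('n) + \<beta>) / 2; d = real CARD('d) in
     (\<forall>x0. has_sq_int_local_time M (\<lambda>t \<omega>. \<chi> j. u j (t, x0) \<omega>) {a1..b1} \<longleftrightarrow> \<alpha> * d < 1) \<and>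
     (\<forall>t0>0. has_sq_int_local_time M (\<lambda>x \<omega>. \<chi> j. u j (t0, x) \<omega>) (cbox a2 b2) \<longleftrightarrow> \<alpha> * d < real CARD('n)) \<and>
     (has_sq_int_local_time M (\<lambda>z \<omega>. \<chi> j. u j z \<omega>) ({a1..b1} \<times> cbox a2 b2) \<longleftrightarrow> \<alpha> * d < 1 + real CARD('n))"
proof -
  interpret prob_space M by fact
  interpret wave_field H \<beta> c1 c2 h M u cH
    by unfold_locales fact+
  have box: "interior (cbox a2 b2) \<noteq> {}"
    using assms(20) by (simp add: interior_cbox box_ne_empty Basis_vec_def inner_axis)
  have time: "interior {a1..b1} \<noteq> {}" using assms(19) by (simp add: interior_atLeastAtMost_real)
  have "has_sq_int_local_time M (\<lambda>t \<omega>. \<chi> j. u j (t, x0) \<omega>) {a1..b1} \<longleftrightarrow> (2*H + 1 - real CARD('n) + \<beta>) / 2 * real CARD('d) < real DIM(real)" for x0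
    using assms(18,19) time by (intro local_time_iff[of "\<lambda>t. (t, x0)" a1 b1]) simp_all
  \<comment> \<open>At a fixed time the time interval degenerates to \<open>a = b = t0\<close>,
    which the criterion admits.\<close>
  moreover have "has_sq_int_local_time M (\<lambda>x \<omega>. \<chi> j. u j (t0, x) \<omega>) (cbox a2 b2) \<longleftrightarrow> (2*H + 1 - real CARD('n) + \<beta>) / 2 * real CARD('d) < real DIM(real^'n)"
    if "0 < t0" for t0
    using that box by (intro local_time_iff[of "\<lambda>x. (t0, x)" t0 t0]) simp_all
  moreover have "has_sq_int_local_time M (\<lambda>z \<omega>. \<chi> j. u j z \<omega>) ({a1..b1} \<times> cbox a2 b2) \<longleftrightarrow> (2*H + 1 - real CARD('n) + \<beta>) / 2 * real CARD('d) < real DIM(real \<times> (real^'n))"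
  proof (rule local_time_iff[of "\<lambda>z. z" a1 b1])
    fix z z' :: "real \<times> (real^'n)"
    show "norm (z - z') \<le> \<bar>fst z - fst z'\<bar> + norm (snd z - snd z')"
      using norm_Pair_le[of "fst z - fst z'" "snd z - snd z'"] by (simp add: minus_prod_def)
    show "\<bar>fst z - fst z'\<bar> + norm (snd z - snd z') \<le> 2 * norm (z - z')"
      using norm_fst_le[of "fst z - fst z'" "snd z - snd z'"] norm_snd_le[of "snd z - snd z'" "fst z - fst z'"] by (simp add: minus_prod_def)
  qed (use assms(18,19) box time in \<open>auto simp: interior_Times compact_Times\<close>)
  ultimately show ?thesis by (simp add: Let_def)
qed

end
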